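(* Let $0<p,q,s,t<\infty$, $n\in\mathbb N\cup\{0\}$, $G\in\mathcal H(\mathbb D)$, $\omega,\nu\in\mathcal D$ and $K=\max\{K(\omega),K(\nu)\}$, where $K(\omega),K(\nu)\in\mathbb N\setminus\{1\}$ are such that, for some constants $C_\omega,C_\nu>1$, $$\widehat\omega(r)\ge C_\omega\,\widehat\omega\left(1-\tfrac{1-r}{K(\omega)}\right),\qquad \widehat\nu(r)\ge C_\nu\,\widehat\nu\left(1-\tfrac{1-r}{K(\nu)}\right),\qquad 0\le r<1.$$ Let $r_j=1-K^{-j}$, $j\in\mathbb N\cup\{0\}$. Then the following conditions are equivalent: (i) There exists a constant $C>0$ such that $$\left(\int_0^1\left(\int_0^{2\pi}|f^{(n)}(re^{i\theta})|^s|G(re^{i\theta})|^s\frac{d\theta}{2\pi}\right)^{\frac ts}\nu(r)\,dr\right)^{\frac1t}\le C\|f\|_{A^{p,q}_\omega}\qquad\text{for all } f\in A^{p,q}_\omega;\tag{1}$$ (ii) The double sequence indexed by $j\in\mathbb N$, $l=0,\dots,K^{j+2}-1$, $$\left\{K^{j(n+\frac1p)}\,\widehat\nu(r_j)^{\frac1t}\,\widehat\omega(r_j)^{-\frac1q}\left(G_{[s]}(r_{j-1})\right)_{K^{j+2},l}\right\}\in\ell^{\,s\left(\frac ps\right)',\,t\left(\frac qt\right)'}.$$ Moreover, with comparison constants independent of $G$, $$\inf\{C>0:\ (1)\text{ holds}\}\asymp\left\|\left\{K^{j(n+\frac1p)}\,\widehat\nu(r_j)^{\frac1t}\,\widehat\omega(r_j)^{-\frac1q}\left(G_{[s]}(r_{j-1})\right)_{K^{j+2},l}\right\}\right\|_{\ell^{s\left(\frac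 ps\right)',t\left(\frac qt\right)'}}.$$
   Context: $\mathbb D$ is the open unit disc and $\mathcal H(\mathbb D)$ the space of analytic functions in $\mathbb D$. $M_p(r,f)=\left(\int_0^{2\pi}|f(re^{i\theta})|^p\frac{d\theta}{2\pi}\right)^{1/p}$ for $0<p<\infty$. A radial weight is the extension $\omega(z)=\omega(|z|)$ to $\mathbb D$ of a non-negative $\omega\in L^1([0,1))$; write $\widehat\omega(z)=\int_{|z|}^1\omega(r)\,dr$ (and similarly $\widehat\nu$), always assumed $>0$ for all $z\in\mathbb D$. $\omega\in\widehat{\mathcal D}$ means there is $C>0$ with $\widehat\omega(r)\le C\widehat\omega\left(\frac{1+r}2\right)$ for $0\le r<1$. $\omega\in\check{\mathcal D}$ means there are $K>1$, $C>1$ with $\widehat\omega(r)\ge C\widehat\omega\left(1-\frac{1-r}K\right)$ for $0\le r<1$. $\mathcal D=\widehat{\mathcal D}\cap\check{\mathcal D}$. For $0<p,q<\infty$, $A^{p,q}_\omega$ is the space of $f\in\mathcal H(\mathbb D)$ with $\|f\|_{A^{p,q}_\omega}^q=\int_0^1M_p^q(r,f)\,\omega(r)\,dr<\infty$. $I_{N,l}=\left[2\pi\frac lN,2\pi\frac{l+1}N\right]$, and $\left(G_{[s]}(r)\right)_{N,l}=\left(\int_{I_{N,l}}|G(re^{i\theta})|^s\frac{d\theta}{2\pi}\right)^{1/s}$. $p'=\frac p{p-1}$ if $p>1$ and $p'=\infty$ if $0<p\le1$. For $0<p,q\le\infty$, $\ell^{p,q}$ is the set of double-indexed complex sequences with $\|\{a_{j,l}\}\|_{\ell^{p,q}}=\big\|\{\|\{a_{j,l}\}_l\|_{\ell^p}\}_j\big\|_{\ell^q}<\infty$.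 $a\asymp b$ means $C^{-1}b\le a\le Cb$ for some constant $C>0$; the infimum of the empty set is $+\infty$. *)

theory Defs
  imports "HOL-Analysis.Analysis" "HOL-Complex_Analysis.Complex_Analysis"
begin

text \<open>
  A radial weight \<open>\<omega>(z) = \<omega>(|z|)\<close> on the unit disc is represented by its radial profile
  \<open>\<omega> :: real \<Rightarrow> real\<close>, of which only the values on \<open>[0,1)\<close> matter. An analytic
  function in the disc is a total function \<open>complex \<Rightarrow> complex\<close> that is holomorphic on
  \<^term>\<open>ball 0 1 :: complex set\<close>; its values elsewhere are never used.
\<close>

definition weight_tail :: "(real \<Rightarrow> real) \<Rightarrow> real \<Rightarrow> real" where
  "weight_tail \<omega> r = integral {r..<1} \<omega>"

definition radial_weight :: "(real \<Rightarrow> real) \<Rightarrow> bool" where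
  "radial_weight \<omega> \<longleftrightarrow>
     (\<forall>r\<in>{0..<1}. 0 \<le> \<omega> r) \<and> \<omega> absolutely_integrable_on {0..<1} \<and>
     (\<forall>r\<in>{0..<1}. 0 < weight_tail \<omega> r)"

definition D_hat :: "(real \<Rightarrow> real) set" where
  "D_hat = {\<omega>. radial_weight \<omega> \<and>
     (\<exists>C>0. \<forall>r\<in>{0..<1}. weight_tail \<omega> r \<le> C * weight_tail \<omega> ((1 + r) / 2))}"

definition D_check :: "(real \<Rightarrow> real) set" where
  "D_check = {\<omega>. radial_weight \<omega> \<and>
     (\<exists>K>1. \<exists>C>1. \<forall>r\<in>{0..<1}. weight_tail \<omega> r \<ge> C * weight_tail \<omega> (1 - (1 - r) / K))}"

definition D_class :: "(real \<Rightarrow> real) set" where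
  "D_class = D_hat \<inter> D_check"

text \<open>Real powers of extended non-negative numbers; only meant for exponents \<open>a > 0\<close>.\<close>

definition epowr :: "ennreal \<Rightarrow> real \<Rightarrow> ennreal" where
  "epowr x a = (if x = top then top else ennreal (enn2real x powr a))"

definition integral_mean :: "real \<Rightarrow> real \<Rightarrow> (complex \<Rightarrow> complex) \<Rightarrow> real" where
  "integral_mean p r f =
     (integral {0..2 * pi} (\<lambda>\<theta>. cmod (f (of_real r * cis \<theta>)) powr p / (2 * pi))) powr (1 / p)"

definition mixed_norm ::
    "real \<Rightarrow> real \<Rightarrow> (real \<Rightarrow> real) \<Rightarrow> (complex \<Rightarrow> complex) \<Rightarrow> ennreal" where
  "mixed_norm p q \<omega> f =
     epowr (\<integral>\<^sup>+r\<in>{0..<1}. ennreal (integral_mean p r f powr q * \<omega> r) \<partial>lebesgue) (1 / q)"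

definition mixed_space ::
    "real \<Rightarrow> real \<Rightarrow> (real \<Rightarrow> real) \<Rightarrow> (complex \<Rightarrow> complex) set" where
  "mixed_space p q \<omega> = {f. f holomorphic_on ball 0 1 \<and> mixed_norm p q \<omega> f < top}"

definition arc :: "nat \<Rightarrow> nat \<Rightarrow> real set" where
  "arc N l = {2 * pi * (real l / real N)..2 * pi * ((real l + 1) / real N)}"

definition arc_mean :: "real \<Rightarrow> (complex \<Rightarrow> complex) \<Rightarrow> real \<Rightarrow> nat \<Rightarrow> nat \<Rightarrow> real" where
  "arc_mean s G r N l =
     (integral (arc N l) (\<lambda>\<theta>. cmod (G (of_real r * cis \<theta>)) powr s / (2 * pi))) powr (1 / s)"

definition conj_exponent :: "real \<Rightarrow> ennreal" where
  "conj_exponent p = (if p > 1 then ennreal (p / (p - 1)) else top)"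

text \<open>
  The \<open>\<ell>\<^sup>p\<close> quasi-norm of a non-negative family over an index set, for \<open>0 < p \<le> \<infinity>\<close>. It takes
  values in \<^typ>\<open>ennreal\<close> so that the inner norm of a mixed sequence may be infinite.
\<close>

definition lp_norm :: "ennreal \<Rightarrow> 'i set \<Rightarrow> ('i \<Rightarrow> ennreal) \<Rightarrow> ennreal" where
  "lp_norm p I a =
     (if p = top then (SUP i\<in>I. a i)
      else epowr (\<integral>\<^sup>+i. epowr (a i) (enn2real p) \<partial>count_space I) (1 / enn2real p))"

text \<open>The inner index \<open>l\<close> ranges over \<open>L j\<close>, which may depend on the outer index \<open>j\<close>.\<close>

definition lpq_norm ::
    "ennreal \<Rightarrow> ennreal \<Rightarrow> 'j set \<Rightarrow> ('j \<Rightarrow> 'l set) \<Rightarrow> ('j \<Rightarrow> 'l \<Rightarrow> complex) \<Rightarrow> ennreal" where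
  "lpq_norm p q J L a = lp_norm q J (\<lambda>j. lp_norm p (L j) (\<lambda>l. ennreal (cmod (a j l))))"

definition lpq_space ::
    "ennreal \<Rightarrow> ennreal \<Rightarrow> 'j set \<Rightarrow> ('j \<Rightarrow> 'l set) \<Rightarrow> ('j \<Rightarrow> 'l \<Rightarrow> complex) set" where
  "lpq_space p q J L = {a. lpq_norm p q J L a < top}"

definition embedding_bound ::
    "real \<Rightarrow> real \<Rightarrow> real \<Rightarrow> real \<Rightarrow> nat \<Rightarrow> (real \<Rightarrow> real) \<Rightarrow> (real \<Rightarrow> real) \<Rightarrow>
      (complex \<Rightarrow> complex) \<Rightarrow> real \<Rightarrow> bool" where
  "embedding_bound p q s t n \<omega> \<nu> G C \<longleftrightarrow>
     (\<forall>f\<in>mixed_space p q \<omega>.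
        epowr (\<integral>\<^sup>+r\<in>{0..<1}. ennreal
           ((integral {0..2 * pi} (\<lambda>\<theta>.
               cmod ((deriv ^^ n) f (of_real r * cis \<theta>)) powr s
               * cmod (G (of_real r * cis \<theta>)) powr s / (2 * pi))) powr (t / s) * \<nu> r)
           \<partial>lebesgue) (1 / t)
        \<le> ennreal C * mixed_norm p q \<omega> f)"

definition radius :: "nat \<Rightarrow> nat \<Rightarrow> real" where
  "radius K j = 1 - 1 / real K ^ j"

definition weighted_arc_means ::
    "real \<Rightarrow> real \<Rightarrow> real \<Rightarrow> real \<Rightarrow> nat \<Rightarrow> (real \<Rightarrow> real) \<Rightarrow> (real \<Rightarrow> real) \<Rightarrow> nat \<Rightarrow>
      (complex \<Rightarrow> complex) \<Rightarrow> nat \<Rightarrow> nat \<Rightarrow> complex" where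
  "weighted_arc_means p q s t n \<omega> \<nu> K G j l = of_real
     (real K powr (real j * (real n + 1 / p))
      * weight_tail \<nu> (radius K j) powr (1 / t)
      * weight_tail \<omega> (radius K j) powr (- (1 / q))
      * arc_mean s G (radius K (j - 1)) (K ^ (j + 2)) l)"

end

theory Submission
  imports Defs
begin

text \<open>
  Write \<open>r\<^sub>j\<close> for \<^term>\<open>radius K j\<close> and \<open>w\<^sub>j\<close> for the tail of a weight at \<open>r\<^sub>j\<close>. The two tails decrease
  geometrically (this is where \<open>K\<close> enters) but at most geometrically (doubling). Hence, for a
  nonnegative nondecreasing \<open>\<Phi>\<close>, the integral of \<open>\<Phi> \<omega>\<close> lies between constant multiples of
  \<open>\<Sum>\<^sub>j w\<^sub>j \<Phi>(r\<^sub>j)\<close> and of \<open>\<Sum>\<^sub>j w\<^sub>j \<Phi>(r\<^sub>j\<^sub>+\<^sub>1)\<close>. Integral means of analytic functions are nondecreasing, for every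
  exponent, because \<open>|f|\<^sup>p\<close> is subharmonic. So both sides of the embedding become sums over \<open>j\<close> of means on
  the circles of radius \<open>r\<^sub>j\<close>, and the theorem says which sequences multiply one mixed sequence space
  into another: if \<open>\<beta>\<^sub>j\<^sub>,\<^sub>l\<close> is the sequence of condition (ii), the best constant in
  \<open>(\<Sum>\<^sub>j (\<Sum>\<^sub>l (x\<^sub>j\<^sub>,\<^sub>l \<beta>\<^sub>j\<^sub>,\<^sub>l)\<^sup>s)\<^sup>t\<^sup>/\<^sup>s)\<^sup>1\<^sup>/\<^sup>t \<le> C \<parallel>x\<parallel>\<close>, with the norm of \<open>x\<close> in \<open>\<ell>\<^sup>p\<^sup>,\<^sup>q\<close>, is exactly the mixed norm of \<open>\<beta>\<close> in (ii),
  by Hoelder's inequality and its equality case (\<open>dual_norm2_Hoelder\<close>, \<open>dual_norm2_attained\<close>).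

  Sufficiency. On the circle of radius \<open>r\<^sub>j\<^sub>-\<^sub>1\<close> split the integral of \<open>|f\<^sup>(\<^sup>n\<^sup>) G|\<^sup>s\<close> over the arcs and bound \<open>f\<^sup>(\<^sup>n\<^sup>)\<close>
  on each arc by a constant \<open>y\<^sub>j\<^sub>,\<^sub>l\<close>. By Cauchy's estimate and the Poisson majorant of \<open>|f|\<^sup>p\<close> on the circle of
  radius \<open>r\<^sub>j\<close>, these constants can be chosen with \<open>\<Sum>\<^sub>l y\<^sub>j\<^sub>,\<^sub>l\<^sup>p\<close> at most a constant times
  \<open>K\<^sup>j\<^sup>(\<^sup>n\<^sup>p\<^sup>+\<^sup>1\<^sup>) M\<^sub>p(r\<^sub>j, f)\<^sup>p\<close>: the Poisson kernels of equally spaced points add up to a multiple of a single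
  Poisson kernel (\<open>sum_poisson_kernel_roots\<close>), which is bounded. Hoelder's inequality for sequences
  finishes this direction (\<open>embedding_of_dual_norm2\<close>).

  Necessity. Given a finite array \<open>x\<close>, test the embedding on
  \<open>f(z) = \<Sum> \<plusminus> \<lambda>\<^sub>j\<^sub>,\<^sub>l (K\<^sup>-\<^sup>j / (1 - cnj a\<^sub>j\<^sub>,\<^sub>l z))\<^sup>M\<close>, where \<open>a\<^sub>j\<^sub>,\<^sub>l\<close> are the left end points of the arcs on the
  circle of radius \<open>r\<^sub>j\<close> and \<open>\<lambda>\<^sub>j\<^sub>,\<^sub>l = K\<^sup>j\<^sup>/\<^sup>p w\<^sub>j\<^sup>-\<^sup>1\<^sup>/\<^sup>q x\<^sub>j\<^sub>,\<^sub>l\<close>, with the tail \<open>w\<^sub>j\<close> of \<open>\<omega>\<close>. For large \<open>M\<close> its norm is at most a constant times the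
  norm of \<open>x\<close>, whatever the signs (\<open>test_function_norm_le\<close>). Averaged over all signs, the left side of the
  embedding is bounded below termwise: flipping the sign of one summand shows that, for at least half of
  the signs, the modulus of the sum is at least that of the summand, and this is enough to bound
  the average of any positive power from below (\<open>sum_powr_ge_of_large_mean\<close>). Choosing \<open>x\<close> extremal for \<open>\<beta>\<close> gives the bound on the mixed norm.
\<close>

section \<open>Circle means and the Poisson kernel\<close>

lemma integral_periodic_shift:
  fixes h :: "real \<Rightarrow> real"
  assumes cont: "continuous_on UNIV h" and per: "\<And>x. h (x + 2 * pi) = h x"
  shows "integral {a..a + 2 * pi} h = integral {0..2 * pi} h"
proof -
  have c: "continuous_on S h" for S using cont continuous_on_subset by blast
  have perk: "h (x + 2 * pi * real k) = h x" for x k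
  proof (induction k)
    case (Suc k)
    have "x + 2 * pi * real (Suc k) = (x + 2 * pi * real k) + 2 * pi" by (simp add: algebra_simps)
    then show ?case using per[of "x + 2 * pi * real k"] Suc by (simp only:)
  qed simp
  have peri: "h (x + 2 * pi * of_int k) = h x" for x k
  proof (cases "k \<ge> 0")
    case True then show ?thesis using perk[of x "nat k"] by simp
  next
    case False
    then show ?thesis using perk[of "x + 2 * pi * of_int k" "nat (-k)"] by simp
  qed
  define k where "k = \<lfloor>a / (2 * pi)\<rfloor>"
  define b where "b = a - 2 * pi * of_int k"
  have "of_int k \<le> a / (2*pi)" "a / (2*pi) < of_int k + 1" unfolding k_def by linarith+
  then have b: "0 \<le> b" "b \<le> 2 * pi" unfolding b_def by (simp_all add: field_simps)
  have "integral {a..a + 2 * pi} h = integral {b..b + 2 * pi} (h \<circ> (\<lambda>x. x + 2 * pi * of_int k))"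
    using integral_shift[of b "2 * pi * of_int k" "b + 2 * pi" h] c by (simp add: b_def)
  also have "h \<circ> (\<lambda>x. x + 2 * pi * of_int k) = h" using peri by auto
  also have "integral {b..b + 2 * pi} h = integral {b..2 * pi} h + integral {2 * pi..b + 2 * pi} h"
    using b by (intro Henstock_Kurzweil_Integration.integral_combine[symmetric] integrable_continuous_real c) auto
  also have "integral {2 * pi..b + 2 * pi} h = integral {0..b} (h \<circ> (\<lambda>x. x + 2 * pi))"
    using integral_shift[of 0 "2 * pi" b h] c by simp
  also have "h \<circ> (\<lambda>x. x + 2 * pi) = h" using per by auto
  also have "integral {b..2 * pi} h + integral {0..b} h = integral {0..2 * pi} h"
    using b by (subst add.commute, intro Henstock_Kurzweil_Integration.integral_combine integrable_continuous_real c) auto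
  finally show ?thesis .
qed

definition circle_mean :: "(complex \<Rightarrow> real) \<Rightarrow> real \<Rightarrow> real" where
  "circle_mean u r = integral {0..2 * pi} (\<lambda>\<theta>. u (of_real r * cis \<theta>)) / (2 * pi)"

abbreviation power_mean :: "real \<Rightarrow> (complex \<Rightarrow> complex) \<Rightarrow> real \<Rightarrow> real" where
  "power_mean p f \<equiv> circle_mean (\<lambda>z. cmod (f z) powr p)"

lemma continuous_on_circle:
  fixes u :: "complex \<Rightarrow> 'a::topological_space"
  assumes "continuous_on (sphere 0 r) u" "0 \<le> r"
  shows "continuous_on A (\<lambda>\<theta>. u (of_real r * cis \<theta>))"
  using assms by (intro continuous_on_compose2[OF assms(1)] continuous_intros) (auto simp: norm_mult)

lemma circle_mean_rotate:
  assumes u: "continuous_on (sphere 0 r) u" and r: "0 \<le> r"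
  shows "circle_mean (\<lambda>z. u (z * cis \<alpha>)) r = circle_mean u r"
proof -
  let ?h = "\<lambda>\<theta>. u (of_real r * cis \<theta>)"
  have c: "continuous_on S ?h" for S using continuous_on_circle[OF u r] .
  have "integral {0..2*pi} (\<lambda>\<theta>. u (of_real r * cis \<theta> * cis \<alpha>)) = integral {0..2*pi} (?h \<circ> (\<lambda>x. x + \<alpha>))"
    by (simp add: o_def cis_mult mult.assoc)
  also have "\<dots> = integral {\<alpha>..\<alpha>+2*pi} ?h"
    using integral_shift[of 0 \<alpha> "2*pi" ?h] c by (simp add: add.commute)
  also have "\<dots> = integral {0..2*pi} ?h"
    by (rule integral_periodic_shift[OF c]) (simp add: cis_mult[symmetric])
  finally show ?thesis by (simp add: circle_mean_def)
qed

lemma circle_mean_mono: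
  assumes u: "continuous_on (sphere 0 r) u" and v: "continuous_on (sphere 0 r) v" and r: "0 \<le> r"
    and le: "\<And>z. cmod z = r \<Longrightarrow> u z \<le> v z"
  shows "circle_mean u r \<le> circle_mean v r"
  unfolding circle_mean_def
  by (intro divide_right_mono integral_le integrable_continuous_real continuous_on_circle u v r le)
     (use r in \<open>auto simp: norm_mult\<close>)

lemma circle_mean_const [simp]: "circle_mean (\<lambda>_. c) r = c"
  by (simp add: circle_mean_def)

lemma circle_mean_cmult: "circle_mean (\<lambda>z. c * u z) r = c * circle_mean u r"
  by (simp add: circle_mean_def)

lemma circle_mean_sum:
  assumes "finite I" "\<And>i. i \<in> I \<Longrightarrow> continuous_on (sphere 0 r) (u i)" "0 \<le> r"
  shows "circle_mean (\<lambda>z. \<Sum>i\<in>I. u i z) r = (\<Sum>i\<in>I. circle_mean (u i) r)"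
  unfolding circle_mean_def using assms
  by (subst integral_sum) (auto intro!: integrable_continuous_real continuous_on_circle simp: sum_divide_distrib)

lemma circle_mean_nonneg:
  assumes "\<And>z. cmod z = \<bar>r\<bar> \<Longrightarrow> 0 \<le> u z"
  shows "0 \<le> circle_mean u r"
proof (cases "(\<lambda>\<theta>. u (of_real r * cis \<theta>)) integrable_on {0..2 * pi}")
  case True
  then show ?thesis unfolding circle_mean_def
    by (intro divide_nonneg_pos Henstock_Kurzweil_Integration.integral_nonneg) (auto simp: assms norm_mult)
qed (simp add: circle_mean_def not_integrable_integral)

lemma mean_value_holomorphic:
  fixes f :: "complex \<Rightarrow> complex"
  assumes cont: "continuous_on (cball z r) f" and hol: "f holomorphic_on ball z r" and r: "0 < r"
  shows "((\<lambda>\<theta>. f (z + of_real r * cis \<theta>)) has_integral 2 * pi * f z) {0..2 * pi}"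
proof -
  have "((\<lambda>u. f u / (u - z)) has_contour_integral (2 * of_real pi * \<i> * f z)) (part_circlepath z r 0 (2*pi))"
    using Cauchy_integral_circlepath[OF cont hol, of z] r by (simp add: circlepath_def)
  then have "((\<lambda>t. f (z + r * cis t) / (r * cis t) * r * \<i> * cis t) has_integral (2 * of_real pi * \<i> * f z)) {0..2*pi}"
    by (subst (asm) has_contour_integral_part_circlepath_iff) auto
  then have "((\<lambda>t. f (z + r * cis t) / (r * cis t) * r * \<i> * cis t * (-\<i>)) has_integral (2 * of_real pi * \<i> * f z * (-\<i>))) {0..2*pi}"
    by (rule has_integral_mult_left)
  moreover have "(\<lambda>t. f (z + r * cis t) / (r * cis t) * r * \<i> * cis t * (-\<i>)) = (\<lambda>t. f (z + r * cis t))"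
    using r by (auto simp: field_simps fun_eq_iff)
  moreover have "2 * of_real pi * \<i> * f z * (-\<i>) = 2 * pi * f z" by (simp add: algebra_simps)
  ultimately show ?thesis by (simp only:)
qed

lemma one_minus_neq_0: "1 - z \<noteq> 0" if "cmod z < 1" for z
  using that by auto

text \<open>
  The Poisson kernel of the disc of radius \<open>R\<close> for the interior point \<open>a\<close>, at the boundary point \<open>z\<close>, is
  \<open>poisson_kernel (cnj a * z / R\<^sup>2)\<close>; with this normalisation a single complex argument suffices.
\<close>

definition poisson_kernel :: "complex \<Rightarrow> real" where
  "poisson_kernel w = (1 - (cmod w)\<^sup>2) / (cmod (1 - w))\<^sup>2"

lemma poisson_kernel_Re:
  assumes "cmod w < 1"
  shows "poisson_kernel w = Re ((1 + w) / (1 - w))"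
proof -
  have "(1 + w) / (1 - w) = (1 + w) * cnj (1 - w) / of_real ((cmod (1 - w))\<^sup>2)"
    by (simp add: complex_div_cnj[of "1+w" "1-w"] complex_norm_square)
  then have "Re ((1 + w) / (1 - w)) = Re ((1 + w) * cnj (1 - w)) / (cmod (1 - w))\<^sup>2"
    by (metis Re_divide_of_real)
  also have "Re ((1 + w) * cnj (1 - w)) = 1 - (cmod w)\<^sup>2"
    unfolding cmod_power2 by (simp add: algebra_simps power2_eq_square)
  finally show ?thesis by (simp add: poisson_kernel_def)
qed

lemma poisson_kernel_nonneg: "cmod w \<le> 1 \<Longrightarrow> 0 \<le> poisson_kernel w"
  by (simp add: poisson_kernel_def power_le_one)

text \<open>
  Each kernel is the real part of \<open>2 / (1 - u) - 1\<close>. Expanding \<open>1 / (1 - u)\<close> into the finite geometric sum over \<open>k <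
  N\<close> with denominator \<open>1 - w\<^sup>N\<close>, only the term \<open>k = 0\<close> survives summation over the roots of unity.
\<close>

lemma sum_poisson_kernel_roots:
  assumes w: "cmod w < 1" and N: "0 < N"
  shows "(\<Sum>m<N. poisson_kernel (w * cis (2 * pi * real m / real N))) = real N * poisson_kernel (w ^ N)"
proof -
  define om where "om m = cis (2 * pi * real m / real N)" for m :: nat
  have omN: "om m ^ N = 1" for m
  proof -
    have "real N * (2 * pi * real m / real N) = 2 * pi * real m" using N by simp
    then have "om m ^ N = cis (2 * pi * real m)" unfolding om_def Complex.DeMoivre by (simp only:)
    also have "\<dots> = 1" by (rule cis_multiple_2pi) auto
    finally show ?thesis .
  qed
  have nm: "cmod (w * om m) < 1" for m using w by (simp add: om_def norm_mult)
  have wN: "cmod (w ^ N) < 1" using w N by (simp add: norm_power power_less_one_iff)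
  have ne: "1 - w ^ N \<noteq> 0" using wN by (rule one_minus_neq_0)
  have ne': "1 - w * om m \<noteq> 0" for m using nm[of m] by (rule one_minus_neq_0)
  have geo: "1 / (1 - w * om m) = (\<Sum>k<N. w ^ k * om m ^ k) / (1 - w ^ N)" for m
  proof -
    have "1 - (w * om m) ^ N = (1 - w * om m) * (\<Sum>k<N. (w * om m) ^ k)"
      by (rule one_diff_power_eq)
    then show ?thesis using ne ne'[of m] by (simp add: power_mult_distrib omN field_simps)
  qed
  have s: "(\<Sum>m<N. om m ^ k) = (if k = 0 then of_nat N else 0)" if "k < N" for k
  proof (cases "k = 0")
    case False
    define q where "q = cis (2 * pi * real k / real N)"
    have eq: "om m ^ k = q ^ m" for m by (simp add: om_def q_def Complex.DeMoivre mult_ac)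
    have "real N * (2 * pi * real k / real N) = 2 * pi * real k" using N by simp
    then have "q ^ N = cis (2 * pi * real k)" unfolding q_def Complex.DeMoivre by (simp only:)
    also have "\<dots> = 1" by (rule cis_multiple_2pi) auto
    finally have "q ^ N = 1" .
    moreover have "q \<noteq> 1"
    proof
      assume "q = 1"
      then have "cos (2 * pi * real k / real N) = 1" by (simp add: q_def complex_eq_iff)
      then obtain n :: int where n: "2 * pi * real k / real N = of_int n * 2 * pi"
        using cos_one_2pi_int by auto
      then have "(2 * pi) * (real k / real N) = (2 * pi) * of_int n" by (simp add: mult_ac)
      then have "real k / real N = of_int n" by (subst (asm) mult_left_cancel) auto
      moreover have "0 < real k / real N" "real k / real N < 1" using False that by auto
      ultimately show False by auto
    qed
    ultimately have "(\<Sum>m<N. q ^ m) = 0" using geometric_sum[of q N] by simp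
    then show ?thesis using False eq by simp
  qed simp
  have "(\<Sum>m<N. 1 / (1 - w * om m)) = (\<Sum>m<N. \<Sum>k<N. w ^ k * om m ^ k) / (1 - w ^ N)"
    by (simp add: geo sum_divide_distrib)
  also have "(\<Sum>m<N. \<Sum>k<N. w ^ k * om m ^ k) = (\<Sum>k<N. w ^ k * (\<Sum>m<N. om m ^ k))"
    by (subst sum.swap) (simp add: sum_distrib_left)
  also have "\<dots> = (\<Sum>k<N. if k = 0 then of_nat N else 0)"
    by (intro sum.cong) (auto simp: s)
  also have "\<dots> = of_nat N" using N by simp
  finally have key: "(\<Sum>m<N. 1 / (1 - w * om m)) = of_nat N / (1 - w ^ N)" .
  have alt: "(1 + u) / (1 - u) = 2 * (1 / (1 - u)) - 1" if "1 - u \<noteq> 0" for u :: complex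
    using that by (simp add: field_simps)
  have "(\<Sum>m<N. poisson_kernel (w * om m)) = Re (\<Sum>m<N. (1 + w * om m) / (1 - w * om m))"
    using nm by (simp add: poisson_kernel_Re)
  also have "(\<Sum>m<N. (1 + w * om m) / (1 - w * om m)) = 2 * (\<Sum>m<N. 1 / (1 - w * om m)) - of_nat N"
    unfolding alt[OF ne'] by (simp add: sum_subtractf sum_distrib_left)
  also have "\<dots> = of_nat N * ((1 + w ^ N) / (1 - w ^ N))"
    unfolding key alt[OF ne] by (simp add: algebra_simps)
  also have "Re \<dots> = real N * poisson_kernel (w ^ N)"
  proof -
    have "Re (of_nat N * X) = real N * Re X" for X by simp
    then show ?thesis unfolding poisson_kernel_Re[OF wN] by blast
  qed
  finally show ?thesis by (simp add: om_def)
qed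

lemma sum_poisson_kernel_roots_le:
  assumes w: "cmod w < 1" and N: "0 < N" and half: "cmod w ^ N \<le> 1 / 2"
  shows "(\<Sum>m<N. poisson_kernel (w * cis (2 * pi * real m / real N))) \<le> 4 * real N"
proof -
  have "poisson_kernel (w ^ N) \<le> 1 / (1/2)\<^sup>2"
    unfolding poisson_kernel_def
  proof (rule frac_le)
    have "1/2 \<le> 1 - cmod (w ^ N)" using half by (simp add: norm_power)
    also have "\<dots> \<le> cmod (1 - w ^ N)" by (metis norm_one norm_triangle_ineq2)
    finally show "(1/2)\<^sup>2 \<le> (cmod (1 - w ^ N))\<^sup>2" by (intro power_mono) auto
  qed auto
  then show ?thesis using sum_poisson_kernel_roots[OF w N] N by (simp add: power2_eq_square)
qed

text \<open>
  The mean value property of \<open>(1 + a z) / (1 - a z)\<close>, which equals 1 at the origin.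
\<close>

lemma circle_mean_poisson_kernel:
  assumes a: "cmod a * r < 1" and r: "0 \<le> r"
  shows "circle_mean (\<lambda>z. poisson_kernel (a * z)) r = 1"
proof (cases "r = 0")
  case True then show ?thesis by (simp add: circle_mean_def poisson_kernel_def)
next
  case False
  then have r: "0 < r" using r by auto
  have lt: "cmod (a * z) < 1" if "cmod z \<le> r" for z
    using that a mult_left_mono[OF that, of "cmod a"] by (simp add: norm_mult)
  have ne: "1 - a * z \<noteq> 0" if "cmod z \<le> r" for z
    using lt[OF that] by (rule one_minus_neq_0)
  let ?f = "\<lambda>z. (1 + a * z) / (1 - a * z)"
  have "((\<lambda>\<theta>. ?f (0 + of_real r * cis \<theta>)) has_integral 2 * pi * ?f 0) {0..2 * pi}"
  proof (rule mean_value_holomorphic)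
    have "1 - a * z \<noteq> 0" if "z \<in> cball 0 r" for z using ne that by simp
    then show "continuous_on (cball 0 r) ?f"
      by (intro continuous_intros ballI)
    have "1 - a * z \<noteq> 0" if "z \<in> ball 0 r" for z using ne[of z] that by simp
    then show "?f holomorphic_on ball 0 r"
      by (intro holomorphic_intros)
  qed (rule r)
  from has_integral_Re[OF this]
  have "((\<lambda>\<theta>. Re (?f (of_real r * cis \<theta>))) has_integral Re (2 * pi * ?f 0)) {0..2 * pi}"
    by (simp only: add_0)
  moreover have "Re (?f (of_real r * cis \<theta>)) = poisson_kernel (a * (of_real r * cis \<theta>))" for \<theta>
    using lt[of "of_real r * cis \<theta>"] r by (simp add: poisson_kernel_Re norm_mult)
  ultimately have "((\<lambda>\<theta>. poisson_kernel (a * (of_real r * cis \<theta>))) has_integral 2 * pi) {0..2*pi}"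
    by simp
  then show ?thesis by (simp add: circle_mean_def integral_unique)
qed

section \<open>Subharmonicity of powers of the modulus\<close>

lemma sum_integral_arcs:
  fixes h :: "real \<Rightarrow> real"
  assumes h: "h integrable_on {0..2 * pi}" and N: "0 < N"
  shows "(\<Sum>l<N. integral (arc N l) h) = integral {0..2 * pi} h"
proof -
  have sub: "h integrable_on {a..b}" if "0 \<le> a" "b \<le> 2 * pi" for a b
    using integrable_on_subinterval[OF h] that by auto
  have le: "2 * pi * (real n / real N) \<le> 2 * pi" if "n \<le> N" for n
    using that N by (simp add: field_simps)
  have "(\<Sum>l<n. integral (arc N l) h) = integral {0..2 * pi * (real n / real N)} h" if "n \<le> N" for n
    using that
  proof (induction n)
    case (Suc n)
    have "integral {0..2 * pi * (real n / real N)} h + integral (arc N n) h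
        = integral {0..2 * pi * ((real n + 1) / real N)} h"
      unfolding arc_def
      using le[OF Suc.prems] N
      by (intro Henstock_Kurzweil_Integration.integral_combine sub)
         (auto simp: divide_right_mono add.commute)
    then show ?case using Suc by (simp add: add.commute)
  qed simp
  from this[of N] show ?thesis using N by simp
qed

lemma powr_norm_continuous_on:
  fixes f :: "'a::topological_space \<Rightarrow> complex"
  assumes "continuous_on S f" "0 < p"
  shows "continuous_on S (\<lambda>z. cmod (f z) powr p)"
  using assms by (intro continuous_on_powr' continuous_intros) auto

text \<open>
  The radii for which the inequality is required may depend on the point: this weak form can be checked with a local branch of the logarithm, and it
  is stable under finite sums.
\<close>

definition locally_submean :: "(complex \<Rightarrow> real) \<Rightarrow> complex \<Rightarrow> bool" where
  "locally_submean u z \<longleftrightarrow> (\<forall>\<^sub>F \<rho> in at_right 0. u z \<le> circle_mean (\<lambda>w. u (z + w)) \<rho>)"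

text \<open>
  At a zero of \<open>f\<close> there is nothing to prove. Elsewhere \<open>f = exp g\<close> nearby, and \<open>|f|\<^sup>p\<close> is the modulus of
  the holomorphic function \<open>exp (p g)\<close>, to which the mean value property applies.
\<close>

lemma locally_submean_powr_norm:
  assumes S: "open S" and f: "f holomorphic_on S" and z: "z \<in> S" and p: "0 < p"
  shows "locally_submean (\<lambda>z. cmod (f z) powr p) z"
proof (cases "f z = 0")
  case True
  then show ?thesis unfolding locally_submean_def
    by (intro always_eventually allI) (auto intro!: circle_mean_nonneg)
next
  case False
  obtain e1 where e1: "e1 > 0" "ball z e1 \<subseteq> S" using S z openE by blast
  have "continuous_on S f" using f holomorphic_on_imp_continuous_on by blast
  then obtain e2 where e2: "e2 > 0" "\<And>y. dist z y < e2 \<Longrightarrow> y \<in> S \<Longrightarrow> f y \<noteq> 0"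
    using continuous_on_avoid[of S f z 0] z False by metis
  define e where "e = min e1 e2"
  have e: "e > 0" "ball z e \<subseteq> S" "\<And>y. y \<in> ball z e \<Longrightarrow> f y \<noteq> 0"
    using e1 e2 unfolding e_def by auto
  have fh: "f holomorphic_on ball z e" using f e holomorphic_on_subset by blast
  obtain g where g: "g holomorphic_on ball z e" "\<And>x. x \<in> ball z e \<Longrightarrow> exp (g x) = f x"
    using holomorphic_logarithm_exists[OF convex_ball open_ball fh e(3), of z] e(1) by (metis centre_in_ball)
  define h where "h = (\<lambda>x. exp (of_real p * g x))"
  have hh: "h holomorphic_on ball z e" unfolding h_def by (intro holomorphic_intros g)
  have nh: "cmod (h x) = cmod (f x) powr p" if "x \<in> ball z e" for x
    using g(2)[OF that, symmetric] by (simp add: h_def powr_def mult.commute)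
  have "cmod (f z) powr p \<le> circle_mean (\<lambda>w. cmod (f (z + w)) powr p) \<rho>" if \<rho>: "0 < \<rho>" "\<rho> < e" for \<rho>
  proof -
    have cb: "cball z \<rho> \<subseteq> ball z e" using \<rho> by auto
    have hc: "continuous_on (cball z \<rho>) h"
      using hh cb holomorphic_on_imp_continuous_on continuous_on_subset by blast
    have hi: "((\<lambda>\<theta>. h (z + of_real \<rho> * cis \<theta>)) has_integral 2 * pi * h z) {0..2 * pi}"
      by (rule mean_value_holomorphic[OF hc]) (use hh cb \<rho> in \<open>auto intro: holomorphic_on_subset\<close>)
    have c: "continuous_on {0..2*pi} (\<lambda>\<theta>. h (z + of_real \<rho> * cis \<theta>))"
      by (intro continuous_on_compose2[OF hc] continuous_intros) (use \<rho> in \<open>auto simp: dist_norm norm_mult\<close>)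
    have "cmod (integral {0..2*pi} (\<lambda>\<theta>. h (z + of_real \<rho> * cis \<theta>)))
        \<le> integral {0..2*pi} (\<lambda>\<theta>. cmod (h (z + of_real \<rho> * cis \<theta>)))"
      by (intro integral_norm_bound_integral integrable_continuous_real continuous_intros c) auto
    also have "\<dots> = integral {0..2*pi} (\<lambda>\<theta>. cmod (f (z + of_real \<rho> * cis \<theta>)) powr p)"
      using \<rho> by (intro integral_cong nh) (auto simp: dist_norm norm_mult)
    finally have "2 * pi * cmod (h z) \<le> integral {0..2*pi} (\<lambda>\<theta>. cmod (f (z + of_real \<rho> * cis \<theta>)) powr p)"
      using hi by (simp add: integral_unique norm_mult)
    then show ?thesis using nh[of z] e by (simp add: circle_mean_def field_simps)
  qed
  then show ?thesis unfolding locally_submean_def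
    using eventually_at_right_real[OF e(1)] by (auto elim!: eventually_mono)
qed

text \<open>
  Among the points where the maximum is attained take one of largest modulus. If it were interior, the function would be constant on small circles
  around it, one point of which has larger modulus.
\<close>

lemma locally_submean_max_principle:
  assumes cont: "continuous_on (cball 0 R) u" and z: "z \<in> cball 0 R"
    and sub: "\<And>z. z \<in> ball 0 R \<Longrightarrow> locally_submean u z"
  obtains w where "cmod w = R" "u z \<le> u w"
proof -
  have ne: "cball (0::complex) R \<noteq> {}" using z by (metis empty_iff)
  obtain x0 where x0: "x0 \<in> cball 0 R" "\<And>y. y \<in> cball 0 R \<Longrightarrow> u y \<le> u x0"
    using continuous_attains_sup[OF compact_cball ne cont] by blast
  define A where "A = {w \<in> cball 0 R. u w = u x0}"
  have "closed A" unfolding A_def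
    by (intro continuous_closed_preimage_constant cont) auto
  moreover have "bounded A" by (rule bounded_subset[OF bounded_cball[of 0 R]]) (auto simp: A_def)
  ultimately have "compact A" by (simp add: compact_eq_bounded_closed)
  moreover have "A \<noteq> {}" using x0 A_def by auto
  ultimately obtain a where a: "a \<in> A" "\<And>y. y \<in> A \<Longrightarrow> cmod y \<le> cmod a"
    using continuous_attains_sup[of A cmod] by (auto intro: continuous_intros)
  have aR: "cmod a \<le> R" "u a = u x0" using a by (auto simp: A_def)
  have "\<not> cmod a < R"
  proof
    assume lt: "cmod a < R"
    then have "\<forall>\<^sub>F \<rho> in at_right 0. u a \<le> circle_mean (\<lambda>w. u (a + w)) \<rho>"
      using sub[of a] by (simp add: locally_submean_def)
    then have "\<forall>\<^sub>F \<rho> in at_right 0. u a \<le> circle_mean (\<lambda>w. u (a + w)) \<rho> \<and> \<rho> \<in> {0<..<R - cmod a}"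
      using lt by (intro eventually_conj eventually_at_right_real) auto
    then obtain \<rho> where \<rho>: "u a \<le> circle_mean (\<lambda>w. u (a + w)) \<rho>" "0 < \<rho>" "\<rho> < R - cmod a"
      using eventually_happens'[OF trivial_limit_at_right_real] by fastforce
    have inb: "cmod (a + of_real \<rho> * cis \<theta>) \<le> R" for \<theta>
      using norm_triangle_ineq[of a "of_real \<rho> * cis \<theta>"] \<rho> by (simp add: norm_mult)
    let ?h = "\<lambda>\<theta>. u x0 - u (a + of_real \<rho> * cis \<theta>)"
    have cu: "continuous_on {0..2*pi} (\<lambda>\<theta>. u (a + of_real \<rho> * cis \<theta>))"
      by (intro continuous_on_compose2[OF cont] continuous_intros) (use inb in auto)
    then have c: "continuous_on {0..2*pi} ?h" by (intro continuous_intros)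
    have nn: "\<And>\<theta>. 0 \<le> ?h \<theta>" using x0(2) inb by auto
    have "integral {0..2*pi} ?h = 2 * pi * u x0 - integral {0..2*pi} (\<lambda>\<theta>. u (a + of_real \<rho> * cis \<theta>))"
      by (subst Henstock_Kurzweil_Integration.integral_diff) (auto intro!: integrable_continuous_real cu)
    also have "\<dots> \<le> 0" using \<rho>(1) aR(2) by (simp add: circle_mean_def field_simps)
    finally have "integral {0..2*pi} ?h = 0"
      using Henstock_Kurzweil_Integration.integral_nonneg[OF integrable_continuous_real[OF c]] nn by fastforce
    then have zero: "?h \<theta> = 0" if "\<theta> \<in> {0..2*pi}" for \<theta>
      using integral_eq_0_iff[OF c] nn that by auto
    define \<theta> where "\<theta> = Arg2pi a"
    have th: "\<theta> \<in> {0..2*pi}" unfolding \<theta>_def using Arg2pi_ge_0[of a] Arg2pi_lt_2pi[of a] by auto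
    have aeq: "a = of_real (cmod a) * cis \<theta>"
      unfolding \<theta>_def cis_conv_exp using Arg2pi_eq[of a] by simp
    have "a + of_real \<rho> * cis \<theta> = of_real (cmod a + \<rho>) * cis \<theta>"
      by (subst (1) aeq) (simp add: algebra_simps)
    then have "cmod (a + of_real \<rho> * cis \<theta>) = cmod a + \<rho>"
      using \<rho>(2) by (metis abs_of_nonneg add_nonneg_nonneg less_imp_le mult.right_neutral norm_cis norm_ge_zero norm_mult norm_of_real)
    moreover have "a + of_real \<rho> * cis \<theta> \<in> A"
      using zero[OF th] inb by (simp add: A_def)
    ultimately show False using a(2) \<rho>(2) by fastforce
  qed
  then have "cmod a = R" using aR by auto
  moreover have "u z \<le> u a" using x0(2)[OF z] aR(2) by simp
  ultimately show ?thesis using that by blast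
qed

text \<open>
  Hardy's convexity theorem, without the convexity. The average \<open>u / N\<close> of \<open>|f|\<^sup>p\<close> over the rotations by
  \<open>N\<close>-th roots of unity has the same circle means as \<open>|f|\<^sup>p\<close> and obeys the maximum principle. On the outer circle it
  is a Riemann sum, hence uniformly close to the circle mean for large \<open>N\<close>.
\<close>

lemma circle_mean_powr_norm_mono:
  assumes cont: "continuous_on (cball 0 R) f" and hol: "f holomorphic_on ball 0 R"
    and p: "0 < p" and r: "0 \<le> r" "r \<le> R"
  shows "power_mean p f r \<le> power_mean p f R"
proof (rule field_le_epsilon)
  fix \<epsilon> :: real assume \<epsilon>: "0 < \<epsilon>"
  define g where "g = (\<lambda>z. cmod (f z) powr p)"
  have R0: "0 \<le> R" using r by simp
  have gc: "continuous_on (cball 0 R) g" unfolding g_def by (intro powr_norm_continuous_on cont p)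
  have gs: "continuous_on (sphere 0 \<rho>) g" if "\<rho> \<le> R" for \<rho>
    by (rule continuous_on_subset[OF gc]) (use that in auto)
  have gper: "uniformly_continuous_on {0..4 * pi} (\<lambda>\<theta>. g (of_real R * cis \<theta>))"
    by (intro compact_uniformly_continuous continuous_on_circle gs R0) auto
  then obtain d where d: "d > 0"
    "\<And>x y. x \<in> {0..4*pi} \<Longrightarrow> y \<in> {0..4*pi} \<Longrightarrow> dist y x < d \<Longrightarrow>
        dist (g (of_real R * cis y)) (g (of_real R * cis x)) < \<epsilon>"
    using \<epsilon> unfolding uniformly_continuous_on_def by meson
  obtain N :: nat where N: "2 * pi / d < real N" using reals_Archimedean2 by blast
  have N0: "0 < N" using N d(1) by (metis divide_pos_pos not_gr_zero of_nat_0 order_less_asym pi_gt_zero zero_less_mult_iff zero_less_numeral)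
  have Nd: "2 * pi / real N < d" using N N0 d(1) by (simp add: field_simps)
  define om where "om k = cis (2 * pi * (real k / real N))" for k :: nat
  define u where "u = (\<lambda>z. \<Sum>k<N. g (z * om k))"
  have om: "cmod (om k) = 1" for k by (simp add: om_def)
  have gk: "continuous_on (cball 0 R) (\<lambda>z. g (z * om k))" for k
    by (intro continuous_on_compose2[OF gc] continuous_intros) (auto simp: norm_mult om)
  have uc: "continuous_on (cball 0 R) u" unfolding u_def by (intro continuous_intros gk)
  have umean: "circle_mean u \<rho> = real N * circle_mean g \<rho>" if "0 \<le> \<rho>" "\<rho> \<le> R" for \<rho>
  proof -
    have "circle_mean u \<rho> = (\<Sum>k<N. circle_mean (\<lambda>z. g (z * om k)) \<rho>)"
      unfolding u_def using that by (intro circle_mean_sum) (auto intro: continuous_on_subset[OF gk])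
    also have "\<dots> = (\<Sum>k<N. circle_mean g \<rho>)"
      unfolding om_def by (intro sum.cong refl circle_mean_rotate gs that)
    finally show ?thesis by simp
  qed
  have sub: "locally_submean u z" if z: "z \<in> ball 0 R" for z
  proof -
    have "locally_submean (\<lambda>z. g (z * om k)) z" for k
    proof -
      have "(\<lambda>z. f (z * om k)) holomorphic_on ball 0 R"
        by (rule holomorphic_on_compose_gen[OF _ hol, of "\<lambda>z. z * om k", unfolded o_def])
           (auto intro!: holomorphic_intros simp: norm_mult om)
      then show ?thesis unfolding g_def by (rule locally_submean_powr_norm[OF open_ball _ z p])
    qed
    then have "\<forall>\<^sub>F \<rho> in at_right 0. \<forall>k\<in>{..<N}. g (z * om k) \<le> circle_mean (\<lambda>w. g ((z + w) * om k)) \<rho>"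
      by (simp add: eventually_ball_finite locally_submean_def)
    moreover have "\<forall>\<^sub>F \<rho> in at_right 0. \<rho> \<in> {0<..<R - cmod z}"
      using z by (intro eventually_at_right_real) auto
    ultimately show ?thesis unfolding locally_submean_def
    proof eventually_elim
      case (elim \<rho>)
      have c: "continuous_on (sphere 0 \<rho>) (\<lambda>w. g ((z + w) * om k))" for k
        by (intro continuous_on_compose2[OF gk] continuous_intros)
           (use elim(2) in \<open>auto intro!: norm_triangle_le\<close>)
      have "u z \<le> (\<Sum>k<N. circle_mean (\<lambda>w. g ((z + w) * om k)) \<rho>)"
        unfolding u_def using elim(1) by (intro sum_mono) auto
      also have "\<dots> = circle_mean (\<lambda>w. u (z + w)) \<rho>"
        unfolding u_def using elim(2) c by (intro circle_mean_sum[symmetric]) auto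
      finally show ?case .
    qed
  qed
  have bd: "u w \<le> real N * (circle_mean g R + \<epsilon>)" if w: "cmod w = R" for w
  proof -
    define \<alpha> where "\<alpha> = Arg2pi w"
    have \<alpha>: "0 \<le> \<alpha>" "\<alpha> \<le> 2*pi" unfolding \<alpha>_def using Arg2pi_ge_0[of w] Arg2pi_lt_2pi[of w] by auto
    have weq: "w = of_real R * cis \<alpha>"
      unfolding \<alpha>_def cis_conv_exp using Arg2pi_eq[of w] w by simp
    let ?h = "\<lambda>\<theta>. g (of_real R * cis \<theta> * cis \<alpha>)"
    have hc: "continuous_on S ?h" for S
      by (intro continuous_on_compose2[OF gc] continuous_intros) (use R0 in \<open>auto simp: norm_mult\<close>)
    have "g (w * om k) - \<epsilon> \<le> real N / (2*pi) * integral (arc N k) ?h" if k: "k < N" for k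
    proof -
      have len: "2 * pi * ((real k + 1) / real N) - 2 * pi * (real k / real N) = 2 * pi / real N"
        using N0 by (simp add: field_simps)
      have le: "2 * pi * ((real k + 1) / real N) \<le> 2 * pi" using k N0 by (intro mult_left_le) auto
      have ge: "0 \<le> 2 * pi * (real k / real N)" using N0 by simp
      have "integral (arc N k) (\<lambda>_. g (w * om k) - \<epsilon>) \<le> integral (arc N k) ?h"
      proof (rule integral_le)
        show "?h integrable_on arc N k" unfolding arc_def by (intro integrable_continuous_real hc)
        fix \<theta> assume "\<theta> \<in> arc N k"
        then have th: "2 * pi * (real k / real N) \<le> \<theta>" "\<theta> \<le> 2 * pi * ((real k + 1) / real N)"
          by (auto simp: arc_def)
        have th0: "0 \<le> \<theta>" "\<theta> \<le> 2 * pi" using th le ge by linarith+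
        have th1: "2 * pi * (real k / real N) \<le> 2 * pi" using th th0 by linarith
        have "dist (g (of_real R * cis (\<theta> + \<alpha>))) (g (of_real R * cis (2 * pi * (real k / real N) + \<alpha>))) < \<epsilon>"
        proof (rule d(2))
          show "\<theta> + \<alpha> \<in> {0..4 * pi}" "2 * pi * (real k / real N) + \<alpha> \<in> {0..4 * pi}"
            unfolding atLeastAtMost_iff using th0 th1 \<alpha> ge by linarith+
          show "dist (\<theta> + \<alpha>) (2 * pi * (real k / real N) + \<alpha>) < d"
            using th len Nd by (simp add: dist_real_def)
        qed
        then show "g (w * om k) - \<epsilon> \<le> ?h \<theta>"
          by (simp add: weq om_def dist_real_def cis_mult mult.assoc add.commute)
      qed (auto simp: arc_def)
      also have "integral (arc N k) (\<lambda>_. g (w * om k) - \<epsilon>) = (2 * pi / real N) * (g (w * om k) - \<epsilon>)"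
        unfolding arc_def using len N0 by (simp add: divide_right_mono)
      finally show ?thesis using N0 by (simp add: field_simps)
    qed
    then have "(\<Sum>k<N. g (w * om k) - \<epsilon>) \<le> (\<Sum>k<N. real N / (2*pi) * integral (arc N k) ?h)"
      by (intro sum_mono) auto
    also have "\<dots> = real N / (2*pi) * integral {0..2*pi} ?h"
      unfolding sum_distrib_left[symmetric]
      by (subst sum_integral_arcs) (auto intro!: integrable_continuous_real hc N0)
    also have "\<dots> = real N * circle_mean (\<lambda>z. g (z * cis \<alpha>)) R" by (simp add: circle_mean_def)
    also have "circle_mean (\<lambda>z. g (z * cis \<alpha>)) R = circle_mean g R"
      by (intro circle_mean_rotate gs R0) auto
    finally show ?thesis by (simp add: u_def sum_subtractf algebra_simps)
  qed
  have "circle_mean u r \<le> circle_mean (\<lambda>_. real N * (circle_mean g R + \<epsilon>)) r"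
  proof (rule circle_mean_mono)
    fix z assume "cmod z = r"
    then have "z \<in> cball 0 R" using r by simp
    then obtain w where "cmod w = R" "u z \<le> u w" using locally_submean_max_principle[OF uc _ sub] by metis
    then show "u z \<le> real N * (circle_mean g R + \<epsilon>)" using bd[of w] by linarith
  qed (use r in \<open>auto intro: continuous_on_subset[OF uc]\<close>)
  then have "real N * circle_mean g r \<le> real N * (circle_mean g R + \<epsilon>)" using umean[OF r] by simp
  then show "power_mean p f r \<le> power_mean p f R + \<epsilon>"
    using N0 by (simp add: g_def)
qed

text \<open>
  Compose \<open>f\<close> with the disc automorphism \<open>\<phi>\<close> that takes 0 to \<open>a\<close> and compare the means on the circles of
  radius 0 and 1. On the unit circle the inverse automorphism is \<open>cis \<theta> \<mapsto> cis (t \<theta>)\<close> with \<open>t \<theta> =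
  \<theta> - 2 arg (1 - cnj a cis \<theta>)\<close>, and the derivative of \<open>t\<close> is the Poisson kernel.
\<close>

lemma powr_norm_le_poisson_unit:
  assumes cont: "continuous_on (cball 0 1) f" and hol: "f holomorphic_on ball 0 1"
    and p: "0 < p" and a: "cmod a < 1"
  shows "cmod (f a) powr p \<le> circle_mean (\<lambda>w. cmod (f w) powr p * poisson_kernel (cnj a * w)) 1"
proof -
  define \<phi> where "\<phi> = (\<lambda>w. (w + a) / (1 + cnj a * w))"
  define \<psi> where "\<psi> = (\<lambda>w. (w - a) / (1 - cnj a * w))"
  have lt: "cmod (cnj a * w) < 1" if "cmod w \<le> 1" for w
    using mult_left_mono[OF that, of "cmod a"] a by (simp add: norm_mult)
  have ne: "1 - cnj a * w \<noteq> 0" "1 + cnj a * w \<noteq> 0" if "cmod w \<le> 1" for w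
  proof -
    show "1 - cnj a * w \<noteq> 0" using lt[OF that] by (rule one_minus_neq_0)
    show "1 + cnj a * w \<noteq> 0" using lt[of "-w"] that by (metis add_eq_0_iff less_irrefl mult_minus_right norm_minus_cancel norm_one)
  qed
  have idn: "(cmod (1 + cnj a * w))\<^sup>2 - (cmod (w + a))\<^sup>2 = (1 - (cmod a)\<^sup>2) * (1 - (cmod w)\<^sup>2)" for w
    unfolding cmod_power2 by (simp add: algebra_simps power2_eq_square)
  have a2: "0 < 1 - (cmod a)\<^sup>2" using a by (simp add: abs_square_less_1)
  have \<phi>le: "cmod (\<phi> w) \<le> 1" if "cmod w \<le> 1" for w
  proof -
    have "(cmod (w + a))\<^sup>2 \<le> (cmod (1 + cnj a * w))\<^sup>2"
      using idn[of w] a2 that by (metis diff_ge_0_iff_ge less_imp_le mult_nonneg_nonneg norm_ge_zero power_le_one)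
    then have "cmod (w + a) \<le> cmod (1 + cnj a * w)" by (simp add: power_mono_iff)
    then show ?thesis using ne(2)[OF that] by (simp add: \<phi>_def norm_divide)
  qed
  have \<phi>lt: "cmod (\<phi> w) < 1" if "cmod w < 1" for w
  proof -
    have "(cmod w)\<^sup>2 < 1" using that by (simp add: abs_square_less_1)
    then have "(cmod (w + a))\<^sup>2 < (cmod (1 + cnj a * w))\<^sup>2"
      using idn[of w] a2 by (metis diff_gt_0_iff_gt mult_pos_pos)
    then have "cmod (w + a) < cmod (1 + cnj a * w)" by (rule power_less_imp_less_base) simp
    then show ?thesis using ne(2)[of w] that by (simp add: \<phi>_def norm_divide)
  qed
  have \<phi>c: "continuous_on (cball 0 1) \<phi>" unfolding \<phi>_def
    by (intro continuous_intros ballI) (use ne(2) in auto)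
  have \<phi>h: "\<phi> holomorphic_on ball 0 1" unfolding \<phi>_def
    by (intro holomorphic_intros) (use ne(2) in \<open>auto simp: less_imp_le\<close>)
  have inv: "\<phi> (\<psi> w) = w" if "cmod w \<le> 1" for w
  proof -
    have "\<psi> w + a = w * (1 - a * cnj a) / (1 - cnj a * w)"
      using ne(1)[OF that] by (simp add: \<psi>_def field_simps)
    moreover have "1 + cnj a * \<psi> w = (1 - a * cnj a) / (1 - cnj a * w)"
      using ne(1)[OF that] by (simp add: \<psi>_def field_simps)
    moreover have "1 - a * cnj a \<noteq> 0"
      using a2 by (metis complex_norm_square eq_iff_diff_eq_0 less_irrefl of_real_1 of_real_eq_iff)
    ultimately show ?thesis using ne(1)[OF that] by (simp add: \<phi>_def)
  qed
  have F: "continuous_on (cball 0 1) (f \<circ> \<phi>)"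
    by (intro continuous_on_compose \<phi>c continuous_on_subset[OF cont]) (use \<phi>le in auto)
  have F': "(f \<circ> \<phi>) holomorphic_on ball 0 1"
    by (rule holomorphic_on_compose_gen[OF \<phi>h hol]) (use \<phi>lt in auto)
  have "cmod (f a) powr p = circle_mean (\<lambda>z. cmod ((f \<circ> \<phi>) z) powr p) 0"
    by (simp add: circle_mean_def \<phi>_def)
  also have "\<dots> \<le> circle_mean (\<lambda>z. cmod ((f \<circ> \<phi>) z) powr p) 1"
    by (rule circle_mean_powr_norm_mono[OF F F' p]) auto
  also have "\<dots> = circle_mean (\<lambda>w. cmod (f w) powr p * poisson_kernel (cnj a * w)) 1"
  proof -
    let ?h = "\<lambda>x. cmod (f (\<phi> (cis x))) powr p"
    have hc: "continuous_on S ?h" for S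
      using continuous_on_circle[of 1 "\<lambda>z. cmod ((f \<circ> \<phi>) z) powr p" S]
        continuous_on_subset[OF powr_norm_continuous_on[OF F p], of "sphere 0 1"] by (simp add: o_def)
    define t where "t = (\<lambda>\<theta>. \<theta> - 2 * Im (Ln (1 - cnj a * cis \<theta>)))"
    have Repos: "0 < Re (1 - cnj a * cis \<theta>)" for \<theta>
      using lt[of "cis \<theta>"] complex_Re_le_cmod[of "cnj a * cis \<theta>"] by simp
    then have nonpos: "1 - cnj a * cis \<theta> \<notin> \<real>\<^sub>\<le>\<^sub>0" for \<theta>
      by (metis complex_nonpos_Reals_iff not_le)
    have tder: "(t has_real_derivative poisson_kernel (cnj a * cis \<theta>)) (at \<theta> within S)" for \<theta> S
    proof -
      let ?z = "cnj a * cis \<theta>"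
      have "((\<lambda>x. 1 - cnj a * cis x) has_vector_derivative - (\<i> * ?z)) (at \<theta> within S)"
        by (auto intro!: derivative_eq_intros simp: cis_conv_exp[symmetric] has_vector_derivative_def scaleR_conv_of_real algebra_simps)
      then have "((Ln \<circ> (\<lambda>x. 1 - cnj a * cis x)) has_vector_derivative (- (\<i> * ?z)) * (inverse (1 - ?z))) (at \<theta> within S)"
        by (rule field_vector_diff_chain_within) (rule has_field_derivative_at_within[OF has_field_derivative_Ln[OF nonpos]])
      then have "((\<lambda>x. Im (Ln (1 - cnj a * cis x))) has_vector_derivative Im ((- (\<i> * ?z)) * (inverse (1 - ?z)))) (at \<theta> within S)"
        using bounded_linear.has_vector_derivative[OF bounded_linear_Im] by (fastforce simp: o_def)
      then have "(t has_real_derivative 1 - 2 * Im ((- (\<i> * ?z)) * (inverse (1 - ?z)))) (at \<theta> within S)"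
        unfolding t_def has_real_derivative_iff_has_vector_derivative[symmetric]
        by (intro DERIV_diff DERIV_ident DERIV_cmult)
      moreover have "1 - 2 * Im ((- (\<i> * ?z)) * (inverse (1 - ?z))) = poisson_kernel ?z"
      proof -
        have "(1 + ?z) / (1 - ?z) = 1 + 2 * (?z * inverse (1 - ?z))"
          using ne(1)[of "cis \<theta>"] by (simp add: field_simps)
        then have "poisson_kernel ?z = 1 + 2 * Re (?z * inverse (1 - ?z))"
          using poisson_kernel_Re[of ?z] lt[of "cis \<theta>"] by simp
        moreover have "Im ((- (\<i> * ?z)) * (inverse (1 - ?z))) = - Re (?z * inverse (1 - ?z))"
        proof -
          have "(- (\<i> * ?z)) * (inverse (1 - ?z)) = - (\<i> * (?z * inverse (1 - ?z)))" by (simp add: mult.assoc)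
          then show ?thesis by (metis Im_i_times uminus_complex.simps(2))
        qed
        ultimately show ?thesis by simp
      qed
      ultimately show ?thesis by simp
    qed
    have tcis: "cis (t \<theta>) = \<psi> (cis \<theta>)" for \<theta>
    proof -
      define U where "U = 1 - cnj a * cis \<theta>"
      have U0: "U \<noteq> 0" using ne(1)[of "cis \<theta>"] by (simp add: U_def)
      define y where "y = Im (Ln U)"
      have Ueq: "U = of_real (cmod U) * cis y"
        using exp_Ln[OF U0] exp_eq_polar[of "Ln U"] norm_exp_eq_Re[of "Ln U"] unfolding y_def by metis
      have "cis \<theta> - a = cis \<theta> * cnj U"
      proof -
        have "cis \<theta> * cnj U = cis \<theta> - a * (cis \<theta> * cnj (cis \<theta>))" by (simp add: U_def algebra_simps)
        also have "cis \<theta> * cnj (cis \<theta>) = 1" by (simp add: cis_cnj cis_mult)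
        finally show ?thesis by simp
      qed
      then have "\<psi> (cis \<theta>) = cis \<theta> * (cnj U / U)" by (simp add: \<psi>_def U_def)
      also have "cnj U / U = cis (-y) / cis y"
        using U0 by (subst (1 2) Ueq) (simp add: cis_cnj)
      also have "\<dots> = cis (- y - y)" by (simp add: cis_divide)
      also have "cis \<theta> * \<dots> = cis (t \<theta>)" by (simp add: cis_mult t_def y_def U_def algebra_simps)
      finally show ?thesis by simp
    qed
    have t2: "t (2 * pi) = t 0 + 2 * pi" by (simp add: t_def)
    have tb: "t ` {0..2*pi} \<subseteq> {- 2 * pi..4 * pi}"
    proof -
      have "\<bar>Im (Ln (1 - cnj a * cis \<theta>))\<bar> \<le> pi" for \<theta>
        using ne(1)[of "cis \<theta>"] Im_Ln_le_pi[of "1 - cnj a * cis \<theta>"] mpi_less_Im_Ln[of "1 - cnj a * cis \<theta>"] by auto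
      then have "\<bar>t \<theta> - \<theta>\<bar> \<le> 2 * pi" for \<theta> unfolding t_def by (simp add: abs_mult)
      note b = this
      show ?thesis
      proof (rule image_subsetI)
        fix \<theta> assume "\<theta> \<in> {0..2*pi}"
        then show "t \<theta> \<in> {- 2 * pi..4 * pi}"
          using b[of \<theta>] unfolding atLeastAtMost_iff abs_le_iff by linarith
      qed
    qed
    have "((\<lambda>\<theta>. poisson_kernel (cnj a * cis \<theta>) *\<^sub>R ?h (t \<theta>)) has_integral integral {t 0..t (2*pi)} ?h) {0..2*pi}"
      by (rule has_integral_substitution[OF _ _ tb hc tder]) (auto simp: t2)
    moreover have "?h (t \<theta>) = cmod (f (cis \<theta>)) powr p" for \<theta>
      by (simp add: tcis inv)
    moreover have "integral {t 0..t (2*pi)} ?h = integral {0..2*pi} ?h"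
      unfolding t2 by (rule integral_periodic_shift[OF hc]) (simp add: cis_mult[symmetric])
    ultimately show ?thesis by (simp add: circle_mean_def integral_unique mult.commute)
  qed
  finally show ?thesis .
qed

lemma powr_norm_le_poisson:
  assumes cont: "continuous_on (cball 0 R) f" and hol: "f holomorphic_on ball 0 R"
    and p: "0 < p" and a: "cmod a < R"
  shows "cmod (f a) powr p \<le> circle_mean (\<lambda>w. cmod (f w) powr p * poisson_kernel (cnj a * w / of_real (R\<^sup>2))) R"
proof -
  have R: "0 < R" using a by (smt (verit) norm_ge_zero)
  let ?F = "\<lambda>z. f (of_real R * z)"
  have "cmod (?F (a / R)) powr p \<le> circle_mean (\<lambda>w. cmod (?F w) powr p * poisson_kernel (cnj (a / R) * w)) 1"
  proof (rule powr_norm_le_poisson_unit[OF _ _ p])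
    show "continuous_on (cball 0 1) ?F"
      by (intro continuous_on_compose2[OF cont] continuous_intros) (use R in \<open>auto simp: norm_mult\<close>)
    show "?F holomorphic_on ball 0 1"
      by (rule holomorphic_on_compose_gen[OF _ hol, unfolded o_def])
         (use R in \<open>auto intro!: holomorphic_intros simp: norm_mult\<close>)
    show "cmod (a / R) < 1" using a R by (simp add: norm_divide)
  qed
  then show ?thesis using R by (simp add: circle_mean_def power2_eq_square)
qed

section \<open>Derivatives on the arcs of a circle\<close>

lemma poisson_kernel_cnj: "poisson_kernel (cnj w) = poisson_kernel w"
proof -
  have "cmod (1 - cnj w) = cmod (1 - w)" by (metis complex_cnj_diff complex_cnj_one complex_mod_cnj)
  then show ?thesis by (simp add: poisson_kernel_def)
qed

text \<open>
  Harnack's inequality for the kernel, in terms of the distance of the two points relative to their distance from the boundary.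
\<close>

lemma poisson_kernel_harnack:
  assumes b: "cmod b < 1" and b': "cmod b' < 1"
    and near: "cmod (b - b') \<le> c * (1 - cmod b)" and comp: "1 - cmod b \<le> c' * (1 - cmod b')" and c: "0 \<le> c"
  shows "poisson_kernel b \<le> 2 * c' * (1 + c)\<^sup>2 * poisson_kernel b'"
proof -
  have c': "0 \<le> c'" using comp b b' by (smt (verit) mult_nonpos_nonneg)
  have pos: "0 < cmod (1 - b)" "0 < cmod (1 - b')"
    using b b' by (metis norm_one zero_less_norm_iff eq_iff_diff_eq_0 less_irrefl)+
  have le1: "1 - cmod b \<le> cmod (1 - b)" by (metis norm_one norm_triangle_ineq2)
  have "cmod (1 - b') \<le> cmod (1 - b) + cmod (b - b')" by (metis diff_add_cancel add_diff_eq norm_triangle_ineq)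
  also have "\<dots> \<le> cmod (1 - b) + c * cmod (1 - b)" using near mult_left_mono[OF le1 c] by linarith
  finally have d: "cmod (1 - b') \<le> (1 + c) * cmod (1 - b)" by (simp add: algebra_simps)
  have "1 - (cmod b)\<^sup>2 = (1 + cmod b) * (1 - cmod b)" by (simp add: algebra_simps power2_eq_square)
  also have "\<dots> \<le> 2 * (1 - cmod b)" using b by (intro mult_right_mono) auto
  also have "\<dots> \<le> 2 * (c' * (1 - cmod b'))" using comp by simp
  also have "\<dots> \<le> 2 * (c' * (1 - (cmod b')\<^sup>2))"
  proof -
    have "(cmod b')\<^sup>2 \<le> cmod b'" using b' by (simp add: power2_eq_square mult_left_le)
    then show ?thesis using c' by (simp add: mult_left_mono)
  qed
  finally have n: "1 - (cmod b)\<^sup>2 \<le> 2 * c' * (1 - (cmod b')\<^sup>2)" by simp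
  have nn: "0 \<le> 1 - (cmod b')\<^sup>2" using b' by (simp add: power_le_one)
  have "poisson_kernel b \<le> 2 * c' * (1 - (cmod b')\<^sup>2) / (cmod (1 - b))\<^sup>2"
    unfolding poisson_kernel_def by (intro divide_right_mono n) auto
  also have "\<dots> \<le> 2 * c' * (1 - (cmod b')\<^sup>2) / ((cmod (1 - b') / (1 + c))\<^sup>2)"
  proof (intro divide_left_mono mult_nonneg_nonneg power_mono)
    show "cmod (1 - b') / (1 + c) \<le> cmod (1 - b)" using d c by (simp add: field_simps)
  qed (use c c' nn pos in auto)
  also have "\<dots> = 2 * c' * (1 + c)\<^sup>2 * poisson_kernel b'"
    using c pos by (simp add: poisson_kernel_def power_divide)
  finally show ?thesis .
qed

lemma continuous_on_poisson_kernel: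
  assumes "continuous_on S g" "\<And>x. x \<in> S \<Longrightarrow> cmod (g x) < 1"
  shows "continuous_on S (\<lambda>x. poisson_kernel (g x))"
proof -
  have "1 - g x \<noteq> 0" if "x \<in> S" for x
    using assms(2)[OF that] by (rule one_minus_neq_0)
  then show ?thesis unfolding poisson_kernel_def
    by (intro continuous_intros assms) auto
qed

lemma norm_cis_diff_le: "cmod (cis x - cis y) \<le> \<bar>x - y\<bar>"
proof -
  have "cis x - cis y = cis y * (cis (x - y) - 1)" by (simp add: algebra_simps cis_mult)
  then have "cmod (cis x - cis y) = cmod (cis (x - y) - 1)" by (simp add: norm_mult)
  also have "\<dots> = 2 * \<bar>sin ((x - y) / 2)\<bar>"
    using dist_exp_i_1[of "x - y"] by (simp add: cis_conv_exp)
  also have "\<dots> \<le> \<bar>x - y\<bar>" using abs_sin_x_le_abs_x[of "(x - y) / 2"] by simp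
  finally show ?thesis .
qed

text \<open>
  Cauchy's estimate on discs of radius \<open>\<delta> = (R - \<rho>) / 2\<close> bounds the derivative by values of \<open>f\<close>, these are
  bounded by the Poisson integral of \<open>|f|\<^sup>p\<close> over the circle of radius \<open>R\<close>, and by Harnack's inequality its kernel may
  be replaced by the one of the end point of the arc. The kernels of all end points add up to at most \<open>4 N\<close>.
\<close>

lemma derivative_on_arcs_bound:
  assumes f: "f holomorphic_on ball 0 1" and p: "0 < p"
    and \<rho>: "0 \<le> \<rho>" "\<rho> < R" and R: "R < 1"
    and N: "0 < N" "2 * pi / real N \<le> 2 * (R - \<rho>)" and half: "(\<rho> / R) ^ N \<le> 1 / 2"
  shows "\<exists>y. (\<forall>l<N. 0 \<le> y l) \<and>
     (\<forall>l<N. \<forall>\<theta>\<in>arc N l. cmod ((deriv ^^ n) f (of_real \<rho> * cis \<theta>)) \<le> y l) \<and>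
     (\<Sum>l<N. y l powr p) \<le>
        432 * real N * (fact n * (2 / (R - \<rho>)) ^ n) powr p * power_mean p f R"
proof -
  define \<delta> where "\<delta> = (R - \<rho>) / 2"
  have \<delta>: "0 < \<delta>" using \<rho> by (simp add: \<delta>_def)
  have R0: "0 < R" using \<rho> by simp
  have fR: "continuous_on (cball 0 R) f" "f holomorphic_on ball 0 R"
    using f R by (auto intro!: holomorphic_on_imp_continuous_on elim!: holomorphic_on_subset)
  define g where "g = (\<lambda>z. cmod (f z) powr p)"
  have gc: "continuous_on (sphere 0 R) g"
    unfolding g_def by (rule powr_norm_continuous_on[OF continuous_on_subset[OF fR(1)] p]) auto
  define b where "b a w = cnj a * w / of_real (R\<^sup>2)" for a w :: complex
  have bn: "cmod (b a w) = cmod a / R" if "cmod w = R" for a w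
    using R0 that by (simp add: b_def norm_divide norm_mult power2_eq_square)
  define zl where "zl l = of_real \<rho> * cis (2 * pi * real l / real N)" for l :: nat
  have zln: "cmod (zl l) = \<rho>" for l using \<rho> by (simp add: zl_def norm_mult)
  define Y where "Y l = circle_mean (\<lambda>w. g w * poisson_kernel (b (zl l) w)) R" for l
  have kc: "continuous_on (sphere 0 R) (\<lambda>w. g w * poisson_kernel (b a w))" if "cmod a < R" for a
  proof (intro continuous_intros gc continuous_on_poisson_kernel)
    show "continuous_on (sphere 0 R) (b a)" unfolding b_def by (intro continuous_intros) (use R0 in auto)
    show "cmod (b a w) < 1" if "w \<in> sphere 0 R" for w
      using that \<open>cmod a < R\<close> R0 by (simp add: bn)
  qed
  have g0: "0 \<le> g w" for w by (simp add: g_def)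
  have Y0: "0 \<le> Y l" for l unfolding Y_def
    by (intro circle_mean_nonneg mult_nonneg_nonneg g0 poisson_kernel_nonneg)
       (use \<rho> R0 in \<open>auto simp: bn zln\<close>)
  define A where "A = fact n * (2 / (R - \<rho>)) ^ n"
  have A0: "0 < A" using \<rho> by (simp add: A_def)
  define y where "y l = A * (108 * Y l) powr (1 / p)" for l
  have bound: "cmod ((deriv ^^ n) f (of_real \<rho> * cis \<theta>)) \<le> y l" if l: "l < N" and th: "\<theta> \<in> arc N l" for l \<theta>
  proof -
    define z where "z = of_real \<rho> * cis \<theta>"
    have zn: "cmod z = \<rho>" using \<rho> by (simp add: z_def norm_mult)
    have sub: "cball z \<delta> \<subseteq> ball 0 1"
    proof
      fix w assume "w \<in> cball z \<delta>"
      then have "cmod w \<le> \<rho> + \<delta>" using norm_triangle_ineq[of z "w - z"] zn by (simp add: dist_norm norm_minus_commute)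
      also have "\<dots> < 1" using \<rho> R by (simp add: \<delta>_def field_simps)
      finally show "w \<in> ball 0 1" by simp
    qed
    have "cmod ((deriv ^^ n) f z) \<le> fact n * (108 * Y l) powr (1 / p) / \<delta> ^ n"
    proof (rule Cauchy_inequality)
      show "f holomorphic_on ball z \<delta>" using f sub by (meson ball_subset_cball holomorphic_on_subset order_trans)
      show "continuous_on (cball z \<delta>) f" using f sub by (meson holomorphic_on_imp_continuous_on holomorphic_on_subset)
      show "0 < \<delta>" by (rule \<delta>)
      fix w assume w: "cmod (z - w) = \<delta>"
      have wle: "cmod w \<le> \<rho> + \<delta>" using norm_triangle_ineq[of z "w - z"] zn w by (simp add: norm_minus_commute)
      have wge: "\<rho> - \<delta> \<le> cmod w" using norm_triangle_ineq[of w "z - w"] zn w by simp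
      have wR: "cmod w < R" using wle \<rho> unfolding \<delta>_def by (simp add: field_simps)
      have "\<theta> - 2 * pi * real l / real N \<le> 2 * pi / real N" "0 \<le> \<theta> - 2 * pi * real l / real N"
        using th by (simp_all add: arc_def add_divide_distrib algebra_simps)
      then have dth: "\<bar>\<theta> - 2 * pi * real l / real N\<bar> \<le> 4 * \<delta>" using N(2) by (simp add: \<delta>_def)
      have "cmod (z - zl l) = \<rho> * cmod (cis \<theta> - cis (2 * pi * real l / real N))"
        using \<rho>(1) by (simp add: z_def zl_def norm_mult flip: right_diff_distrib)
      also have "\<dots> \<le> 1 * \<bar>\<theta> - 2 * pi * real l / real N\<bar>"
        using \<rho> R by (intro mult_mono norm_cis_diff_le) auto
      finally have "cmod (z - zl l) \<le> 4 * \<delta>" using dth by simp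
      then have wz: "cmod (w - zl l) \<le> 5 * \<delta>"
        using norm_triangle_ineq[of "w - z" "z - zl l"] w by (simp add: norm_minus_commute)
      have "g w \<le> circle_mean (\<lambda>u. g u * poisson_kernel (b w u)) R"
        unfolding g_def b_def by (rule powr_norm_le_poisson[OF fR p wR])
      also have "\<dots> \<le> circle_mean (\<lambda>u. 108 * (g u * poisson_kernel (b (zl l) u))) R"
      proof (rule circle_mean_mono)
        fix u :: complex assume u: "cmod u = R"
        \<comment> \<open>\<open>w\<close> is within \<open>5 \<delta>\<close> of the end point and at distance at least \<open>\<delta>\<close> from the outer circle; this gives \<open>2 (3/2) 6\<^sup>2 = 108\<close>\<close>
        have "poisson_kernel (b w u) \<le> 2 * (3/2) * (1 + 5)\<^sup>2 * poisson_kernel (b (zl l) u)"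
        proof (rule poisson_kernel_harnack)
          show "cmod (b w u) < 1" "cmod (b (zl l) u) < 1" using wR \<rho> R0 by (simp_all add: bn[OF u] zln)
          have "b w u - b (zl l) u = b (w - zl l) u" by (simp add: b_def left_diff_distrib diff_divide_distrib)
          then have "cmod (b w u - b (zl l) u) = cmod (w - zl l) / R" by (simp add: bn[OF u])
          also have "\<dots> \<le> 5 * (1 - cmod w / R)"
            using wz wle R0 unfolding \<delta>_def by (simp add: field_simps)
          finally show "cmod (b w u - b (zl l) u) \<le> 5 * (1 - cmod (b w u))" by (simp add: bn[OF u])
          have "R - cmod w \<le> 3 / 2 * (R - \<rho>)" using wge unfolding \<delta>_def by (simp add: field_simps)
          then have "(R - cmod w) / R \<le> 3 / 2 * (R - \<rho>) / R" using R0 by (intro divide_right_mono) auto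
          then show "1 - cmod (b w u) \<le> 3/2 * (1 - cmod (b (zl l) u))" 
            using R0 by (simp add: bn[OF u] zln diff_divide_distrib right_diff_distrib)
        qed simp
        then show "g u * poisson_kernel (b w u) \<le> 108 * (g u * poisson_kernel (b (zl l) u))"
          using mult_left_mono[OF _ g0[of u]] by fastforce
      qed (use kc[OF wR] kc[of "zl l"] \<rho> zln in \<open>auto intro!: continuous_on_mult_left\<close>)
      also have "\<dots> = 108 * Y l" by (simp add: Y_def circle_mean_cmult)
      finally have "cmod (f w) powr p \<le> 108 * Y l" by (simp add: g_def)
      then have "(cmod (f w) powr p) powr (1 / p) \<le> (108 * Y l) powr (1 / p)"
        using p by (intro powr_mono2) auto
      then show "cmod (f w) \<le> (108 * Y l) powr (1 / p)" using p by (simp add: powr_powr)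
    qed
    also have "\<dots> = y l" by (simp add: y_def A_def \<delta>_def power_divide)
    finally show ?thesis by (simp add: z_def)
  qed
  have sumY: "(\<Sum>l<N. Y l) \<le> 4 * real N * circle_mean g R"
  proof -
    have "(\<Sum>l<N. Y l) = circle_mean (\<lambda>w. \<Sum>l<N. g w * poisson_kernel (b (zl l) w)) R"
      unfolding Y_def using kc \<rho> R0 zln by (intro circle_mean_sum[symmetric]) auto
    also have "\<dots> \<le> circle_mean (\<lambda>w. 4 * real N * g w) R"
    proof (rule circle_mean_mono)
      fix w :: complex assume w: "cmod w = R"
      define v where "v = of_real \<rho> * cnj w / of_real (R\<^sup>2)"
      have vn: "cmod v = \<rho> / R" using w R0 \<rho> by (simp add: v_def norm_mult norm_divide power2_eq_square)
      have "poisson_kernel (b (zl l) w) = poisson_kernel (v * cis (2 * pi * real l / real N))" for l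
      proof -
        have "cnj (b (zl l) w) = v * cis (2 * pi * real l / real N)" by (simp add: b_def zl_def v_def)
        then show ?thesis by (metis poisson_kernel_cnj)
      qed
      then have "(\<Sum>l<N. poisson_kernel (b (zl l) w)) \<le> 4 * real N"
        using sum_poisson_kernel_roots_le[of v N] vn \<rho> R0 N half by simp
      then have "g w * (\<Sum>l<N. poisson_kernel (b (zl l) w)) \<le> g w * (4 * real N)"
        by (intro mult_left_mono g0)
      then show "(\<Sum>l<N. g w * poisson_kernel (b (zl l) w)) \<le> 4 * real N * g w"
        by (simp add: sum_distrib_left mult_ac)
    qed (use kc[of "zl _"] \<rho> R0 zln in \<open>auto intro!: continuous_on_sum continuous_on_mult_left gc\<close>)
    also have "\<dots> = 4 * real N * circle_mean g R" by (rule circle_mean_cmult)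
    finally show ?thesis .
  qed
  have "y l powr p = A powr p * 108 * Y l" for l
    using p A0 Y0[of l] by (simp add: y_def powr_mult powr_powr)
  then have "(\<Sum>l<N. y l powr p) = A powr p * 108 * (\<Sum>l<N. Y l)" by (simp add: sum_distrib_left)
  also have "\<dots> \<le> A powr p * 108 * (4 * real N * circle_mean g R)"
    by (intro mult_left_mono sumY) auto
  finally have "(\<Sum>l<N. y l powr p) \<le> 432 * real N * A powr p * circle_mean g R" by (simp add: mult_ac)
  moreover have "0 \<le> y l" for l using A0 by (simp add: y_def)
  ultimately show ?thesis using bound unfolding A_def g_def by (intro exI[of _ y]) auto
qed

section \<open>Multipliers between mixed sequence spaces\<close>

text \<open>
  The norm of \<open>\<ell>\<^sup>s\<^sup>(\<^sup>p\<^sup>/\<^sup>s\<^sup>)\<^sup>'\<close>, where \<open>s (p/s)' = s p / (p - s)\<close> for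
  \<open>s < p\<close> and \<open>\<infinity>\<close> otherwise. Being real valued on finite index sets, it keeps infinities out of the estimates; it
  is always used with a nonempty \<open>I\<close>.
\<close>

definition dual_norm :: "real \<Rightarrow> real \<Rightarrow> 'i set \<Rightarrow> ('i \<Rightarrow> real) \<Rightarrow> real" where
  "dual_norm s p I b =
     (if s < p then (\<Sum>i\<in>I. b i powr (s * p / (p - s))) powr ((p - s) / (s * p)) else Max (b ` I))"

lemma dual_norm_nonneg:
  assumes "finite I" "I \<noteq> {}" "\<And>i. i \<in> I \<Longrightarrow> 0 \<le> b i"
  shows "0 \<le> dual_norm s p I b"
  using assms by (auto simp: dual_norm_def Max_ge_iff)

lemma sum_powr_le_powr_sum:
  fixes a :: "'i \<Rightarrow> real"
  assumes "finite I" "\<And>i. i \<in> I \<Longrightarrow> 0 \<le> a i" "0 < p" "p \<le> s"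
  shows "(\<Sum>i\<in>I. a i powr s) \<le> (\<Sum>i\<in>I. a i powr p) powr (s / p)"
proof -
  define S where "S = (\<Sum>i\<in>I. a i powr p)"
  have le: "a i powr p \<le> S" if "i \<in> I" for i
    unfolding S_def using assms that by (intro member_le_sum) auto
  have S0: "0 \<le> S" by (simp add: S_def sum_nonneg)
  have "a i powr s \<le> a i powr p * S powr (s / p - 1)" if i: "i \<in> I" for i
  proof -
    have "a i powr s = a i powr p * (a i powr p) powr (s / p - 1)"
      using assms by (simp add: powr_powr right_diff_distrib flip: powr_add)
    also have "\<dots> \<le> a i powr p * S powr (s / p - 1)"
      using le[OF i] assms by (intro mult_left_mono powr_mono2) auto
    finally show ?thesis .
  qed
  then have "(\<Sum>i\<in>I. a i powr s) \<le> (\<Sum>i\<in>I. a i powr p * S powr (s / p - 1))" by (intro sum_mono) auto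
  also have "\<dots> = S * S powr (s / p - 1)" by (simp add: S_def sum_distrib_right)
  also have "\<dots> = S powr (s / p)" using S0 by (cases "S = 0") (simp_all add: powr_diff)
  finally show ?thesis by (simp add: S_def)
qed

text \<open>
  For \<open>s < p\<close> this is Hoelder's inequality with exponents \<open>p / s\<close> and its conjugate, obtained from Young's inequality after
  normalising both factors; for \<open>p \<le> s\<close> it is the inclusion of \<open>\<ell>\<^sup>p\<close> in \<open>\<ell>\<^sup>s\<close>.
\<close>

lemma dual_norm_Hoelder:
  assumes I: "finite I" "I \<noteq> {}" and a: "\<And>i. i \<in> I \<Longrightarrow> 0 \<le> a i" and b: "\<And>i. i \<in> I \<Longrightarrow> 0 \<le> b i"
    and s: "0 < s" and p: "0 < p"
  shows "(\<Sum>i\<in>I. (a i * b i) powr s) \<le> dual_norm s p I b powr s * (\<Sum>i\<in>I. a i powr p) powr (s / p)"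
proof (cases "s < p")
  case True
  define P where "P = s * p / (p - s)"
  have P: "0 < P" using s p True by (simp add: P_def)
  have conj: "s / p + s / P = 1" using s p True by (simp add: P_def field_simps)
  define A where "A = (\<Sum>i\<in>I. a i powr p)"
  define B where "B = (\<Sum>i\<in>I. b i powr P)"
  have A0: "0 \<le> A" and B0: "0 \<le> B" by (simp_all add: A_def B_def sum_nonneg)
  have dn: "dual_norm s p I b powr s = B powr (s / P)"
    using True s p B0 by (simp add: dual_norm_def P_def B_def powr_powr)
  show ?thesis
  proof (cases "A = 0 \<or> B = 0")
    case True
    have "a i * b i = 0" if "i \<in> I" for i
    proof -
      have "a i powr p = 0 \<or> b i powr P = 0" using True that I unfolding A_def B_def
        by (auto simp: sum_nonneg_eq_0_iff)
      then show ?thesis using p P by auto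
    qed
    then have "(\<Sum>i\<in>I. (a i * b i) powr s) = 0" by (intro sum.neutral ballI) (simp only: powr_eq_0_iff)
    then show ?thesis by simp
  next
    case False
    then have A: "0 < A" and B: "0 < B" using A0 B0 by auto
    define C where "C = A powr (s / p) * B powr (s / P)"
    have C: "0 < C" using A B by (simp add: C_def)
    have "(a i * b i) powr s / C \<le> s / p * (a i powr p / A) + s / P * (b i powr P / B)" if i: "i \<in> I" for i
    proof (cases "a i = 0 \<or> b i = 0")
      case True
      then have "(a i * b i) powr s / C = 0" by auto
      also have "0 \<le> s / p * (a i powr p / A) + s / P * (b i powr P / B)"
        using s p P A B by (intro add_nonneg_nonneg mult_nonneg_nonneg) auto
      finally show ?thesis .
    next
      case False
      then have "(a i powr p / A) powr (s / p) * (b i powr P / B) powr (s / P)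
          \<le> s / p * (a i powr p / A) + s / P * (b i powr P / B)"
        using s p P conj A B by (intro Youngs_inequality_0) auto
      moreover have "(a i powr p / A) powr (s / p) * (b i powr P / B) powr (s / P) = (a i * b i) powr s / C"
        using s p P A B a[OF i] b[OF i] by (simp add: powr_divide powr_powr powr_mult C_def)
      ultimately show ?thesis by simp
    qed
    then have "(\<Sum>i\<in>I. (a i * b i) powr s / C) \<le> (\<Sum>i\<in>I. s / p * (a i powr p / A) + s / P * (b i powr P / B))"
      by (intro sum_mono) auto
    also have "\<dots> = s / p * ((\<Sum>i\<in>I. a i powr p) / A) + s / P * ((\<Sum>i\<in>I. b i powr P) / B)"
      by (simp add: sum.distrib sum_distrib_left sum_divide_distrib)
    also have "\<dots> = 1" using A B conj unfolding A_def[symmetric] B_def[symmetric] by simp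
    finally have "(\<Sum>i\<in>I. (a i * b i) powr s) \<le> C"
      using C by (simp add: sum_divide_distrib[symmetric] field_simps)
    then show ?thesis unfolding dn C_def A_def by (simp add: mult.commute)
  qed
next
  case False
  define M where "M = Max (b ` I)"
  have bM: "b i \<le> M" if "i \<in> I" for i unfolding M_def using I that by (intro Max_ge) auto
  have "(a i * b i) powr s \<le> M powr s * a i powr s" if i: "i \<in> I" for i
    using a[OF i] b[OF i] bM[OF i] s by (simp add: powr_mult mult.commute[of "M powr s"] mult_left_mono powr_mono2)
  then have "(\<Sum>i\<in>I. (a i * b i) powr s) \<le> M powr s * (\<Sum>i\<in>I. a i powr s)"
    by (simp add: sum_distrib_left sum_mono)
  also have "\<dots> \<le> M powr s * (\<Sum>i\<in>I. a i powr p) powr (s / p)"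
    using False by (intro mult_left_mono sum_powr_le_powr_sum I a p) auto
  finally show ?thesis using False by (simp add: dual_norm_def M_def)
qed

text \<open>
  The extremal sequence is a normalised power of \<open>b\<close> for \<open>s < p\<close>, and a unit vector at a maximum of \<open>b\<close>
  otherwise.
\<close>

lemma dual_norm_attained:
  assumes I: "finite I" "I \<noteq> {}" and b: "\<And>i. i \<in> I \<Longrightarrow> 0 \<le> b i"
    and s: "0 < s" and p: "0 < p"
  shows "\<exists>x. (\<forall>i. 0 \<le> x i) \<and> (\<Sum>i\<in>I. x i powr p) \<le> 1 \<and>
           dual_norm s p I b powr s \<le> (\<Sum>i\<in>I. (x i * b i) powr s)"
proof (cases "s < p")
  case True
  define P where "P = s * p / (p - s)"
  have P: "0 < P" using s p True by (simp add: P_def)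
  define B where "B = (\<Sum>i\<in>I. b i powr P)"
  have B0: "0 \<le> B" by (simp add: B_def sum_nonneg)
  have dn: "dual_norm s p I b powr s = B powr (s / P)"
    using True s p B0 by (simp add: dual_norm_def P_def B_def powr_powr)
  show ?thesis
  proof (cases "B = 0")
    case True
    then show ?thesis using dn by (intro exI[of _ "\<lambda>_. 0"]) auto
  next
    case False
    then have B: "0 < B" using B0 by simp
    define x where "x i = b i powr (P / p) / B powr (1 / p)" for i
    have xp: "x i powr p = b i powr P / B" for i
      using B p by (simp add: x_def powr_divide powr_powr)
    have "(\<Sum>i\<in>I. x i powr p) = 1"
      unfolding xp sum_divide_distrib[symmetric] B_def[symmetric] using B by simp
    moreover have "(\<Sum>i\<in>I. (x i * b i) powr s) = B powr (s / P)"
    proof -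
      have e: "P / p * s + s = P" using s p True by (simp add: P_def field_simps)
      have e2: "1 - s / p = s / P" using s p True by (simp add: P_def field_simps)
      have "(x i * b i) powr s = b i powr P / B powr (s / p)" if "i \<in> I" for i
        using b[OF that] B e s p
        by (simp add: x_def powr_mult powr_divide powr_powr powr_add[symmetric] mult.commute add.commute)
      then have "(\<Sum>i\<in>I. (x i * b i) powr s) = (\<Sum>i\<in>I. b i powr P / B powr (s / p))" by simp
      also have "\<dots> = B / B powr (s / p)" by (simp add: B_def sum_divide_distrib)
      also have "\<dots> = B powr (1 - s / p)" using B by (simp add: powr_diff)
      finally show ?thesis by (simp add: e2)
    qed
    moreover have "0 \<le> x i" for i by (simp add: x_def)
    ultimately show ?thesis using dn by (intro exI[of _ x]) auto
  qed
next
  case False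
  have "Max (b ` I) \<in> b ` I" using I by (intro Max_in) auto
  then obtain k where k: "k \<in> I" "Max (b ` I) = b k" by auto
  define x :: "_ \<Rightarrow> real" where "x i = (if i = k then 1 else 0)" for i
  have "(\<Sum>i\<in>I. x i powr p) = (\<Sum>i\<in>I. if i = k then 1 else 0)"
    by (intro sum.cong) (auto simp: x_def)
  then have "(\<Sum>i\<in>I. x i powr p) = 1" using k I by simp
  moreover have "(\<Sum>i\<in>I. (x i * b i) powr s) = (\<Sum>i\<in>I. if i = k then b k powr s else 0)"
    by (intro sum.cong) (auto simp: x_def)
  then have "(\<Sum>i\<in>I. (x i * b i) powr s) = b k powr s" using k I by simp
  ultimately show ?thesis using False k by (intro exI[of _ x]) (auto simp: x_def dual_norm_def)
qed

text \<open>
  The mixed norm of condition (ii), restricted to finitely many levels.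
\<close>

definition dual_norm2 :: "real \<Rightarrow> real \<Rightarrow> real \<Rightarrow> real \<Rightarrow> 'j set \<Rightarrow> ('j \<Rightarrow> 'l set) \<Rightarrow> ('j \<Rightarrow> 'l \<Rightarrow> real) \<Rightarrow> real" where
  "dual_norm2 p q s t J L b = dual_norm t q J (\<lambda>j. dual_norm s p (L j) (b j))"

lemma dual_norm2_Hoelder:
  assumes J: "finite J" "J \<noteq> {}" and L: "\<And>j. j \<in> J \<Longrightarrow> finite (L j)" "\<And>j. j \<in> J \<Longrightarrow> L j \<noteq> {}"
    and a: "\<And>j l. j \<in> J \<Longrightarrow> l \<in> L j \<Longrightarrow> 0 \<le> a j l" and b: "\<And>j l. j \<in> J \<Longrightarrow> l \<in> L j \<Longrightarrow> 0 \<le> b j l"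
    and pos: "0 < p" "0 < q" "0 < s" "0 < t"
  shows "(\<Sum>j\<in>J. (\<Sum>l\<in>L j. (a j l * b j l) powr s) powr (t / s))
     \<le> dual_norm2 p q s t J L b powr t * (\<Sum>j\<in>J. (\<Sum>l\<in>L j. a j l powr p) powr (q / p)) powr (t / q)"
proof -
  define D where "D j = dual_norm s p (L j) (b j)" for j
  define X where "X j = (\<Sum>l\<in>L j. a j l powr p) powr (1 / p)" for j
  have D0: "0 \<le> D j" if "j \<in> J" for j unfolding D_def using L b that by (intro dual_norm_nonneg) auto
  have X0: "0 \<le> X j" for j by (simp add: X_def)
  have "(\<Sum>l\<in>L j. (a j l * b j l) powr s) powr (t / s) \<le> (X j * D j) powr t" if j: "j \<in> J" for j
  proof -
    have "(\<Sum>l\<in>L j. (a j l * b j l) powr s) \<le> D j powr s * (\<Sum>l\<in>L j. a j l powr p) powr (s / p)"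
      unfolding D_def using L a b j pos by (intro dual_norm_Hoelder) auto
    also have "\<dots> = (X j * D j) powr s"
      using D0[OF j] X0[of j] pos by (simp add: powr_mult X_def powr_powr)
    finally have "(\<Sum>l\<in>L j. (a j l * b j l) powr s) powr (t / s) \<le> ((X j * D j) powr s) powr (t / s)"
      using pos by (intro powr_mono2) (auto intro!: sum_nonneg)
    then show ?thesis using pos by (simp add: powr_powr)
  qed
  then have "(\<Sum>j\<in>J. (\<Sum>l\<in>L j. (a j l * b j l) powr s) powr (t / s)) \<le> (\<Sum>j\<in>J. (X j * D j) powr t)"
    by (intro sum_mono) auto
  also have "\<dots> \<le> dual_norm t q J D powr t * (\<Sum>j\<in>J. X j powr q) powr (t / q)"
    using J D0 X0 pos by (intro dual_norm_Hoelder) auto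
  also have "dual_norm t q J D = dual_norm2 p q s t J L b" by (simp add: dual_norm2_def D_def[abs_def])
  also have "(\<Sum>j\<in>J. X j powr q) = (\<Sum>j\<in>J. (\<Sum>l\<in>L j. a j l powr p) powr (q / p))"
    by (simp add: X_def powr_powr)
  finally show ?thesis .
qed

text \<open>
  The extremal array is the product of an extremal sequence for the level norms with extremal sequences on the levels.
\<close>

lemma dual_norm2_attained:
  assumes J: "finite J" "J \<noteq> {}" and L: "\<And>j. j \<in> J \<Longrightarrow> finite (L j)" "\<And>j. j \<in> J \<Longrightarrow> L j \<noteq> {}"
    and b: "\<And>j l. j \<in> J \<Longrightarrow> l \<in> L j \<Longrightarrow> 0 \<le> b j l"
    and pos: "0 < p" "0 < q" "0 < s" "0 < t"
  shows "\<exists>x. (\<forall>j l. 0 \<le> x j l) \<and> (\<Sum>j\<in>J. (\<Sum>l\<in>L j. x j l powr p) powr (q / p)) \<le> 1 \<and>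
     dual_norm2 p q s t J L b powr t \<le> (\<Sum>j\<in>J. (\<Sum>l\<in>L j. (x j l * b j l) powr s) powr (t / s))"
proof -
  define D where "D j = dual_norm s p (L j) (b j)" for j
  have D0: "0 \<le> D j" if "j \<in> J" for j unfolding D_def using L b that by (intro dual_norm_nonneg) auto
  have "\<forall>j\<in>J. \<exists>x. (\<forall>i. 0 \<le> x i) \<and> (\<Sum>i\<in>L j. x i powr p) \<le> 1 \<and>
           D j powr s \<le> (\<Sum>i\<in>L j. (x i * b j i) powr s)"
    unfolding D_def using L b pos by (intro ballI dual_norm_attained) auto
  from bchoice[OF this] obtain x where "\<forall>j\<in>J. (\<forall>i. 0 \<le> x j i) \<and> (\<Sum>i\<in>L j. x j i powr p) \<le> 1 \<and>
           D j powr s \<le> (\<Sum>i\<in>L j. (x j i * b j i) powr s)" ..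
  then have x: "\<And>j i. j \<in> J \<Longrightarrow> 0 \<le> x j i" "\<And>j. j \<in> J \<Longrightarrow> (\<Sum>i\<in>L j. x j i powr p) \<le> 1"
    "\<And>j. j \<in> J \<Longrightarrow> D j powr s \<le> (\<Sum>i\<in>L j. (x j i * b j i) powr s)" by auto
  obtain y where y: "\<And>j. 0 \<le> y j" "(\<Sum>j\<in>J. y j powr q) \<le> 1"
    "dual_norm t q J D powr t \<le> (\<Sum>j\<in>J. (y j * D j) powr t)"
    using dual_norm_attained[of J D t q] J D0 pos by auto
  define z where "z j l = (if j \<in> J then y j * x j l else 0)" for j l
  have "(\<Sum>l\<in>L j. z j l powr p) powr (q / p) \<le> y j powr q" if j: "j \<in> J" for j
  proof -
    have "(\<Sum>l\<in>L j. z j l powr p) = y j powr p * (\<Sum>l\<in>L j. x j l powr p)"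
      using j y x by (simp add: z_def powr_mult sum_distrib_left)
    also have "\<dots> \<le> y j powr p" using x(2)[OF j] by (intro mult_left_le) auto
    finally have "(\<Sum>l\<in>L j. z j l powr p) powr (q / p) \<le> (y j powr p) powr (q / p)"
      using pos by (intro powr_mono2) (auto intro!: sum_nonneg)
    then show ?thesis using pos by (simp add: powr_powr)
  qed
  then have "(\<Sum>j\<in>J. (\<Sum>l\<in>L j. z j l powr p) powr (q / p)) \<le> (\<Sum>j\<in>J. y j powr q)" by (intro sum_mono) auto
  then have 1: "(\<Sum>j\<in>J. (\<Sum>l\<in>L j. z j l powr p) powr (q / p)) \<le> 1" using y(2) by simp
  have "(y j * D j) powr t \<le> (\<Sum>l\<in>L j. (z j l * b j l) powr s) powr (t / s)" if j: "j \<in> J" for j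
  proof -
    have "(y j * D j) powr s = y j powr s * D j powr s" using y D0[OF j] by (simp add: powr_mult)
    also have "\<dots> \<le> y j powr s * (\<Sum>l\<in>L j. (x j l * b j l) powr s)" by (intro mult_left_mono x(3) j) auto
    also have "\<dots> = (\<Sum>l\<in>L j. (z j l * b j l) powr s)"
      using j y x b unfolding sum_distrib_left by (intro sum.cong) (auto simp: z_def powr_mult)
    finally have "((y j * D j) powr s) powr (t / s) \<le> (\<Sum>l\<in>L j. (z j l * b j l) powr s) powr (t / s)"
      using pos by (intro powr_mono2) auto
    then show ?thesis using pos by (simp add: powr_powr)
  qed
  then have "(\<Sum>j\<in>J. (y j * D j) powr t) \<le> (\<Sum>j\<in>J. (\<Sum>l\<in>L j. (z j l * b j l) powr s) powr (t / s))"
    by (intro sum_mono) auto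
  then have 2: "dual_norm2 p q s t J L b powr t \<le> (\<Sum>j\<in>J. (\<Sum>l\<in>L j. (z j l * b j l) powr s) powr (t / s))"
    using y(3) by (simp add: dual_norm2_def D_def[abs_def])
  have "0 \<le> z j l" for j l using y x by (simp add: z_def)
  then show ?thesis using 1 2 by (intro exI[of _ z]) auto
qed

lemma epowr_ennreal: "0 \<le> x \<Longrightarrow> epowr (ennreal x) a = ennreal (x powr a)"
  by (simp add: epowr_def)

lemma epowr_mono: "x \<le> y \<Longrightarrow> 0 < a \<Longrightarrow> epowr x a \<le> epowr y a"
  by (cases x; cases y) (auto simp: epowr_def intro!: ennreal_leI powr_mono2 simp: top_unique)

lemma epowr_epowr_inverse: "0 < a \<Longrightarrow> epowr (epowr x a) (1 / a) = x"
  by (cases x) (auto simp: epowr_def powr_powr)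

lemma dual_exponent:
  assumes "0 < s" "0 < p"
  shows "ennreal s * conj_exponent (p / s) = (if s < p then ennreal (s * p / (p - s)) else top)"
proof (cases "s < p")
  case True
  then have "s * (p / s / (p / s - 1)) = s * p / (p - s)" using assms by (simp add: field_simps)
  then show ?thesis using True assms
    by (simp add: conj_exponent_def ennreal_mult'[symmetric] less_divide_eq del: times_divide_eq_right)
next
  case False
  then show ?thesis using assms by (simp add: conj_exponent_def ennreal_mult_top less_divide_eq)
qed

lemma lp_norm_dual_norm:
  assumes I: "finite I" "I \<noteq> {}" and b: "\<And>i. i \<in> I \<Longrightarrow> 0 \<le> b i" and pos: "0 < s" "0 < p"
  shows "lp_norm (ennreal s * conj_exponent (p / s)) I (\<lambda>i. ennreal (b i)) = ennreal (dual_norm s p I b)"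
proof (cases "s < p")
  case True
  define P where "P = s * p / (p - s)"
  have P: "0 < P" using pos True by (simp add: P_def)
  have "(\<integral>\<^sup>+i. epowr (ennreal (b i)) P \<partial>count_space I) = (\<Sum>i\<in>I. ennreal (b i powr P))"
    using I b by (simp add: nn_integral_count_space_finite epowr_ennreal)
  also have "\<dots> = ennreal (\<Sum>i\<in>I. b i powr P)" by (rule sum_ennreal) auto
  finally show ?thesis using True pos P
    by (simp add: dual_exponent lp_norm_def dual_norm_def epowr_ennreal sum_nonneg flip: P_def)
       (simp add: P_def)
next
  case False
  have "(SUP i\<in>I. ennreal (b i)) = ennreal (Max (b ` I))"
  proof (rule antisym)
    show "(SUP i\<in>I. ennreal (b i)) \<le> ennreal (Max (b ` I))"
      using I by (intro SUP_least ennreal_leI) auto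
    have "Max (b ` I) \<in> b ` I" using I by (intro Max_in) auto
    then show "ennreal (Max (b ` I)) \<le> (SUP i\<in>I. ennreal (b i))" by (auto intro: SUP_upper)
  qed
  then show ?thesis using False pos by (simp add: dual_exponent lp_norm_def dual_norm_def)
qed

lemma lp_norm_mono_set:
  assumes sub: "I \<subseteq> I'" and P: "0 < P"
  shows "lp_norm P I a \<le> lp_norm P I' a"
proof (cases "P = top")
  case True
  then show ?thesis using sub by (simp add: lp_norm_def SUP_subset_mono)
next
  case False
  then have P0: "0 < enn2real P" using P by (simp add: enn2real_positive_iff less_top)
  have "(\<integral>\<^sup>+i. epowr (a i) (enn2real P) \<partial>count_space I) \<le> (\<integral>\<^sup>+i. epowr (a i) (enn2real P) \<partial>count_space I')"
    using sub by (subst (1 2) nn_integral_count_space_indicator)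
      (auto intro!: nn_integral_mono simp: indicator_def)
  then show ?thesis using False P0 by (simp add: lp_norm_def epowr_mono)
qed

text \<open>
  Together with \<open>lp_norm_mono_set\<close>: the norm over all levels is the supremum of the norms over finitely many levels.
\<close>

lemma lp_norm_atLeast_le:
  assumes le: "\<And>n. 1 \<le> n \<Longrightarrow> lp_norm P {1..n} a \<le> c" and P: "0 < P"
  shows "lp_norm P {1::nat..} a \<le> c"
proof (cases "P = top")
  case True
  have "a i \<le> c" if "1 \<le> i" for i
  proof -
    have "a i \<le> (SUP k\<in>{1..i}. a k)" using that by (intro SUP_upper) auto
    then show ?thesis using le[OF that] True by (simp add: lp_norm_def)
  qed
  then show ?thesis using True by (auto simp: lp_norm_def intro!: SUP_least)
next
  case False
  define P' where "P' = enn2real P"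
  have P0: "0 < P'" using P False by (simp add: P'_def enn2real_positive_iff less_top)
  have "(\<Sum>i<n. epowr (a i) P' * indicator {1..} i) \<le> epowr c P'" for n
  proof -
    have "(\<Sum>i<n. epowr (a i) P' * indicator {1..} i) \<le> (\<Sum>i\<in>{1..n+1}. epowr (a i) P')"
    proof -
      have "(\<Sum>i<n. epowr (a i) P' * indicator {1..} i) = (\<Sum>i\<in>{..<n} \<inter> {1..}. epowr (a i) P')"
        unfolding sum.inter_restrict[OF finite_lessThan] by (intro sum.cong) (auto simp: indicator_def)
      also have "\<dots> \<le> (\<Sum>i\<in>{1..n+1}. epowr (a i) P')" by (intro sum_mono2) auto
      finally show ?thesis .
    qed
    also have "\<dots> = (\<integral>\<^sup>+i. epowr (a i) P' \<partial>count_space {1..n+1})" by (simp add: nn_integral_count_space_finite)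
    also have "\<dots> = epowr (epowr \<dots> (1 / P')) (1 / (1 / P'))" using P0 by (intro epowr_epowr_inverse[symmetric]) simp
    also have "\<dots> \<le> epowr c P'"
      using le[of "n+1"] False P0 by (simp add: lp_norm_def P'_def epowr_mono)
    finally show ?thesis .
  qed
  then have "(\<Sum>i. epowr (a i) P' * indicator {1..} i) \<le> epowr c P'"
    by (subst suminf_eq_SUP) (rule SUP_least)
  then have "(\<integral>\<^sup>+i. epowr (a i) P' \<partial>count_space {1..}) \<le> epowr c P'"
    by (subst nn_integral_count_space_indicator) (auto simp: nn_integral_count_space_nat)
  then have "epowr (\<integral>\<^sup>+i. epowr (a i) P' \<partial>count_space {1..}) (1 / P') \<le> epowr (epowr c P') (1 / P')"
    using P0 by (intro epowr_mono) auto
  then show ?thesis using False P0 by (simp add: lp_norm_def P'_def epowr_epowr_inverse)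
qed

lemma lpq_norm_le_iff_dual_norm2:
  assumes L: "\<And>j. finite (L j)" "\<And>j. L j \<noteq> {}" and pos: "0 < p" "0 < q" "0 < s" "0 < t"
    and b: "\<And>j l. 0 \<le> b j l"
  defines "N \<equiv> lpq_norm (ennreal s * conj_exponent (p / s)) (ennreal t * conj_exponent (q / t)) {1::nat..} L
      (\<lambda>j l. of_real (b j l))"
  shows "N \<le> c \<longleftrightarrow> (\<forall>J\<ge>1. ennreal (dual_norm2 p q s t {1..J} L b) \<le> c)"
proof -
  define Q where "Q = ennreal t * conj_exponent (q / t)"
  define D where "D j = dual_norm s p (L j) (b j)" for j
  have Q0: "0 < Q" using pos by (simp add: Q_def dual_exponent)
  have D0: "0 \<le> D j" for j unfolding D_def using L b by (intro dual_norm_nonneg) auto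
  have N: "N = lp_norm Q {1..} (\<lambda>j. ennreal (D j))"
    unfolding N_def lpq_norm_def Q_def D_def using b L pos by (simp add: lp_norm_dual_norm)
  have e: "lp_norm Q {1..J} (\<lambda>j. ennreal (D j)) = ennreal (dual_norm2 p q s t {1..J} L b)" if "1 \<le> J" for J
    unfolding dual_norm2_def Q_def D_def[symmetric] using that D0 pos by (intro lp_norm_dual_norm) auto
  have up: "ennreal (dual_norm2 p q s t {1..J} L b) \<le> N" if "1 \<le> J" for J
    unfolding e[OF that, symmetric] N using Q0 by (intro lp_norm_mono_set) auto
  show ?thesis
  proof
    assume "N \<le> c"
    then show "\<forall>J\<ge>1. ennreal (dual_norm2 p q s t {1..J} L b) \<le> c" using up order_trans by blast
  next
    assume "\<forall>J\<ge>1. ennreal (dual_norm2 p q s t {1..J} L b) \<le> c"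
    then show "N \<le> c" unfolding N using Q0 e by (intro lp_norm_atLeast_le) auto
  qed
qed

section \<open>Weights at lacunary radii\<close>

lemma radius_0 [simp]: "radius K 0 = 0"
  by (simp add: radius_def)

lemma radius_mono:
  assumes "2 \<le> K" "i \<le> j"
  shows "radius K i \<le> radius K j"
  using assms by (simp add: radius_def frac_le power_increasing)

lemma radius_bounds:
  assumes "2 \<le> K"
  shows "0 \<le> radius K j" "radius K j < 1"
  using assms radius_mono[of K 0 j] by (simp_all add: radius_def)

lemma radius_gap:
  assumes "2 \<le> K"
  shows "1 / real K ^ Suc j \<le> radius K (Suc j) - radius K j"
proof -
  have "2 * real K ^ j \<le> real K ^ Suc j" using assms by simp
  then show ?thesis using assms by (simp add: radius_def field_simps)
qed

lemma radius_ge_half: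
  assumes K: "2 \<le> K" and j: "1 \<le> j"
  shows "1 / 2 \<le> radius K j"
proof -
  have "real K \<le> real K ^ j" using K j by (intro self_le_power) auto
  then have "2 \<le> real K ^ j" using K by linarith
  then have "1 / real K ^ j \<le> 1 / 2" using K by (intro divide_left_mono) auto
  then show ?thesis by (simp add: radius_def)
qed

lemma arc_length_le:
  assumes "2 \<le> K"
  shows "2 * pi / real (K ^ (j + 2)) \<le> 2 / real K ^ j"
proof -
  \<comment> \<open>the factor \<open>K\<^sup>2 \<ge> 4 > \<pi>\<close> in the number of arcs absorbs \<open>\<pi>\<close>\<close>
  have "(2::real)\<^sup>2 \<le> (real K)\<^sup>2" using assms by (intro power_mono) auto
  then have "pi / (real K)\<^sup>2 \<le> 1" using pi_less_4 assms by simp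
  then have "2 * (pi / (real K)\<^sup>2) / real K ^ j \<le> 2 * 1 / real K ^ j"
    by (intro divide_right_mono mult_left_mono) auto
  then show ?thesis by (simp add: power_add power2_eq_square mult_ac)
qed

lemma radius_interval:
  assumes K: "2 \<le> K" and r: "0 \<le> r" "r < 1"
  shows "\<exists>j. radius K j \<le> r \<and> r < radius K (Suc j)"
proof -
  obtain m where "(1 / real K) ^ m < 1 - r"
    using real_arch_pow_inv[of "1 - r" "1 / real K"] r K by auto
  then have ex: "\<exists>m. r < radius K m" by (intro exI[of _ m]) (simp add: radius_def power_one_over)
  define m0 where "m0 = (LEAST m. r < radius K m)"
  have m0: "r < radius K m0" unfolding m0_def using ex by (rule LeastI_ex)
  have "m0 \<noteq> 0" using m0 r by (metis radius_0 not_le)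
  then obtain j where j: "m0 = Suc j" using not0_implies_Suc by blast
  have "\<not> r < radius K j" using not_less_Least[of j "\<lambda>m. r < radius K m"] j m0_def by auto
  then show ?thesis using m0 j by (intro exI[of _ j]) auto
qed

text \<open>
  What a weight of \<^const>\<open>D_class\<close> satisfies at the radii of the theorem, see \<open>lacunary_weight_D_class\<close>:
  \<open>decay\<close> is the condition that selects \<open>K\<close>, and \<open>doubling\<close> is the condition of \<^const>\<open>D_hat\<close>,
  iterated.
\<close>

locale lacunary_weight =
  fixes w :: "real \<Rightarrow> real" and K :: nat and C D :: real
  assumes weight: "radial_weight w" and K: "2 \<le> K" and C: "1 < C" and D: "1 \<le> D"
    and decay: "\<And>j. C * weight_tail w (radius K (Suc j)) \<le> weight_tail w (radius K j)"
    and doubling: "\<And>j. weight_tail w (radius K j) \<le> D * weight_tail w (radius K (Suc j))"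
begin

definition tail :: "nat \<Rightarrow> real" where "tail j = weight_tail w (radius K j)"

lemma tail_pos: "0 < tail j"
  using weight radius_bounds[OF K, of j] by (auto simp: tail_def radial_weight_def)

lemma tail_decay: "C ^ m * tail (i + m) \<le> tail i"
proof (induction m)
  case (Suc m)
  have "C ^ Suc m * tail (i + Suc m) = C ^ m * (C * tail (Suc (i + m)))" by simp
  also have "\<dots> \<le> C ^ m * tail (i + m)" using decay[of "i + m"] C by (intro mult_left_mono) (auto simp: tail_def)
  finally show ?case using Suc by linarith
qed simp

lemma tail_doubling: "tail i \<le> D ^ m * tail (i + m)"
proof (induction m)
  case (Suc m)
  have "tail (i + m) \<le> D * tail (i + Suc m)" using doubling[of "i + m"] by (simp add: tail_def)
  then have "D ^ m * tail (i + m) \<le> D ^ m * (D * tail (i + Suc m))" using D by (intro mult_left_mono) auto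
  then show ?case using Suc by (simp add: mult_ac)
qed simp

lemma tail_Suc_le: "tail (Suc j) \<le> tail j"
proof -
  have "1 * tail (Suc j) \<le> C * tail (Suc j)" using C tail_pos[of "Suc j"] by (intro mult_right_mono) auto
  then show ?thesis using decay[of j] by (simp add: tail_def)
qed

lemma tail_diff: "(1 - 1 / C) * tail j \<le> tail j - tail (Suc j)"
  using decay[of j] C by (simp add: tail_def field_simps)

lemma weight_nonneg: "0 \<le> r \<Longrightarrow> r < 1 \<Longrightarrow> 0 \<le> w r"
  using weight by (auto simp: radial_weight_def)

lemma weight_measurable:
  "(\<lambda>r. ennreal (w r) * indicator {radius K i..<radius K (Suc i)} r) \<in> borel_measurable lebesgue"
proof -
  have "set_integrable lebesgue {0..<1} w" using weight by (simp add: radial_weight_def)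
  then have "(\<lambda>x. indicator {0..<1} x *\<^sub>R w x) \<in> borel_measurable lebesgue"
    unfolding set_integrable_def by (rule borel_measurable_integrable)
  then have "(\<lambda>x. ennreal (indicator {0..<1} x *\<^sub>R w x) * indicator {radius K i..<radius K (Suc i)} x) \<in> borel_measurable lebesgue"
    by (intro borel_measurable_times_ennreal) (auto intro!: borel_measurable_indicator)
  also have "(\<lambda>x. ennreal (indicator {0..<1} x *\<^sub>R w x) * indicator {radius K i..<radius K (Suc i)} x)
     = (\<lambda>r. ennreal (w r) * indicator {radius K i..<radius K (Suc i)} r)"
    using radius_bounds(1)[OF K, of i] radius_bounds(2)[OF K, of "Suc i"] by (intro ext) (simp add: indicator_def)
  finally show ?thesis .
qed

lemma weight_ring:
  "(\<integral>\<^sup>+r. ennreal (w r) * indicator {radius K i..<radius K (Suc i)} r \<partial>lebesgue) = ennreal (tail i - tail (Suc i))"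
proof -
  define a where "a = radius K i"
  define b where "b = radius K (Suc i)"
  have ab: "0 \<le> a" "a \<le> b" "b < 1"
    using radius_bounds[OF K] radius_mono[OF K, of i "Suc i"] by (auto simp: a_def b_def)
  have ai: "w absolutely_integrable_on {0..<1}" using weight by (simp add: radial_weight_def)
  have sub: "w absolutely_integrable_on {x..<y}" if "0 \<le> x" "y \<le> 1" for x y
    by (rule set_integrable_subset[OF ai]) (use that in auto)
  have int: "w integrable_on {x..<y}" if "0 \<le> x" "y \<le> 1" for x y
    using sub[OF that] absolutely_integrable_on_def by blast
  have un: "{a..<b} \<union> {b..<1} = {a..<1}" using ab by auto
  have "integral {a..<1} w = integral {a..<b} w + integral {b..<1} w"
    unfolding un[symmetric] by (rule integral_Un) (use ab int in auto)
  then have dif: "tail i - tail (Suc i) = integral {a..<b} w" by (simp add: tail_def weight_tail_def a_def b_def)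
  have hi: "(w has_integral (tail i - tail (Suc i))) {a..<b}"
    unfolding dif using int ab by (intro integrable_integral) auto
  have nn: "\<And>x. x \<in> {a..<b} \<Longrightarrow> 0 \<le> w x" using ab weight_nonneg by auto
  have "integral\<^sup>N lebesgue (\<lambda>x. indicator {a..<b} x * ennreal (w x)) = ennreal (tail i - tail (Suc i))"
  proof -
    have "(LINT x:{a..<b}|lebesgue. w x) = tail i - tail (Suc i)"
      using set_lebesgue_integral_eq_integral(2)[OF sub] ab dif by auto
    moreover have "(\<integral>\<^sup>+x\<in>{a..<b}. ennreal (w x) \<partial>lebesgue) = ennreal (LINT x:{a..<b}|lebesgue. w x)"
    proof -
      have "integrable lebesgue (\<lambda>x. indicator {a..<b} x *\<^sub>R w x)"
        using sub ab unfolding set_integrable_def by auto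
      then have "(\<integral>\<^sup>+x. ennreal (indicator {a..<b} x *\<^sub>R w x) \<partial>lebesgue) = ennreal (LINT x:{a..<b}|lebesgue. w x)"
        unfolding set_lebesgue_integral_def using nn
        by (intro nn_integral_eq_integral) (auto simp: indicator_def)
      moreover have "ennreal (indicator {a..<b} x *\<^sub>R w x) = ennreal (w x) * indicator {a..<b} x" for x
        by (simp add: indicator_def)
      ultimately show ?thesis by simp
    qed
    ultimately show ?thesis by (simp add: mult.commute)
  qed
  then show ?thesis by (simp add: a_def b_def mult.commute)
qed

text \<open>
  Means will be compared with step functions of the radius, so that measurability is a matter of the weight alone.
\<close>

lemma step_function_integral:
  assumes c: "\<And>j. 0 \<le> c j"
    and F: "\<And>r j. radius K j \<le> r \<Longrightarrow> r < radius K (Suc j) \<Longrightarrow> F r = ennreal (c j * w r)"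
  shows "(\<integral>\<^sup>+r\<in>{0..<1}. F r \<partial>lebesgue) = (\<Sum>j. ennreal (c j * (tail j - tail (Suc j))))"
proof -
  define R where "R j = {radius K j..<radius K (Suc j)}" for j
  have uniq: "i = j" if "r \<in> R i" "r \<in> R j" for r i j
  proof (rule ccontr)
    assume "i \<noteq> j"
    then have "Suc i \<le> j \<or> Suc j \<le> i" by linarith
    then show False using that radius_mono[OF K, of "Suc i" j] radius_mono[OF K, of "Suc j" i]
      by (auto simp: R_def)
  qed
  have eq: "F r * indicator {0..<1} r = (\<Sum>j. ennreal (c j) * (ennreal (w r) * indicator (R j) r))" for r
  proof (cases "r \<in> {0..<1}")
    case True
    then obtain i where i: "r \<in> R i" using radius_interval[OF K, of r] by (auto simp: R_def)
    have "(\<Sum>j. ennreal (c j) * (ennreal (w r) * indicator (R j) r))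
        = (\<Sum>j\<in>{i}. ennreal (c j) * (ennreal (w r) * indicator (R j) r))"
      using uniq[OF i] by (intro suminf_finite) (auto simp: indicator_def)
    also have "\<dots> = F r" using i F[of i r] c[of i] True weight_nonneg[of r] by (simp add: ennreal_mult R_def)
    finally show ?thesis using True by simp
  next
    case False
    have "r \<notin> R j" for j using False radius_bounds[OF K, of j] radius_bounds[OF K, of "Suc j"] by (auto simp: R_def)
    then show ?thesis using False by simp
  qed
  have "(\<integral>\<^sup>+r\<in>{0..<1}. F r \<partial>lebesgue) = (\<integral>\<^sup>+r. (\<Sum>j. ennreal (c j) * (ennreal (w r) * indicator (R j) r)) \<partial>lebesgue)"
    by (simp only: eq)
  also have "\<dots> = (\<Sum>j. \<integral>\<^sup>+r. ennreal (c j) * (ennreal (w r) * indicator (R j) r) \<partial>lebesgue)"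
    unfolding R_def by (intro nn_integral_suminf borel_measurable_times_ennreal weight_measurable) auto
  also have "\<dots> = (\<Sum>j. ennreal (c j) * ennreal (tail j - tail (Suc j)))"
    unfolding R_def by (subst nn_integral_cmult[OF weight_measurable]) (simp add: weight_ring)
  also have "\<dots> = (\<Sum>j. ennreal (c j * (tail j - tail (Suc j))))"
    using c tail_Suc_le by (simp add: ennreal_mult)
  finally show ?thesis .
qed

lemma ring_index:
  obtains J where "\<And>r j. radius K j \<le> r \<Longrightarrow> r < radius K (Suc j) \<Longrightarrow> J r = j"
proof
  fix r j assume r: "radius K j \<le> r" "r < radius K (Suc j)"
  show "(LEAST i. r < radius K (Suc i)) = j"
  proof (rule Least_equality)
    show "r < radius K (Suc j)" by (rule r(2))
    fix i assume i: "r < radius K (Suc i)"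
    show "j \<le> i"
    proof (rule ccontr)
      assume "\<not> j \<le> i"
      then have "radius K (Suc i) \<le> radius K j" by (intro radius_mono[OF K]) auto
      then show False using i r by linarith
    qed
  qed
qed

lemma weighted_integral_le:
  assumes c: "\<And>j. 0 \<le> c j" and le: "\<And>j r. radius K j \<le> r \<Longrightarrow> r < radius K (Suc j) \<Longrightarrow> \<Phi> r \<le> c j"
  shows "(\<integral>\<^sup>+r\<in>{0..<1}. ennreal (\<Phi> r * w r) \<partial>lebesgue) \<le> (\<Sum>j. ennreal (c j * tail j))"
proof -
  obtain J where J: "\<And>r j. radius K j \<le> r \<Longrightarrow> r < radius K (Suc j) \<Longrightarrow> J r = j" using ring_index by blast
  have "(\<integral>\<^sup>+r\<in>{0..<1}. ennreal (\<Phi> r * w r) \<partial>lebesgue) \<le> (\<integral>\<^sup>+r\<in>{0..<1}. ennreal (c (J r) * w r) \<partial>lebesgue)"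
  proof (intro nn_integral_mono)
    fix r
    show "ennreal (\<Phi> r * w r) * indicator {0..<1} r \<le> ennreal (c (J r) * w r) * indicator {0..<1} r"
    proof (cases "r \<in> {0..<1}")
      case True
      then obtain j where j: "radius K j \<le> r" "r < radius K (Suc j)" using radius_interval[OF K, of r] by auto
      then show ?thesis using True le[OF j] J[OF j] weight_nonneg[of r]
        by (auto intro!: ennreal_leI mult_right_mono)
    qed simp
  qed
  also have "\<dots> = (\<Sum>j. ennreal (c j * (tail j - tail (Suc j))))"
    by (rule step_function_integral) (use c J in auto)
  also have "\<dots> \<le> (\<Sum>j. ennreal (c j * tail j))"
    using c tail_pos by (intro suminf_le ennreal_leI mult_left_mono) (auto simp: less_imp_le)
  finally show ?thesis .
qed

text \<open>
  The annulus carries the mass \<open>tail j - tail (Suc j)\<close>, which by \<open>decay\<close> is at least a fixed proportion of \<open>tail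
  j\<close>.
\<close>

lemma weighted_integral_ge:
  assumes c: "\<And>j. 0 \<le> c j" and ge: "\<And>j r. radius K j \<le> r \<Longrightarrow> r < radius K (Suc j) \<Longrightarrow> c j \<le> \<Phi> r"
  shows "(\<Sum>j. ennreal ((1 - 1 / C) * (c j * tail j))) \<le> (\<integral>\<^sup>+r\<in>{0..<1}. ennreal (\<Phi> r * w r) \<partial>lebesgue)"
proof -
  obtain J where J: "\<And>r j. radius K j \<le> r \<Longrightarrow> r < radius K (Suc j) \<Longrightarrow> J r = j" using ring_index by blast
  have "(\<Sum>j. ennreal ((1 - 1 / C) * (c j * tail j))) \<le> (\<Sum>j. ennreal (c j * (tail j - tail (Suc j))))"
    using mult_left_mono[OF tail_diff c] by (intro suminf_le ennreal_leI) (auto simp: mult_ac)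
  also have "\<dots> = (\<integral>\<^sup>+r\<in>{0..<1}. ennreal (c (J r) * w r) \<partial>lebesgue)"
    by (rule step_function_integral[symmetric]) (use c J in auto)
  also have "\<dots> \<le> (\<integral>\<^sup>+r\<in>{0..<1}. ennreal (\<Phi> r * w r) \<partial>lebesgue)"
  proof (intro nn_integral_mono)
    fix r
    show "ennreal (c (J r) * w r) * indicator {0..<1} r \<le> ennreal (\<Phi> r * w r) * indicator {0..<1} r"
    proof (cases "r \<in> {0..<1}")
      case True
      then obtain j where j: "radius K j \<le> r" "r < radius K (Suc j)" using radius_interval[OF K, of r] by auto
      then show ?thesis using True ge[OF j] J[OF j] weight_nonneg[of r]
        by (auto intro!: ennreal_leI mult_right_mono)
    qed simp
  qed
  finally show ?thesis .
qed

end

lemma weight_tail_antimono: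
  assumes w: "radial_weight w" and r: "0 \<le> a" "a \<le> b" "b < 1"
  shows "weight_tail w b \<le> weight_tail w a"
proof -
  have ai: "w absolutely_integrable_on {0..<1}" using w by (simp add: radial_weight_def)
  have "w absolutely_integrable_on {x..<1}" if "0 \<le> x" for x
    by (rule set_integrable_subset[OF ai]) (use that in auto)
  then have int: "w integrable_on {x..<1}" if "0 \<le> x" for x
    using that absolutely_integrable_on_def by blast
  show ?thesis unfolding weight_tail_def
    by (intro integral_subset_le int) (use r w in \<open>auto simp: radial_weight_def\<close>)
qed

text \<open>
  Replacing the constant of the weight by the larger \<open>K\<close> only strengthens the decay, as tails are nonincreasing. Doubling from
  \<open>r\<^sub>j\<close> to \<open>r\<^sub>j\<^sub>+\<^sub>1\<close> takes \<open>m\<close> steps that halve the distance to 1, where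
  \<open>2\<^sup>m \<ge> K\<close>.
\<close>

lemma lacunary_weight_D_class:
  assumes w: "w \<in> D_class" and Kw: "2 \<le> Kw" "Kw \<le> K" and C: "1 < C"
    and chk: "\<And>r. 0 \<le> r \<Longrightarrow> r < 1 \<Longrightarrow> C * weight_tail w (1 - (1 - r) / real Kw) \<le> weight_tail w r"
  shows "\<exists>D. lacunary_weight w K C D"
proof -
  have K: "2 \<le> K" using Kw by simp
  have rw: "radial_weight w" using w by (simp add: D_class_def D_hat_def)
  obtain H where H: "0 < H" "\<And>r. 0 \<le> r \<Longrightarrow> r < 1 \<Longrightarrow> weight_tail w r \<le> H * weight_tail w ((1 + r) / 2)"
    using w by (auto simp: D_class_def D_hat_def)
  define E where "E = max 1 H"
  have tpos: "0 < weight_tail w r" if "0 \<le> r" "r < 1" for r using rw that by (simp add: radial_weight_def)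
  have iter: "weight_tail w r \<le> E ^ m * weight_tail w (1 - (1 - r) / 2 ^ m)" if r: "0 \<le> r" "r < 1" for r m
  proof (induction m)
    case (Suc m)
    define x where "x = 1 - (1 - r) / 2 ^ m"
    define d where "d = (1 - r) / 2 ^ m"
    have "d \<le> (1 - r) / 1" unfolding d_def using r by (intro divide_left_mono) auto
    moreover have "0 < d" unfolding d_def using r by simp
    moreover have "x = 1 - d" by (simp add: x_def d_def)
    ultimately have x: "0 \<le> x" "x < 1" using r by auto
    have e: "(1 + x) / 2 = 1 - (1 - r) / 2 ^ Suc m" by (simp add: x_def field_simps)
    have "weight_tail w x \<le> H * weight_tail w ((1 + x) / 2)" using H(2)[OF x] .
    also have "\<dots> \<le> E * weight_tail w ((1 + x) / 2)"
      using tpos[of "(1 + x) / 2"] x by (intro mult_right_mono) (auto simp: E_def)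
    finally have "E ^ m * weight_tail w x \<le> E ^ m * (E * weight_tail w ((1 + x) / 2))"
      by (intro mult_left_mono) (auto simp: E_def)
    then show ?case using Suc unfolding x_def[symmetric] e[symmetric] by (simp add: mult_ac)
  qed simp
  obtain m :: nat where m: "real K \<le> 2 ^ m"
    using less_exp[of K] by (metis less_imp_le of_nat_le_iff of_nat_numeral of_nat_power)
  have rK: "radius K (Suc j) = 1 - (1 - radius K j) / real K" for j using K by (simp add: radius_def)
  have "lacunary_weight w K C (E ^ m)"
  proof
    show "radial_weight w" "2 \<le> K" "1 < C" "1 \<le> E ^ m" using rw K C by (auto simp: E_def)
    fix j
    define r where "r = radius K j"
    have r: "0 \<le> r" "r < 1" using radius_bounds[OF K] by (auto simp: r_def)
    have sub: "0 \<le> 1 - (1 - r) / x" "1 - (1 - r) / x < 1" if "1 \<le> x" for x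
    proof -
      have "(1 - r) / x \<le> (1 - r) / 1" using r that by (intro divide_left_mono) auto
      then show "0 \<le> 1 - (1 - r) / x" using r by simp
      show "1 - (1 - r) / x < 1" using r that by simp
    qed
    have mono: "weight_tail w (1 - (1 - r) / y) \<le> weight_tail w (1 - (1 - r) / x)" if "1 \<le> x" "x \<le> y" for x y
    proof (rule weight_tail_antimono[OF rw sub(1)[OF that(1)] _ sub(2)])
      show "1 - (1 - r) / x \<le> 1 - (1 - r) / y" using r that by (simp add: divide_left_mono)
    qed (use that in auto)
    show "C * weight_tail w (radius K (Suc j)) \<le> weight_tail w (radius K j)"
    proof -
      have "C * weight_tail w (radius K (Suc j)) \<le> C * weight_tail w (1 - (1 - r) / real Kw)"
        unfolding rK r_def[symmetric] using C Kw by (intro mult_left_mono mono) auto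
      then show ?thesis using chk[OF r] by (simp add: r_def)
    qed
    show "weight_tail w (radius K j) \<le> E ^ m * weight_tail w (radius K (Suc j))"
    proof -
      have "E ^ m * weight_tail w (1 - (1 - r) / 2 ^ m) \<le> E ^ m * weight_tail w (1 - (1 - r) / real K)"
        using m K by (intro mult_left_mono mono) (auto simp: E_def)
      then show ?thesis using iter[OF r, of m] unfolding rK r_def[symmetric] by linarith
    qed
  qed
  then show ?thesis by blast
qed

section \<open>From the sequence condition to the embedding\<close>

definition level_factor :: "real \<Rightarrow> real \<Rightarrow> real \<Rightarrow> nat \<Rightarrow> (real \<Rightarrow> real) \<Rightarrow> (real \<Rightarrow> real) \<Rightarrow> nat \<Rightarrow> nat \<Rightarrow> real" where
  "level_factor p q t n \<omega> \<nu> K j =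
     real K powr (real j * (real n + 1 / p)) * weight_tail \<nu> (radius K j) powr (1 / t)
       * weight_tail \<omega> (radius K j) powr (- (1 / q))"

lemma integral_mean_powr:
  "integral_mean p r f powr q = power_mean p f r powr (q / p)"
  by (simp add: integral_mean_def circle_mean_def powr_powr)

lemma product_mean:
  "integral {0..2 * pi} (\<lambda>\<theta>. cmod (F (of_real r * cis \<theta>)) powr s * cmod (G (of_real r * cis \<theta>)) powr s / (2 * pi))
     = circle_mean (\<lambda>z. cmod (F z * G z) powr s) r"
  by (simp add: circle_mean_def norm_mult powr_mult)

lemma arc_mean_powr:
  assumes "0 < s" "continuous_on (ball 0 1) G" "0 \<le> r" "r < 1"
  shows "arc_mean s G r N l powr s = integral (arc N l) (\<lambda>\<theta>. cmod (G (of_real r * cis \<theta>)) powr s / (2 * pi))"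
proof -
  have "0 \<le> integral (arc N l) (\<lambda>\<theta>. cmod (G (of_real r * cis \<theta>)) powr s / (2 * pi))"
    by (cases "(\<lambda>\<theta>. cmod (G (of_real r * cis \<theta>)) powr s / (2 * pi)) integrable_on arc N l")
       (auto intro: Henstock_Kurzweil_Integration.integral_nonneg simp: not_integrable_integral simp del: integral_divide)
  then show ?thesis using assms by (simp add: arc_mean_def powr_powr del: integral_divide)
qed

lemma powr_norm_circle_continuous:
  assumes "f holomorphic_on ball 0 1" "0 \<le> r" "r < 1" "0 < p"
  shows "continuous_on A (\<lambda>\<theta>. cmod (f (of_real r * cis \<theta>)) powr p)"
proof (intro powr_norm_continuous_on continuous_on_circle assms)
  show "continuous_on (sphere 0 r) f"
    by (rule continuous_on_subset[OF holomorphic_on_imp_continuous_on[OF assms(1)]]) (use assms in auto)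
qed

lemma circle_mean_powr_norm_mono_disc:
  assumes "f holomorphic_on ball 0 1" "0 < p" "0 \<le> r" "r \<le> R" "R < 1"
  shows "power_mean p f r \<le> power_mean p f R"
proof (rule circle_mean_powr_norm_mono)
  have "f holomorphic_on cball 0 R" by (rule holomorphic_on_subset[OF assms(1)]) (use assms in auto)
  then show "continuous_on (cball 0 R) f" by (rule holomorphic_on_imp_continuous_on)
  show "f holomorphic_on ball 0 R" by (rule holomorphic_on_subset[OF assms(1)]) (use assms in auto)
qed (use assms in auto)

lemma circle_mean_arcs:
  assumes "f holomorphic_on ball 0 1" "0 \<le> r" "r < 1" "0 < p" "0 < N"
  shows "power_mean p f r
     = (\<Sum>l<N. integral (arc N l) (\<lambda>\<theta>. cmod (f (of_real r * cis \<theta>)) powr p / (2 * pi)))"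
  unfolding circle_mean_def using assms
  by (subst sum_integral_arcs)
     (auto intro!: integrable_continuous_real powr_norm_circle_continuous simp: integrable_on_divide)

text \<open>
  Bernoulli's inequality, as the exponent is at least \<open>1 / (1 - r\<^sub>j)\<close>. It is the hypothesis of
  \<open>sum_poisson_kernel_roots_le\<close> for the end points of the arcs of level \<open>j\<close>.
\<close>

lemma radius_power_le_half:
  assumes K: "2 \<le> K"
  shows "radius K j ^ (K ^ (j + 2)) \<le> 1 / 2"
proof -
  define x where "x = 1 / real K ^ j"
  have x: "0 < x" "x \<le> 1" using K by (simp_all add: x_def)
  have kk: "K ^ j \<le> K ^ (j + 2)" using K by (intro power_increasing) auto
  have "radius K j ^ (K ^ (j + 2)) \<le> radius K j ^ (K ^ j)"
    by (rule power_decreasing[OF kk]) (use radius_bounds[OF K, of j] in auto)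
  also have "radius K j ^ (K ^ j) = (1 - x) ^ (K ^ j)" by (simp add: radius_def x_def)
  also have "(1 - x) ^ (K ^ j) \<le> 1 / 2"
  proof -
    have "1 + real (K ^ j) * x \<le> (1 + x) ^ (K ^ j)" using x by (intro Bernoulli_inequality) auto
    moreover have "real (K ^ j) * x = 1" using K by (simp add: x_def)
    ultimately have b: "2 \<le> (1 + x) ^ (K ^ j)" by simp
    have "(1 - x) ^ (K ^ j) * 2 \<le> (1 - x) ^ (K ^ j) * (1 + x) ^ (K ^ j)"
      using b x by (intro mult_left_mono) auto
    also have "\<dots> = ((1 - x) * (1 + x)) ^ (K ^ j)" by (simp add: power_mult_distrib)
    also have "\<dots> \<le> 1"
    proof (intro power_le_one)
      show "0 \<le> (1 - x) * (1 + x)" using x by simp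
      show "(1 - x) * (1 + x) \<le> 1" by (simp add: algebra_simps)
    qed
    finally show ?thesis by simp
  qed
  finally show ?thesis .
qed

lemma ratio_power_le_half:
  assumes K: "2 \<le> K" and j: "1 \<le> j"
  shows "(radius K (j - 1) / radius K j) ^ (K ^ (j + 2)) \<le> 1 / 2"
proof -
  define x where "x = 1 / real K ^ j"
  obtain i where i: "j = Suc i" using j by (cases j) auto
  have x: "0 < x" "x \<le> 1 / 2" using radius_ge_half[OF K j] K by (simp_all add: x_def radius_def)
  have rj: "radius K j = 1 - x" by (simp add: radius_def x_def)
  have ri: "radius K (j - 1) = 1 - real K * x" using K by (simp add: radius_def x_def i)
  have "2 * x \<le> real K * x" using K x by (intro mult_right_mono) auto
  moreover have "(1 - x) * (1 - x) = 1 - 2 * x + x * x" by (simp add: algebra_simps)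
  moreover have "0 \<le> x * x" by simp
  ultimately have "radius K (j - 1) \<le> (1 - x) * (1 - x)" unfolding ri by linarith
  then have le: "radius K (j - 1) / radius K j \<le> 1 - x" using x by (simp add: rj field_simps)
  have ge: "0 \<le> radius K (j - 1) / radius K j" using radius_bounds[OF K] by simp
  have "(radius K (j - 1) / radius K j) ^ (K ^ (j + 2)) \<le> radius K j ^ (K ^ (j + 2))"
    by (rule power_mono[OF _ ge]) (use le rj in simp)
  also have "\<dots> \<le> 1 / 2" by (rule radius_power_le_half[OF K])
  finally show ?thesis .
qed

lemma derivative_on_level_arcs_bound:
  assumes f: "f holomorphic_on ball 0 1" and p: "0 < p" and K: "2 \<le> K" and j: "1 \<le> j"
  shows "\<exists>y. (\<forall>l. 0 \<le> y l) \<and>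
     (\<forall>l<K ^ (j + 2). \<forall>\<theta>\<in>arc (K ^ (j + 2)) l.
         cmod ((deriv ^^ n) f (of_real (radius K (j - 1)) * cis \<theta>)) \<le> y l) \<and>
     (\<Sum>l<K ^ (j + 2). y l powr p) \<le>
        432 * (real K)\<^sup>2 * (fact n * 2 ^ n) powr p * real K powr (real j * (real n * p + 1))
          * power_mean p f (radius K j)"
proof -
  define N where "N = K ^ (j + 2)"
  define \<rho> R where "\<rho> = radius K (j - 1)" and "R = radius K j"
  obtain i where i: "j = Suc i" using j by (cases j) auto
  have gap: "1 / real K ^ j \<le> R - \<rho>" using radius_gap[OF K, of i] by (simp add: R_def \<rho>_def i)
  have gap0: "0 < 1 / real K ^ j" using K by simp
  have gap1: "0 < R - \<rho>" using gap gap0 by linarith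
  have N0: "0 < N" using K by (simp add: N_def)
  have M0: "0 \<le> power_mean p f R" by (intro circle_mean_nonneg) auto
  have "\<exists>y. (\<forall>l<N. 0 \<le> y l) \<and>
     (\<forall>l<N. \<forall>\<theta>\<in>arc N l. cmod ((deriv ^^ n) f (of_real \<rho> * cis \<theta>)) \<le> y l) \<and>
     (\<Sum>l<N. y l powr p) \<le>
        432 * real N * (fact n * (2 / (R - \<rho>)) ^ n) powr p * power_mean p f R"
  proof (rule derivative_on_arcs_bound[OF f p])
    show "0 \<le> \<rho>" "R < 1" using radius_bounds[OF K] by (auto simp: \<rho>_def R_def)
    show "\<rho> < R" using gap gap0 by linarith
    show "0 < N" by (rule N0)
    show "2 * pi / real N \<le> 2 * (R - \<rho>)" using arc_length_le[OF K, of j] gap by (simp add: N_def)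
    show "(\<rho> / R) ^ N \<le> 1 / 2" unfolding \<rho>_def R_def N_def by (rule ratio_power_le_half[OF K j])
  qed
  then obtain y where y: "\<And>l. l < N \<Longrightarrow> 0 \<le> y l"
    "\<And>l \<theta>. l < N \<Longrightarrow> \<theta> \<in> arc N l \<Longrightarrow> cmod ((deriv ^^ n) f (of_real \<rho> * cis \<theta>)) \<le> y l"
    "(\<Sum>l<N. y l powr p) \<le>
        432 * real N * (fact n * (2 / (R - \<rho>)) ^ n) powr p * power_mean p f R"
    by blast
  have "2 / (R - \<rho>) \<le> 2 / (1 / real K ^ j)"
    using gap gap0 gap1 by (intro divide_left_mono mult_pos_pos) auto
  then have a: "2 / (R - \<rho>) \<le> 2 * real K ^ j" by simp
  have "(fact n * (2 / (R - \<rho>)) ^ n) powr p \<le> (fact n * (2 * real K ^ j) ^ n) powr p"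
    using a gap gap0 gap1 p by (intro powr_mono2 mult_left_mono power_mono mult_nonneg_nonneg zero_le_power divide_nonneg_pos) auto
  also have "\<dots> = (fact n * 2 ^ n) powr p * real K powr (real j * real n * p)"
    using K by (simp add: power_mult_distrib powr_mult powr_powr flip: powr_realpow)
  finally have b: "(fact n * (2 / (R - \<rho>)) ^ n) powr p \<le> (fact n * 2 ^ n) powr p * real K powr (real j * real n * p)" .
  have c: "real N = (real K)\<^sup>2 * real K powr real j"
    using K by (simp add: N_def power_add powr_realpow power2_eq_square)
  have "432 * real N * (fact n * (2 / (R - \<rho>)) ^ n) powr p * power_mean p f R
     \<le> 432 * real N * ((fact n * 2 ^ n) powr p * real K powr (real j * real n * p)) * power_mean p f R"
    using b M0 by (intro mult_right_mono mult_left_mono) auto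
  also have "\<dots> = 432 * (real K)\<^sup>2 * (fact n * 2 ^ n) powr p * (real K powr real j * real K powr (real j * real n * p))
          * power_mean p f R" by (simp add: c)
  also have "real K powr real j * real K powr (real j * real n * p) = real K powr (real j * (real n * p + 1))"
    by (simp add: powr_add[symmetric] algebra_simps)
  finally have fin: "(\<Sum>l<N. y l powr p) \<le>
        432 * (real K)\<^sup>2 * (fact n * 2 ^ n) powr p * real K powr (real j * (real n * p + 1))
          * power_mean p f R" using y(3) by linarith
  show ?thesis
    unfolding N_def[symmetric] \<rho>_def[symmetric] R_def[symmetric]
    by (rule exI[of _ "\<lambda>l. if l < N then y l else 0"]) (use y fin in auto)
qed

text \<open>
  The set of levels is arbitrary because the sum for \<open>\<omega>\<close> will start at level 1, but the one for \<open>\<nu>\<close> at level 0.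
\<close>

lemma sum_levels_le_integral:
  assumes lw: "lacunary_weight w K C D" and f: "f holomorphic_on ball 0 1" and pos: "0 < p" "0 < q"
    and I: "finite I"
  shows "ennreal ((1 - 1 / C) * (\<Sum>j\<in>I. weight_tail w (radius K j) * power_mean p f (radius K j) powr (q / p)))
     \<le> (\<integral>\<^sup>+r\<in>{0..<1}. ennreal (power_mean p f r powr (q / p) * w r) \<partial>lebesgue)"
proof -
  interpret lacunary_weight w K C D by (rule lw)
  let ?M = "\<lambda>r. power_mean p f r powr (q / p)"
  have "ennreal ((1 - 1 / C) * (\<Sum>j\<in>I. tail j * ?M (radius K j)))
      = (\<Sum>j\<in>I. ennreal ((1 - 1 / C) * (?M (radius K j) * tail j)))"
    using C tail_pos by (subst sum_ennreal) (auto simp: sum_distrib_left mult_ac less_imp_le)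
  also have "\<dots> \<le> (\<Sum>j. ennreal ((1 - 1 / C) * (?M (radius K j) * tail j)))"
    using I by (intro sum_le_suminf) auto
  also have "\<dots> \<le> (\<integral>\<^sup>+r\<in>{0..<1}. ennreal (?M r * w r) \<partial>lebesgue)"
  proof (rule weighted_integral_ge)
    fix j r assume r: "radius K j \<le> r" "r < radius K (Suc j)"
    show "?M (radius K j) \<le> ?M r"
      using r radius_bounds[OF K, of j] radius_bounds[OF K, of "Suc j"] pos f
      by (intro powr_mono2 circle_mean_powr_norm_mono_disc circle_mean_nonneg) auto
  qed auto
  finally show ?thesis by (simp add: tail_def)
qed

text \<open>
  Hoelder's inequality is applied to the array \<open>\<beta>\<close> and to the array \<open>a\<close>, which is the bound \<open>y\<close> for the
  derivative divided by the growth \<open>K\<^sup>j\<^sup>(\<^sup>n\<^sup>+\<^sup>1\<^sup>/\<^sup>p\<^sup>)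
  w\<^sub>j\<^sup>-\<^sup>1\<^sup>/\<^sup>q\<close>, with the tail \<open>w\<^sub>j\<close> of \<open>\<omega>\<close>; its norm in
  \<open>\<ell>\<^sup>p\<^sup>,\<^sup>q\<close> is controlled by the norm of \<open>f\<close>.
\<close>

lemma embedding_of_dual_norm2:
  assumes lwo: "lacunary_weight \<omega> K C\<omega> D\<omega>" and lwv: "lacunary_weight \<nu> K C\<nu> D\<nu>"
    and pos: "0 < p" "0 < q" "0 < s" "0 < t"
  shows "\<exists>c>0. \<forall>G N B. G holomorphic_on ball 0 1 \<longrightarrow> 0 \<le> N \<longrightarrow> 0 < B \<longrightarrow> c * N \<le> B \<longrightarrow>
     (\<forall>J\<ge>1. dual_norm2 p q s t {1..J} (\<lambda>j. {..<K ^ (j + 2)})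
        (\<lambda>j l. level_factor p q t n \<omega> \<nu> K j * arc_mean s G (radius K (j - 1)) (K ^ (j + 2)) l) \<le> N) \<longrightarrow>
     embedding_bound p q s t n \<omega> \<nu> G B"
proof -
  interpret O: lacunary_weight \<omega> K C\<omega> D\<omega> by (rule lwo)
  interpret V: lacunary_weight \<nu> K C\<nu> D\<nu> by (rule lwv)
  note K = O.K
  define A0 where "A0 = 432 * (real K)\<^sup>2 * (fact n * 2 ^ n) powr p"
  have A0: "0 < A0" using K by (simp add: A0_def)
  define k where "k = 1 - 1 / C\<omega>"
  have k: "0 < k" using O.C by (simp add: k_def)
  define c where "c = (D\<nu>\<^sup>2 * (A0 powr (q / p) / k) powr (t / q)) powr (1 / t)"
  have c: "0 < c" using A0 k V.D by (simp add: c_def)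
  have ct: "c powr t = D\<nu>\<^sup>2 * (A0 powr (q / p) / k) powr (t / q)"
    using A0 k V.D pos by (simp add: c_def powr_powr)
  have "embedding_bound p q s t n \<omega> \<nu> G B"
    if G: "G holomorphic_on ball 0 1" and N: "0 \<le> N" and B: "0 < B" "c * N \<le> B"
      and dn: "\<And>J. J \<ge> 1 \<Longrightarrow> dual_norm2 p q s t {1..J} (\<lambda>j. {..<K ^ (j + 2)})
        (\<lambda>j l. level_factor p q t n \<omega> \<nu> K j * arc_mean s G (radius K (j - 1)) (K ^ (j + 2)) l) \<le> N"
    for G N B
    unfolding embedding_bound_def
  proof
    fix f assume fm: "f \<in> mixed_space p q \<omega>"
    then have f: "f holomorphic_on ball 0 1" by (simp add: mixed_space_def)
    define M where "M r = power_mean p f r" for r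
    have M0: "0 \<le> M r" for r unfolding M_def by (intro circle_mean_nonneg) auto
    define Vf where "Vf = (\<integral>\<^sup>+r\<in>{0..<1}. ennreal (M r powr (q / p) * \<omega> r) \<partial>lebesgue)"
    have mn: "mixed_norm p q \<omega> f = epowr Vf (1 / q)"
      by (simp add: mixed_norm_def integral_mean_powr Vf_def M_def)
    have "Vf \<noteq> top" using fm mn by (auto simp: mixed_space_def epowr_def)
    then obtain v where v: "0 \<le> v" "Vf = ennreal v" by (cases Vf) auto
    have vsum: "k * (\<Sum>j=1..J. O.tail j * M (radius K j) powr (q / p)) \<le> v" for J
      using sum_levels_le_integral[OF lwo f pos(1,2), of "{1..J}"] v
      by (simp add: Vf_def M_def O.tail_def k_def)
    define F where "F = (deriv ^^ n) f"
    have F: "F holomorphic_on ball 0 1" unfolding F_def by (intro holomorphic_higher_deriv f) auto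
    have FG: "(\<lambda>z. F z * G z) holomorphic_on ball 0 1" by (intro holomorphic_intros F G)
    define \<Phi> where "\<Phi> r = circle_mean (\<lambda>z. cmod (F z * G z) powr s) r powr (t / s)" for r
    define b where "b j l = arc_mean s G (radius K (j - 1)) (K ^ (j + 2)) l" for j l
    have b0: "0 \<le> b j l" for j l by (simp add: b_def arc_mean_def)
    define \<kappa> where "\<kappa> j = level_factor p q t n \<omega> \<nu> K j" for j
    have \<kappa>: "0 < \<kappa> j" for j using K O.tail_pos[of j] V.tail_pos[of j]
      by (simp add: \<kappa>_def level_factor_def O.tail_def V.tail_def)
    have "\<forall>j. \<exists>y. 1 \<le> j \<longrightarrow> (\<forall>l. 0 \<le> y l) \<and>
       (\<forall>l<K ^ (j + 2). \<forall>\<theta>\<in>arc (K ^ (j + 2)) l. cmod (F (of_real (radius K (j - 1)) * cis \<theta>)) \<le> y l) \<and>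
       (\<Sum>l<K ^ (j + 2). y l powr p) \<le> A0 * real K powr (real j * (real n * p + 1)) * M (radius K j)"
      using derivative_on_level_arcs_bound[OF f pos(1) K, of _ n] unfolding A0_def M_def F_def by blast
    from choice[OF this] obtain y where y:
      "\<And>j l. 1 \<le> j \<Longrightarrow> 0 \<le> y j l"
      "\<And>j l \<theta>. 1 \<le> j \<Longrightarrow> l < K ^ (j + 2) \<Longrightarrow> \<theta> \<in> arc (K ^ (j + 2)) l \<Longrightarrow>
          cmod (F (of_real (radius K (j - 1)) * cis \<theta>)) \<le> y j l"
      "\<And>j. 1 \<le> j \<Longrightarrow> (\<Sum>l<K ^ (j + 2). y j l powr p) \<le> A0 * real K powr (real j * (real n * p + 1)) * M (radius K j)"
      by blast
    define a where "a j l = V.tail j powr (1 / t) / \<kappa> j * y j l" for j l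
    have a0: "0 \<le> a j l" if "1 \<le> j" for j l using y(1)[OF that] \<kappa>[of j] by (simp add: a_def less_imp_le)
    have level: "V.tail j * \<Phi> (radius K (j - 1)) \<le> (\<Sum>l<K ^ (j + 2). (a j l * (\<kappa> j * b j l)) powr s) powr (t / s)"
      if j: "1 \<le> j" for j
    proof -
      define \<rho> where "\<rho> = radius K (j - 1)"
      define N' where "N' = K ^ (j + 2)"
      have \<rho>: "0 \<le> \<rho>" "\<rho> < 1" using radius_bounds[OF K] by (auto simp: \<rho>_def)
      have N': "0 < N'" using K by (simp add: N'_def)
      have Gc: "continuous_on (ball 0 1) G" using G holomorphic_on_imp_continuous_on by blast
      have "circle_mean (\<lambda>z. cmod (F z * G z) powr s) \<rho>
         = (\<Sum>l<N'. integral (arc N' l) (\<lambda>\<theta>. cmod (F (of_real \<rho> * cis \<theta>) * G (of_real \<rho> * cis \<theta>)) powr s / (2 * pi)))"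
        by (rule circle_mean_arcs[OF FG \<rho> pos(3) N'])
      also have "\<dots> \<le> (\<Sum>l<N'. (y j l * b j l) powr s)"
      proof (rule sum_mono)
        fix l assume "l \<in> {..<N'}"
        then have l: "l < N'" by simp
        have "integral (arc N' l) (\<lambda>\<theta>. cmod (F (of_real \<rho> * cis \<theta>) * G (of_real \<rho> * cis \<theta>)) powr s / (2 * pi))
           \<le> integral (arc N' l) (\<lambda>\<theta>. y j l powr s * (cmod (G (of_real \<rho> * cis \<theta>)) powr s / (2 * pi)))"
        proof (rule integral_le)
          show "(\<lambda>\<theta>. cmod (F (of_real \<rho> * cis \<theta>) * G (of_real \<rho> * cis \<theta>)) powr s / (2 * pi)) integrable_on arc N' l"
            unfolding arc_def using powr_norm_circle_continuous[OF FG \<rho> pos(3)]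
            by (intro integrable_continuous_real continuous_on_divide) auto
          show "(\<lambda>\<theta>. y j l powr s * (cmod (G (of_real \<rho> * cis \<theta>)) powr s / (2 * pi))) integrable_on arc N' l"
            unfolding arc_def using powr_norm_circle_continuous[OF G \<rho> pos(3)]
            by (intro integrable_continuous_real continuous_on_divide continuous_on_mult_left) auto
          fix \<theta> assume "\<theta> \<in> arc N' l"
          then have "cmod (F (of_real \<rho> * cis \<theta>)) \<le> y j l" using y(2)[OF j] l by (simp add: N'_def \<rho>_def)
          then show "cmod (F (of_real \<rho> * cis \<theta>) * G (of_real \<rho> * cis \<theta>)) powr s / (2 * pi)
              \<le> y j l powr s * (cmod (G (of_real \<rho> * cis \<theta>)) powr s / (2 * pi))"
            using pos by (simp add: norm_mult powr_mult divide_right_mono mult_right_mono powr_mono2)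
        qed
        also have "\<dots> = y j l powr s * b j l powr s"
          using arc_mean_powr[OF pos(3) Gc \<rho>, of N' l] by (simp add: b_def \<rho>_def N'_def)
        also have "\<dots> = (y j l * b j l) powr s" using y(1)[OF j] b0 by (simp add: powr_mult)
        finally show "integral (arc N' l) (\<lambda>\<theta>. cmod (F (of_real \<rho> * cis \<theta>) * G (of_real \<rho> * cis \<theta>)) powr s / (2 * pi))
           \<le> (y j l * b j l) powr s" .
      qed
      finally have "V.tail j * \<Phi> \<rho> \<le> V.tail j * (\<Sum>l<N'. (y j l * b j l) powr s) powr (t / s)"
        unfolding \<Phi>_def using pos V.tail_pos[of j]
        by (intro mult_left_mono powr_mono2 circle_mean_nonneg) auto
      also have "\<dots> = (V.tail j powr (s / t) * (\<Sum>l<N'. (y j l * b j l) powr s)) powr (t / s)"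
        using V.tail_pos[of j] pos by (simp add: powr_mult powr_powr sum_nonneg)
      also have "V.tail j powr (s / t) * (\<Sum>l<N'. (y j l * b j l) powr s) = (\<Sum>l<N'. (a j l * (\<kappa> j * b j l)) powr s)"
        unfolding sum_distrib_left
      proof (intro sum.cong refl)
        fix l
        have e: "a j l * (\<kappa> j * b j l) = V.tail j powr (1 / t) * (y j l * b j l)" using \<kappa>[of j] by (simp add: a_def)
        show "V.tail j powr (s / t) * (y j l * b j l) powr s = (a j l * (\<kappa> j * b j l)) powr s"
          unfolding e using y(1)[OF j] b0 V.tail_pos[of j] by (simp add: powr_mult powr_powr)
      qed
      finally show ?thesis by (simp add: \<rho>_def N'_def)
    qed
    have asum: "(\<Sum>l<K ^ (j + 2). a j l powr p) powr (q / p) \<le> A0 powr (q / p) * (O.tail j * M (radius K j) powr (q / p))"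
      if j: "1 \<le> j" for j
    proof -
      have e: "V.tail j powr (1 / t) / \<kappa> j = real K powr (- (real j * (real n + 1 / p))) * O.tail j powr (1 / q)"
      proof -
        define x where "x = real j * (real n + 1 / p)"
        show ?thesis unfolding \<kappa>_def level_factor_def x_def[symmetric] V.tail_def[symmetric] O.tail_def[symmetric]
          using V.tail_pos[of j] by (simp add: powr_minus field_simps)
      qed
      have e': "(V.tail j powr (1 / t) / \<kappa> j) powr p = real K powr (- (real j * (real n * p + 1))) * O.tail j powr (p / q)"
      proof -
        have x: "- (real j * (real n + 1 / p)) * p = - (real j * (real n * p + 1))" using pos by (simp add: field_simps)
        have "(V.tail j powr (1 / t) / \<kappa> j) powr p
            = real K powr (- (real j * (real n + 1 / p)) * p) * O.tail j powr (1 / q * p)"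
          unfolding e by (simp only: powr_mult powr_powr powr_ge_zero)
        then show ?thesis unfolding x by simp
      qed
      have "(\<Sum>l<K ^ (j + 2). a j l powr p) = (V.tail j powr (1 / t) / \<kappa> j) powr p * (\<Sum>l<K ^ (j + 2). y j l powr p)"
        unfolding a_def sum_distrib_left using \<kappa>[of j] y(1)[OF j]
        by (intro sum.cong powr_mult) (auto simp: less_imp_le)
      also have "\<dots> \<le> (V.tail j powr (1 / t) / \<kappa> j) powr p * (A0 * real K powr (real j * (real n * p + 1)) * M (radius K j))"
        by (intro mult_left_mono y(3) j) auto
      also have "\<dots> = A0 * O.tail j powr (p / q) * M (radius K j)"
      proof -
        define x where "x = real j * (real n * p + 1)"
        show ?thesis unfolding e' x_def[symmetric] using K by (simp add: powr_minus field_simps)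
      qed
      finally have "(\<Sum>l<K ^ (j + 2). a j l powr p) powr (q / p) \<le> (A0 * O.tail j powr (p / q) * M (radius K j)) powr (q / p)"
        using pos by (intro powr_mono2 sum_nonneg) auto
      also have "\<dots> = A0 powr (q / p) * (O.tail j * M (radius K j) powr (q / p))"
        using A0 M0 O.tail_pos[of j] pos by (simp add: powr_mult powr_powr)
      finally show ?thesis .
    qed
    have partial: "(\<Sum>j=1..J. V.tail j * \<Phi> (radius K (j - 1))) \<le> N powr t * (A0 powr (q / p) / k) powr (t / q) * v powr (t / q)"
      if J: "1 \<le> J" for J
    proof -
      have "(\<Sum>j=1..J. V.tail j * \<Phi> (radius K (j - 1)))
         \<le> (\<Sum>j=1..J. (\<Sum>l<K ^ (j + 2). (a j l * (\<kappa> j * b j l)) powr s) powr (t / s))"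
        by (intro sum_mono level) auto
      also have "\<dots> \<le> dual_norm2 p q s t {1..J} (\<lambda>j. {..<K ^ (j + 2)}) (\<lambda>j l. \<kappa> j * b j l) powr t
          * (\<Sum>j=1..J. (\<Sum>l<K ^ (j + 2). a j l powr p) powr (q / p)) powr (t / q)"
        using J a0 b0 \<kappa> K pos by (intro dual_norm2_Hoelder) (auto simp: less_imp_le lessThan_empty_iff)
      also have "\<dots> \<le> N powr t * (\<Sum>j=1..J. A0 powr (q / p) * (O.tail j * M (radius K j) powr (q / p))) powr (t / q)"
      proof (intro mult_mono powr_mono2 sum_mono asum)
        show "dual_norm2 p q s t {1..J} (\<lambda>j. {..<K ^ (j + 2)}) (\<lambda>j l. \<kappa> j * b j l) \<le> N"
          using dn[OF J] by (simp add: \<kappa>_def b_def)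
        show "0 \<le> dual_norm2 p q s t {1..J} (\<lambda>j. {..<K ^ (j + 2)}) (\<lambda>j l. \<kappa> j * b j l)"
          unfolding dual_norm2_def using J b0 \<kappa> K
          by (intro dual_norm_nonneg) (auto simp: less_imp_le lessThan_empty_iff)
      qed (use pos in \<open>auto intro!: sum_nonneg\<close>)
      also have "\<dots> \<le> N powr t * (A0 powr (q / p) * (v / k)) powr (t / q)"
      proof (intro mult_left_mono powr_mono2)
        have "(\<Sum>j=1..J. O.tail j * M (radius K j) powr (q / p)) \<le> v / k" using vsum[of J] k by (simp add: field_simps)
        then show "(\<Sum>j=1..J. A0 powr (q / p) * (O.tail j * M (radius K j) powr (q / p))) \<le> A0 powr (q / p) * (v / k)"
          unfolding sum_distrib_left[symmetric] by (intro mult_left_mono) auto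
      qed (use pos O.tail_pos in \<open>auto intro!: sum_nonneg simp: less_imp_le\<close>)
      also have "(A0 powr (q / p) * (v / k)) powr (t / q) = (A0 powr (q / p) / k) powr (t / q) * v powr (t / q)"
        using v k by (simp add: powr_mult[symmetric])
      finally show ?thesis by (simp add: mult.assoc)
    qed
    have "(\<integral>\<^sup>+r\<in>{0..<1}. ennreal (\<Phi> r * \<nu> r) \<partial>lebesgue) \<le> (\<Sum>i. ennreal (\<Phi> (radius K (Suc i)) * V.tail i))"
    proof (rule V.weighted_integral_le)
      fix j r assume r: "radius K j \<le> r" "r < radius K (Suc j)"
      show "\<Phi> r \<le> \<Phi> (radius K (Suc j))" unfolding \<Phi>_def
        using r radius_bounds[OF K, of j] radius_bounds[OF K, of "Suc j"] pos FG
        by (intro powr_mono2 circle_mean_powr_norm_mono_disc circle_mean_nonneg) auto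
    qed (simp add: \<Phi>_def)
    \<comment> \<open>the annulus \<open>i\<close> is charged to the level \<open>j = i + 2\<close>, so that the means are taken at \<open>r\<^sub>j\<^sub>-\<^sub>1\<close>; this costs two doublings of the tail of \<open>\<nu>\<close>\<close>
    also have "\<dots> \<le> ennreal (D\<nu>\<^sup>2 * (N powr t * (A0 powr (q / p) / k) powr (t / q) * v powr (t / q)))"
    proof (subst suminf_eq_SUP, rule SUP_least)
      fix m
      have "(\<Sum>i<m. \<Phi> (radius K (Suc i)) * V.tail i) \<le> (\<Sum>i<m. D\<nu>\<^sup>2 * (V.tail (i + 2) * \<Phi> (radius K (i + 2 - 1))))"
      proof (rule sum_mono)
        fix i
        have "V.tail i * \<Phi> (radius K (Suc i)) \<le> (D\<nu>\<^sup>2 * V.tail (i + 2)) * \<Phi> (radius K (Suc i))"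
          by (intro mult_right_mono V.tail_doubling) (simp add: \<Phi>_def)
        then show "\<Phi> (radius K (Suc i)) * V.tail i \<le> D\<nu>\<^sup>2 * (V.tail (i + 2) * \<Phi> (radius K (i + 2 - 1)))"
          by (simp add: mult_ac)
      qed
      also have "\<dots> = D\<nu>\<^sup>2 * (\<Sum>i<m. V.tail (i + 2) * \<Phi> (radius K (i + 2 - 1)))" by (simp add: sum_distrib_left)
      also have "(\<Sum>i<m. V.tail (i + 2) * \<Phi> (radius K (i + 2 - 1))) = (\<Sum>j\<in>(\<lambda>i. i + 2) ` {..<m}. V.tail j * \<Phi> (radius K (j - 1)))"
        by (subst sum.reindex) (auto simp: inj_on_def)
      also have "\<dots> \<le> (\<Sum>j=1..m+1. V.tail j * \<Phi> (radius K (j - 1)))"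
        using V.tail_pos by (intro sum_mono2) (auto simp: \<Phi>_def less_imp_le)
      also have "\<dots> \<le> N powr t * (A0 powr (q / p) / k) powr (t / q) * v powr (t / q)"
        by (rule partial) simp
      finally have "(\<Sum>i<m. \<Phi> (radius K (Suc i)) * V.tail i) \<le> D\<nu>\<^sup>2 * (N powr t * (A0 powr (q / p) / k) powr (t / q) * v powr (t / q))"
        by (simp add: mult_left_mono)
      then show "(\<Sum>i<m. ennreal (\<Phi> (radius K (Suc i)) * V.tail i)) \<le> ennreal (D\<nu>\<^sup>2 * (N powr t * (A0 powr (q / p) / k) powr (t / q) * v powr (t / q)))"
        using V.tail_pos by (subst sum_ennreal) (auto simp: \<Phi>_def less_imp_le intro!: ennreal_leI)
    qed
    also have "D\<nu>\<^sup>2 * (N powr t * (A0 powr (q / p) / k) powr (t / q) * v powr (t / q)) = (c * N * v powr (1 / q)) powr t"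
      using c N v pos by (simp add: powr_mult powr_powr ct)
    also have "\<dots> \<le> (B * v powr (1 / q)) powr t"
      using c N B pos by (intro powr_mono2 mult_right_mono) auto
    finally have "epowr (\<integral>\<^sup>+r\<in>{0..<1}. ennreal (\<Phi> r * \<nu> r) \<partial>lebesgue) (1 / t) \<le> epowr (ennreal ((B * v powr (1 / q)) powr t)) (1 / t)"
      using pos by (intro epowr_mono) (auto intro: ennreal_leI)
    also have "\<dots> = ennreal (B * v powr (1 / q))"
      using pos B by (simp add: epowr_ennreal powr_powr)
    also have "\<dots> = ennreal B * mixed_norm p q \<omega> f"
      using B v unfolding mn v(2) by (simp add: epowr_ennreal ennreal_mult)
    finally show "epowr (\<integral>\<^sup>+r\<in>{0..<1}. ennreal
           ((integral {0..2 * pi} (\<lambda>\<theta>.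
               cmod ((deriv ^^ n) f (of_real r * cis \<theta>)) powr s
               * cmod (G (of_real r * cis \<theta>)) powr s / (2 * pi))) powr (t / s) * \<nu> r)
           \<partial>lebesgue) (1 / t) \<le> ennreal B * mixed_norm p q \<omega> f"
      unfolding product_mean[of "(deriv ^^ n) f" _ s G] \<Phi>_def F_def .
  qed
  then show ?thesis using c by (intro exI[of _ c]) blast
qed

section \<open>Kernel sums over the lattice\<close>

text \<open>
  A substitute for Minkowski's and Hoelder's inequalities that works for every \<open>p > 0\<close>: a sum of terms \<open>a i = u i * (a i / u
  i)\<close> with summable \<open>u\<close> is at most \<open>S\<close> times the largest \<open>a i / u i\<close>.
\<close>

lemma powr_sum_le_sum_powr:
  fixes a u :: "'i \<Rightarrow> real"
  assumes I: "finite I" and a: "\<And>i. i \<in> I \<Longrightarrow> 0 \<le> a i" and u: "\<And>i. i \<in> I \<Longrightarrow> 0 < u i"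
    and S: "sum u I \<le> S" and p: "0 < p"
  shows "(\<Sum>i\<in>I. a i) powr p \<le> S powr p * (\<Sum>i\<in>I. (a i / u i) powr p)"
proof -
  define m where "m = (\<Sum>i\<in>I. (a i / u i) powr p) powr (1 / p)"
  have S0: "0 \<le> S" using S sum_nonneg[of I u] u by (force intro: less_imp_le order_trans)
  have "a i \<le> m * u i" if i: "i \<in> I" for i
  proof -
    have "(a i / u i) powr p \<le> (\<Sum>i\<in>I. (a i / u i) powr p)"
      using I i by (intro member_le_sum) auto
    then have "((a i / u i) powr p) powr (1 / p) \<le> m" unfolding m_def using p by (intro powr_mono2) auto
    then have "a i / u i \<le> m" using p a[OF i] u[OF i] by (simp add: powr_powr)
    then show ?thesis using u[OF i] by (simp add: field_simps)
  qed
  then have "(\<Sum>i\<in>I. a i) \<le> m * sum u I" unfolding sum_distrib_left by (intro sum_mono) auto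
  also have "\<dots> \<le> m * S" using S by (intro mult_left_mono) (auto simp: m_def)
  finally have "(\<Sum>i\<in>I. a i) powr p \<le> (m * S) powr p" using p a by (intro powr_mono2 sum_nonneg) auto
  also have "\<dots> = S powr p * (\<Sum>i\<in>I. (a i / u i) powr p)"
    using p S0 by (simp add: powr_mult m_def powr_powr sum_nonneg)
  finally show ?thesis .
qed

abbreviation ndist :: "nat \<Rightarrow> nat \<Rightarrow> nat" where "ndist i k \<equiv> (i - k) + (k - i)"

lemma sum_power_ndist_le:
  fixes \<beta> :: real
  assumes \<beta>: "0 < \<beta>" "\<beta> < 1" and I: "finite I"
  shows "(\<Sum>i\<in>I. \<beta> ^ ndist i k) \<le> 2 / (1 - \<beta>)"
proof -
  have geo: "(\<Sum>m\<in>M. \<beta> ^ m) \<le> 1 / (1 - \<beta>)" if "finite M" for M :: "nat set"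
  proof -
    have "(\<Sum>m\<in>M. \<beta> ^ m) \<le> (\<Sum>m. \<beta> ^ m)"
      using \<beta> that by (intro sum_le_suminf summable_geometric) auto
    then show ?thesis using \<beta> by (simp add: suminf_geometric)
  qed
  have inj1: "inj_on (\<lambda>i. i - k) {i \<in> I. k \<le> i}" by (rule inj_onI) auto
  have inj2: "inj_on (\<lambda>i. k - i) {i \<in> I. i < k}" by (rule inj_onI) auto
  have "(\<Sum>i\<in>I. \<beta> ^ ndist i k) = (\<Sum>i\<in>{i \<in> I. k \<le> i} \<union> {i \<in> I. i < k}. \<beta> ^ ndist i k)"
    by (intro sum.cong) auto
  also have "\<dots> = (\<Sum>i\<in>{i \<in> I. k \<le> i}. \<beta> ^ ndist i k) + (\<Sum>i\<in>{i \<in> I. i < k}. \<beta> ^ ndist i k)"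
    using I by (intro sum.union_disjoint) auto
  also have "(\<Sum>i\<in>{i \<in> I. k \<le> i}. \<beta> ^ ndist i k) = (\<Sum>m\<in>(\<lambda>i. i - k) ` {i \<in> I. k \<le> i}. \<beta> ^ m)"
    by (subst sum.reindex[OF inj1]) (auto intro!: sum.cong)
  also have "(\<Sum>i\<in>{i \<in> I. i < k}. \<beta> ^ ndist i k) = (\<Sum>m\<in>(\<lambda>i. k - i) ` {i \<in> I. i < k}. \<beta> ^ m)"
    by (subst sum.reindex[OF inj2]) (auto intro!: sum.cong)
  finally show ?thesis
    using geo[of "(\<lambda>i. i - k) ` {i \<in> I. k \<le> i}"] geo[of "(\<lambda>i. k - i) ` {i \<in> I. i < k}"] I by simp
qed

definition lattice_point :: "nat \<Rightarrow> nat \<Rightarrow> nat \<Rightarrow> complex" where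
  "lattice_point K i m = of_real (radius K i) * cis (2 * pi * real m / real (K ^ (i + 2)))"

text \<open>
  The modulus of the kernel with pole reflected from a lattice point, scaled to be of order 1 near that lattice point. Its square is a multiple of a
  Poisson kernel, whose circle means and sums over one level of the lattice are explicit.
\<close>

definition bump :: "nat \<Rightarrow> nat \<Rightarrow> nat \<Rightarrow> complex \<Rightarrow> real" where
  "bump K i m z = 1 / real K ^ i / cmod (1 - cnj (lattice_point K i m) * z)"

lemma norm_lattice_point:
  assumes "2 \<le> K" shows "cmod (lattice_point K i m) = radius K i"
  using radius_bounds[OF assms, of i] by (simp add: lattice_point_def norm_mult)

lemma bump_bounds:
  assumes K: "2 \<le> K" and z: "cmod z \<le> r" "r < 1"
  shows "0 < 1 - radius K i * r" "1 - radius K i * r \<le> cmod (1 - cnj (lattice_point K i m) * z)"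
    "0 < bump K i m z" "bump K i m z \<le> 1 / real K ^ i / (1 - radius K i * r)"
proof -
  have r0: "0 \<le> r" using z norm_ge_zero order_trans by blast
  note rb = radius_bounds[OF K, of i]
  have "radius K i * r \<le> 1 * r" using rb r0 by (intro mult_right_mono) auto
  then show a: "0 < 1 - radius K i * r" using z by simp
  have "cmod (cnj (lattice_point K i m) * z) \<le> radius K i * r"
    using rb z by (simp add: norm_mult norm_lattice_point[OF K] mult_left_mono)
  then show b: "1 - radius K i * r \<le> cmod (1 - cnj (lattice_point K i m) * z)"
    using norm_triangle_ineq2[of 1 "cnj (lattice_point K i m) * z"] by simp
  show "0 < bump K i m z" unfolding bump_def using a b K by (intro divide_pos_pos) auto
  show "bump K i m z \<le> 1 / real K ^ i / (1 - radius K i * r)"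
    unfolding bump_def using a b K less_le_trans[OF a b] by (intro divide_left_mono mult_pos_pos) auto
qed

lemma bump_square:
  assumes K: "2 \<le> K" and z: "cmod z < 1"
  shows "(bump K i m z)\<^sup>2 = (1 / real K ^ i)\<^sup>2 / (1 - (radius K i * cmod z)\<^sup>2)
            * poisson_kernel (cnj (lattice_point K i m) * z)"
proof -
  have lt: "radius K i * cmod z < 1" using bump_bounds(1)[OF K order_refl z, of i] by simp
  have "0 \<le> radius K i * cmod z" using radius_bounds[OF K, of i] by simp
  then have "(radius K i * cmod z)\<^sup>2 < 1" using lt by (simp add: abs_square_less_1)
  then show ?thesis
    by (simp add: bump_def poisson_kernel_def norm_mult norm_lattice_point[OF K] power_divide power_mult_distrib)
qed

lemma bump_square_factor:
  assumes K: "2 \<le> K" and z: "cmod z < 1"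
  shows "(1 / real K ^ i)\<^sup>2 / (1 - (radius K i * cmod z)\<^sup>2) \<le> (1 / real K ^ i) * (1 / real K ^ i / (1 - radius K i * cmod z))"
proof -
  define x where "x = radius K i * cmod z"
  have x: "0 \<le> x" "x < 1"
    using bump_bounds(1)[OF K order_refl z, of i] radius_bounds[OF K, of i] by (simp_all add: x_def)
  have "x\<^sup>2 \<le> x" using x by (simp add: power2_eq_square mult_left_le)
  then have "(1 / real K ^ i)\<^sup>2 / (1 - x\<^sup>2) \<le> (1 / real K ^ i)\<^sup>2 / (1 - x)"
    using x by (intro divide_left_mono mult_pos_pos) auto
  then show ?thesis by (simp add: x_def power2_eq_square)
qed

lemma sum_bump_square_le:
  assumes K: "2 \<le> K" and z: "cmod z < 1"
  shows "(\<Sum>m<K ^ (i + 2). (bump K i m z)\<^sup>2) \<le> 4 * (real K)\<^sup>2"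
proof -
  define \<delta> where "\<delta> = 1 / real K ^ i"
  have \<delta>: "0 < \<delta>" using K by (simp add: \<delta>_def)
  define N where "N = K ^ (i + 2)"
  have N: "0 < N" using K by (simp add: N_def)
  define v where "v = of_real (radius K i) * cnj z"
  note rb = radius_bounds[OF K, of i]
  have vn: "cmod v = radius K i * cmod z" using rb by (simp add: v_def norm_mult)
  have vle: "cmod v \<le> radius K i" unfolding vn using rb z by (intro mult_left_le) auto
  have "poisson_kernel (cnj (lattice_point K i m) * z) = poisson_kernel (v * cis (2 * pi * real m / real N))" for m
  proof -
    have "cnj (cnj (lattice_point K i m) * z) = v * cis (2 * pi * real m / real N)"
      by (simp add: lattice_point_def v_def N_def mult_ac)
    then show ?thesis by (metis poisson_kernel_cnj)
  qed
  moreover have "(\<Sum>m<N. poisson_kernel (v * cis (2 * pi * real m / real N))) \<le> 4 * real N"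
  proof (rule sum_poisson_kernel_roots_le[OF _ N])
    show "cmod v < 1" using vle rb by simp
    have "cmod v ^ N \<le> radius K i ^ N" by (intro power_mono vle) auto
    also have "\<dots> \<le> 1 / 2" unfolding N_def by (rule radius_power_le_half[OF K])
    finally show "cmod v ^ N \<le> 1 / 2" .
  qed
  ultimately have ps: "(\<Sum>m<N. poisson_kernel (cnj (lattice_point K i m) * z)) \<le> 4 * real N" by simp
  have d: "\<delta> \<le> 1 - radius K i * cmod z"
  proof -
    have "radius K i * cmod z \<le> radius K i" using rb z by (intro mult_left_le) auto
    then show ?thesis by (simp add: \<delta>_def radius_def)
  qed
  have "(1 / real K ^ i)\<^sup>2 / (1 - (radius K i * cmod z)\<^sup>2) \<le> \<delta> * (\<delta> / (1 - radius K i * cmod z))"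
    unfolding \<delta>_def by (rule bump_square_factor[OF K z])
  also have "\<dots> \<le> \<delta> * 1" using d \<delta> by (intro mult_left_mono) auto
  finally have fac: "(1 / real K ^ i)\<^sup>2 / (1 - (radius K i * cmod z)\<^sup>2) \<le> \<delta>" by simp
  have p0: "0 \<le> (\<Sum>m<N. poisson_kernel (cnj (lattice_point K i m) * z))"
  proof (intro sum_nonneg poisson_kernel_nonneg)
    fix m show "cmod (cnj (lattice_point K i m) * z) \<le> 1"
      using vle vn rb by (simp add: norm_mult norm_lattice_point[OF K])
  qed
  have "(\<Sum>m<N. (bump K i m z)\<^sup>2) = (1 / real K ^ i)\<^sup>2 / (1 - (radius K i * cmod z)\<^sup>2)
     * (\<Sum>m<N. poisson_kernel (cnj (lattice_point K i m) * z))"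
    unfolding sum_distrib_left by (intro sum.cong refl bump_square[OF K z])
  also have "\<dots> \<le> \<delta> * (4 * real N)" using fac ps p0 \<delta> by (intro mult_mono) auto
  also have "\<dots> = 4 * (real K)\<^sup>2" using K by (simp add: \<delta>_def N_def power_add power2_eq_square)
  finally show ?thesis by (simp add: N_def)
qed

lemma continuous_on_bump:
  assumes K: "2 \<le> K" and r: "r < 1"
  shows "continuous_on (sphere 0 r) (bump K i m)"
proof -
  have "cmod (1 - cnj (lattice_point K i m) * z) \<noteq> 0" if "z \<in> sphere 0 r" for z
    using bump_bounds(1)[OF K, of z r i] bump_bounds(2)[OF K, of z r i m] that r by auto
  then show ?thesis unfolding bump_def by (intro continuous_intros) auto
qed

lemma continuous_on_bump_powr:
  assumes K: "2 \<le> K" and r: "r < 1"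
  shows "continuous_on (sphere 0 r) (\<lambda>z. bump K i m z powr a)"
proof (rule continuous_on_powr[OF continuous_on_bump[OF K r] continuous_on_const])
  show "\<forall>z\<in>sphere 0 r. bump K i m z \<noteq> 0"
  proof
    fix z :: complex assume "z \<in> sphere 0 r"
    then have "0 < bump K i m z" by (intro bump_bounds(3)[OF K _ r]) auto
    then show "bump K i m z \<noteq> 0" by simp
  qed
qed

lemma circle_mean_bump_le:
  assumes K: "2 \<le> K" and r: "0 \<le> r" "r < 1" and \<kappa>: "1 \<le> \<kappa>"
  shows "circle_mean (\<lambda>z. bump K i m z powr (\<kappa> + 1)) r
    \<le> 1 / real K ^ i * (1 / real K ^ i / (1 - radius K i * r)) powr \<kappa>"
proof -
  define h where "h = 1 / real K ^ i / (1 - radius K i * r)"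
  define A where "A = (1 / real K ^ i)\<^sup>2 / (1 - (radius K i * r)\<^sup>2)"
  have h0: "0 < h" unfolding h_def using bump_bounds(1)[OF K, of 0 r i] r K by (intro divide_pos_pos) auto
  have bc: "continuous_on (sphere 0 r) (bump K i m)" by (rule continuous_on_bump[OF K r(2)])
  have "circle_mean (\<lambda>z. bump K i m z powr (\<kappa> + 1)) r
      \<le> circle_mean (\<lambda>z. (h powr (\<kappa> - 1) * A) * poisson_kernel (cnj (lattice_point K i m) * z)) r"
  proof (rule circle_mean_mono)
    show "continuous_on (sphere 0 r) (\<lambda>z. bump K i m z powr (\<kappa> + 1))"
      by (rule continuous_on_bump_powr[OF K r(2)])
    show "continuous_on (sphere 0 r) (\<lambda>z. h powr (\<kappa> - 1) * A * poisson_kernel (cnj (lattice_point K i m) * z))"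
    proof (intro continuous_on_mult_left continuous_on_poisson_kernel continuous_intros)
      fix z :: complex assume "z \<in> sphere 0 r"
      then show "cmod (cnj (lattice_point K i m) * z) < 1"
        using bump_bounds(1)[OF K, of 0 r i] r by (simp add: norm_mult norm_lattice_point[OF K])
    qed
    fix z assume z: "cmod z = r"
    have b: "0 < bump K i m z" "bump K i m z \<le> h"
      using bump_bounds(3,4)[OF K, of z r i m] z r by (auto simp: h_def)
    have "bump K i m z powr (\<kappa> + 1) = bump K i m z powr (\<kappa> - 1) * (bump K i m z)\<^sup>2"
    proof -
      have "bump K i m z powr (\<kappa> + 1) = bump K i m z powr (\<kappa> - 1) * bump K i m z powr 2"
        by (subst powr_add[symmetric]) (simp add: add.commute)
      then show ?thesis using b by (simp add: powr_numeral)
    qed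
    also have "\<dots> \<le> h powr (\<kappa> - 1) * (bump K i m z)\<^sup>2"
      using b \<kappa> by (intro mult_right_mono powr_mono2) auto
    also have "\<dots> = (h powr (\<kappa> - 1) * A) * poisson_kernel (cnj (lattice_point K i m) * z)"
      using bump_square[OF K, of z i m] z r by (simp add: A_def)
    finally show "bump K i m z powr (\<kappa> + 1) \<le> (h powr (\<kappa> - 1) * A) * poisson_kernel (cnj (lattice_point K i m) * z)" .
  qed (use r in auto)
  also have "\<dots> = h powr (\<kappa> - 1) * A"
    using bump_bounds(1)[OF K, of 0 r i] r
    by (subst circle_mean_cmult, subst circle_mean_poisson_kernel) (auto simp: norm_lattice_point[OF K])
  also have "\<dots> \<le> h powr (\<kappa> - 1) * (1 / real K ^ i * h)"
    using bump_square_factor[OF K, of "of_real r" i] r by (intro mult_left_mono) (auto simp: A_def h_def)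
  also have "\<dots> = 1 / real K ^ i * (h powr (\<kappa> - 1) * h powr 1)" using h0 by simp
  also have "h powr (\<kappa> - 1) * h powr 1 = h powr \<kappa>" by (subst powr_add[symmetric]) simp
  finally show ?thesis by (simp add: h_def)
qed

text \<open>
  Near-orthogonality of the kernels on one level: two of the \<open>M\<close> factors of each kernel serve as the summable weights in
  \<open>powr_sum_le_sum_powr\<close>, the remaining ones are integrated.
\<close>

lemma level_sum_mean_le:
  assumes K: "2 \<le> K" and r: "0 \<le> r" "r < 1" and p: "0 < p" and M: "2 \<le> M" "2 \<le> (real M - 2) * p"
    and x: "\<And>m. 0 \<le> x m"
  shows "circle_mean (\<lambda>z. (\<Sum>m<K ^ (i + 2). x m * bump K i m z ^ M) powr p) r
    \<le> (4 * (real K)\<^sup>2) powr p * (1 / real K ^ i) * (1 / real K ^ i / (1 - radius K i * r)) powr ((real M - 2) * p - 1)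
        * (\<Sum>m<K ^ (i + 2). x m powr p)"
proof -
  define \<kappa> where "\<kappa> = (real M - 2) * p - 1"
  define S where "S = 4 * (real K)\<^sup>2"
  define N where "N = K ^ (i + 2)"
  have bc: "continuous_on (sphere 0 r) (bump K i m)" for m by (rule continuous_on_bump[OF K r(2)])
  have bpos: "0 < bump K i m z" if "cmod z = r" for z m using bump_bounds(3)[OF K, of z r i m] that r by auto
  have bpc: "continuous_on (sphere 0 r) (\<lambda>z. bump K i m z powr (\<kappa> + 1))" for m
    by (rule continuous_on_bump_powr[OF K r(2)])
  have "circle_mean (\<lambda>z. (\<Sum>m<N. x m * bump K i m z ^ M) powr p) r
      \<le> circle_mean (\<lambda>z. S powr p * (\<Sum>m<N. x m powr p * bump K i m z powr (\<kappa> + 1))) r"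
  proof (rule circle_mean_mono)
    show "continuous_on (sphere 0 r) (\<lambda>z. (\<Sum>m<N. x m * bump K i m z ^ M) powr p)"
    proof (intro continuous_on_powr' continuous_intros bc ballI conjI impI)
      fix z :: complex assume "z \<in> sphere 0 r"
      then show "0 \<le> (\<Sum>m<N. x m * bump K i m z ^ M)"
        using x bpos by (intro sum_nonneg mult_nonneg_nonneg zero_le_power) (auto simp: less_imp_le)
    qed (rule p)
    show "continuous_on (sphere 0 r) (\<lambda>z. S powr p * (\<Sum>m<N. x m powr p * bump K i m z powr (\<kappa> + 1)))"
      by (intro continuous_on_mult_left continuous_on_sum bpc)
    fix z assume z: "cmod z = r"
    have "(\<Sum>m<N. x m * bump K i m z ^ M) powr p
        \<le> S powr p * (\<Sum>m<N. (x m * bump K i m z ^ M / (bump K i m z)\<^sup>2) powr p)"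
    proof (rule powr_sum_le_sum_powr)
      show "(\<Sum>m<N. (bump K i m z)\<^sup>2) \<le> S" unfolding N_def S_def using z r by (intro sum_bump_square_le[OF K]) auto
      show "0 < (bump K i m z)\<^sup>2" for m using bpos[OF z, of m] by (intro zero_less_power)
      show "0 \<le> x m * bump K i m z ^ M" for m
        using x[of m] bpos[OF z, of m] by (intro mult_nonneg_nonneg zero_le_power) auto
    qed (use p in auto)
    also have "(\<Sum>m<N. (x m * bump K i m z ^ M / (bump K i m z)\<^sup>2) powr p) = (\<Sum>m<N. x m powr p * bump K i m z powr (\<kappa> + 1))"
    proof (intro sum.cong refl)
      fix m
      let ?b = "bump K i m z"
      have b: "0 < ?b" by (rule bpos[OF z])
      have "?b ^ M / ?b\<^sup>2 = ?b powr (real M - 2)"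
        using b by (simp add: powr_diff powr_realpow)
      then have "(x m * ?b ^ M / ?b\<^sup>2) powr p = (x m * ?b powr (real M - 2)) powr p"
        by (simp only: times_divide_eq_right[symmetric])
      also have "\<dots> = x m powr p * ?b powr ((real M - 2) * p)" using x b by (simp add: powr_mult powr_powr)
      finally show "(x m * ?b ^ M / ?b\<^sup>2) powr p = x m powr p * ?b powr (\<kappa> + 1)" by (simp add: \<kappa>_def)
    qed
    finally show "(\<Sum>m<N. x m * bump K i m z ^ M) powr p \<le> S powr p * (\<Sum>m<N. x m powr p * bump K i m z powr (\<kappa> + 1))" .
  qed (rule r(1))
  also have "\<dots> = S powr p * (\<Sum>m<N. x m powr p * circle_mean (\<lambda>z. bump K i m z powr (\<kappa> + 1)) r)"
    unfolding circle_mean_cmult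
    by (subst circle_mean_sum) (auto intro!: continuous_on_mult_left bpc r simp: circle_mean_cmult)
  also have "\<dots> \<le> S powr p * (\<Sum>m<N. x m powr p * (1 / real K ^ i * (1 / real K ^ i / (1 - radius K i * r)) powr \<kappa>))"
    using M by (intro mult_left_mono sum_mono circle_mean_bump_le K r) (auto simp: \<kappa>_def)
  also have "\<dots> = S powr p * (1 / real K ^ i) * (1 / real K ^ i / (1 - radius K i * r)) powr \<kappa> * (\<Sum>m<N. x m powr p)"
    unfolding sum_distrib_left by (intro sum.cong refl) (simp only: mult_ac)
  finally show ?thesis by (simp add: S_def N_def \<kappa>_def)
qed

section \<open>Norms of the test functions\<close>

text \<open>
  The contribution of the kernels of level \<open>i\<close> to the norm over the annulus \<open>k\<close>. For \<open>i \<le> k\<close> the decay of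
  the tails beats the loss \<open>sqrt C\<close> per level; for \<open>i > k\<close> the tails may grow like \<open>D\<close> per level, which is
  compensated by the decay of the kernels if \<open>\<mu>\<close> is large.
\<close>

lemma (in lacunary_weight) level_interaction_le:
  assumes L: "D * C \<le> real K powr \<mu>"
  shows "sqrt C ^ ndist i k * ((1 / real K) ^ (i - Suc k)) powr \<mu> * (tail k / tail i) \<le> D * C * (1 / sqrt C) ^ ndist i k"
proof -
  have sC: "0 < sqrt C" "sqrt C * sqrt C = C" using C by auto
  have DC: "0 < D * C" "1 \<le> D * C" using C D by (auto intro: mult_ge1_I)
  have split: "sqrt C ^ d / C ^ d = (1 / sqrt C) ^ d" for d
  proof -
    have "sqrt C ^ d / C ^ d = sqrt C ^ d / (sqrt C ^ d * sqrt C ^ d)" by (metis power_mult_distrib sC(2))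
    then show ?thesis using sC by (simp add: power_one_over)
  qed
  show ?thesis
  proof (cases "i \<le> k")
    case True
    then obtain d where d: "k = i + d" using le_Suc_ex by blast
    have "tail k / tail i \<le> 1 / C ^ d" using tail_decay[of d i] tail_pos[of i] C d by (simp add: field_simps)
    then have "sqrt C ^ d * (tail k / tail i) \<le> sqrt C ^ d * (1 / C ^ d)" using sC by (intro mult_left_mono) auto
    also have "\<dots> = 1 * (1 / sqrt C) ^ d" using split[of d] by simp
    also have "\<dots> \<le> D * C * (1 / sqrt C) ^ d" using DC sC by (intro mult_right_mono) auto
    finally show ?thesis using d K by simp
  next
    case False
    then obtain d where d: "i = k + Suc d" by (metis add_Suc_right less_imp_Suc_add not_le)
    have t: "tail k / tail i \<le> D ^ Suc d" using tail_doubling[of k "Suc d"] tail_pos[of i] d by (simp add: field_simps)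
    have "((1 / real K) ^ d) powr \<mu> = 1 / (real K powr \<mu>) ^ d"
      using K by (simp add: powr_divide power_one_over powr_powr mult.commute flip: powr_realpow)
    also have "\<dots> \<le> 1 / (D * C) ^ d"
    proof (rule divide_left_mono)
      show "(D * C) ^ d \<le> (real K powr \<mu>) ^ d" using L DC by (intro power_mono) auto
      have "0 < real K powr \<mu>" using K by simp
      then show "0 < (real K powr \<mu>) ^ d * (D * C) ^ d" by (rule mult_pos_pos[OF zero_less_power zero_less_power[OF DC(1)]])
    qed simp
    finally have h: "((1 / real K) ^ d) powr \<mu> \<le> 1 / (D * C) ^ d" .
    have "sqrt C ^ Suc d * ((1 / real K) ^ d) powr \<mu> * (tail k / tail i) \<le> sqrt C ^ Suc d * (1 / (D * C) ^ d) * D ^ Suc d"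
      using t h sC D C tail_pos[of k] tail_pos[of i] by (intro mult_mono) (auto simp: less_imp_le)
    also have "\<dots> = D * C * (sqrt C ^ Suc d / C ^ Suc d)"
      using D C by (simp add: power_mult_distrib field_simps)
    also have "\<dots> = D * C * (1 / sqrt C) ^ Suc d" by (simp only: split)
    finally show ?thesis using d by simp
  qed
qed

text \<open>
  Levels are separated by \<open>powr_sum_le_sum_powr\<close>, for the power \<open>p\<close> with the weights
  \<open>\<beta>\<^sup>|\<^sup>i\<^sup>-\<^sup>k\<^sup>|\<close> and for the power \<open>q / p\<close> with
  \<open>\<beta>\<^sup>p\<^sup>|\<^sup>i\<^sup>-\<^sup>k\<^sup>|\<close>. Then \<open>level_interaction_le\<close> makes the double sum over levels
  geometric in \<open>|i - k|\<close>.
\<close>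

lemma (in lacunary_weight) test_function_norm_le:
  assumes pos: "0 < p" "0 < q"
  shows "\<exists>M E. 2 \<le> M \<and> 0 < E \<and> (\<forall>f x J. f holomorphic_on ball 0 1 \<longrightarrow> (\<forall>i m. 0 \<le> x i m) \<longrightarrow>
     (\<forall>z\<in>ball 0 1. cmod (f z) \<le> (\<Sum>i=1..J. \<Sum>m<K ^ (i + 2).
          real K powr (real i / p) * tail i powr (- (1 / q)) * x i m * bump K i m z ^ M)) \<longrightarrow>
     (\<Sum>i=1..J. (\<Sum>m<K ^ (i + 2). x i m powr p) powr (q / p)) \<le> 1 \<longrightarrow> mixed_norm p q w f \<le> ennreal E)"
proof -
  have K1: "1 < real K" using K by simp
  have DC: "0 < D * C" using C D by auto
  obtain M0 :: nat where M0: "2 / p + (log (real K) (D * C) * (p / q) + 1) / p < real M0"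
    using reals_Archimedean2 by blast
  \<comment> \<open>\<open>M0\<close> makes the kernels decay faster than the tails can grow; the last summand gives \<open>(M - 2) p \<ge> 2\<close>, so that a square can be split off\<close>
  define M where "M = M0 + 2 + nat \<lceil>2 / p\<rceil>"
  have M2: "2 \<le> M" by (simp add: M_def)
  have Mp: "2 \<le> (real M - 2) * p"
  proof -
    have "2 / p \<le> real (nat \<lceil>2 / p\<rceil>)" by linarith
    then have "2 / p \<le> real M - 2" by (simp add: M_def)
    then show ?thesis using pos by (simp add: field_simps)
  qed
  define \<kappa> where "\<kappa> = (real M - 2) * p - 1"
  have \<kappa>1: "1 \<le> \<kappa>" using Mp by (simp add: \<kappa>_def)
  define \<mu> where "\<mu> = \<kappa> * (q / p)"
  have \<mu>L: "D * C \<le> real K powr \<mu>"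
  proof -
    have "(log (real K) (D * C) * (p / q) + 1) / p \<le> real M - 2"
    proof -
      have "0 < 2 / p" using pos by simp
      then show ?thesis using M0 unfolding M_def by linarith
    qed
    then have "log (real K) (D * C) * (p / q) \<le> \<kappa>" using pos by (simp add: \<kappa>_def field_simps)
    then have "log (real K) (D * C) * (p / q) * (q / p) \<le> \<mu>" unfolding \<mu>_def using pos by (intro mult_right_mono) auto
    then have "log (real K) (D * C) \<le> \<mu>" using pos by simp
    then have "real K powr (log (real K) (D * C)) \<le> real K powr \<mu>" using K1 by simp
    then show ?thesis using K1 DC by simp
  qed
  \<comment> \<open>this base loses \<open>\<beta>\<^sup>-\<^sup>2\<^sup>q = sqrt C\<close> per level in the two separations together, the square root of the decay of the tails\<close>
  define \<beta> where "\<beta> = C powr (- (1 / (4 * q)))"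
  have \<beta>: "0 < \<beta>" "\<beta> < 1" using C pos by (auto simp: \<beta>_def powr_less_one)
  define \<beta>' where "\<beta>' = \<beta> powr p"
  have \<beta>': "0 < \<beta>'" "\<beta>' < 1" using C pos by (auto simp: \<beta>'_def \<beta>_def powr_powr intro!: powr_less_one)
  define S0 where "S0 = 4 * (real K)\<^sup>2"
  define S1 where "S1 = 2 / (1 - \<beta>)"
  define S2 where "S2 = 2 / (1 - \<beta>')"
  define A where "A = S1 powr p * S0 powr p"
  have S: "0 < S0" "0 < S1" "0 < S2" "0 < A"
    using K \<beta> \<beta>' by (auto simp: S0_def S1_def S2_def A_def)
  define E where "E = S2 powr (q / p) * A powr (q / p) * (D * C * (2 / (1 - 1 / sqrt C)))"
  have sC: "1 < sqrt C" using C by simp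
  have E: "0 < E" using S DC sC by (simp add: E_def)
  have bound: "mixed_norm p q w f \<le> ennreal (E powr (1 / q))"
    if f: "f holomorphic_on ball 0 1" and x: "\<And>i m. 0 \<le> x i m"
      and fb: "\<And>z. z \<in> ball 0 1 \<Longrightarrow> cmod (f z) \<le> (\<Sum>i=1..J. \<Sum>m<K ^ (i + 2).
          real K powr (real i / p) * tail i powr (- (1 / q)) * x i m * bump K i m z ^ M)"
      and xs: "(\<Sum>i=1..J. (\<Sum>m<K ^ (i + 2). x i m powr p) powr (q / p)) \<le> 1"
    for f x J
  proof -
    define Y where "Y i = (\<Sum>m<K ^ (i + 2). x i m powr p)" for i
    have Y0: "0 \<le> Y i" for i by (simp add: Y_def sum_nonneg)
    define y where "y i m = real K powr (real i / p) * tail i powr (- (1 / q)) * x i m" for i m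
    have y0: "0 \<le> y i m" for i m using x by (simp add: y_def)
    define F where "F i z = (\<Sum>m<K ^ (i + 2). y i m * bump K i m z ^ M)" for i z
    have F0: "0 \<le> F i z" if "cmod z < 1" for i z
      unfolding F_def using y0 bump_bounds(3)[OF K order_refl that] by (intro sum_nonneg mult_nonneg_nonneg zero_le_power) (auto simp: less_imp_le)
    define h where "h i k = (1 / real K) ^ (i - Suc k)" for i k
    have h0: "0 < h i k" for i k using K by (simp add: h_def)
    define g where "g i k = A / (\<beta> ^ ndist i k) powr p * tail i powr (- (p / q)) * h i k powr \<kappa> * Y i" for i k
    have g0: "0 \<le> g i k" for i k using S Y0 by (simp add: g_def)
    have mean: "power_mean p f r \<le> (\<Sum>i=1..J. g i k)"
      if r: "radius K k \<le> r" "r < radius K (Suc k)" for r k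
    proof -
      have r01: "0 \<le> r" "r < 1" using r radius_bounds[OF K, of k] radius_bounds[OF K, of "Suc k"] by auto
      have Fc: "continuous_on (sphere 0 r) (\<lambda>z. F i z powr p)" for i
      proof (intro continuous_on_powr' continuous_on_const ballI conjI impI)
        show "continuous_on (sphere 0 r) (F i)"
          unfolding F_def by (intro continuous_intros continuous_on_bump[OF K r01(2)])
        show "0 \<le> F i z" if "z \<in> sphere 0 r" for z using F0[of z i] that r01 by simp
      qed (rule pos(1))
      have fc: "continuous_on (sphere 0 r) (\<lambda>z. cmod (f z) powr p)"
      proof (rule powr_norm_continuous_on[OF _ pos(1)])
        have "f holomorphic_on sphere 0 r" by (rule holomorphic_on_subset[OF f]) (use r01 in auto)
        then show "continuous_on (sphere 0 r) f" by (rule holomorphic_on_imp_continuous_on)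
      qed
      have "power_mean p f r
          \<le> circle_mean (\<lambda>z. \<Sum>i=1..J. (S1 powr p / (\<beta> ^ ndist i k) powr p) * F i z powr p) r"
      proof (rule circle_mean_mono[OF fc])
        show "continuous_on (sphere 0 r) (\<lambda>z. \<Sum>i=1..J. (S1 powr p / (\<beta> ^ ndist i k) powr p) * F i z powr p)"
          by (intro continuous_on_sum continuous_on_mult_left Fc)
        fix z :: complex assume z: "cmod z = r"
        have z1: "cmod z < 1" using z r01 by simp
        have "cmod (f z) powr p \<le> (\<Sum>i=1..J. F i z) powr p"
          using fb[of z] z1 pos unfolding F_def y_def by (intro powr_mono2) auto
        also have "\<dots> \<le> S1 powr p * (\<Sum>i=1..J. (F i z / \<beta> ^ ndist i k) powr p)"
          using F0[OF z1] \<beta> pos unfolding S1_def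
          by (intro powr_sum_le_sum_powr sum_power_ndist_le) auto
        also have "\<dots> = (\<Sum>i=1..J. (S1 powr p / (\<beta> ^ ndist i k) powr p) * F i z powr p)"
          using F0[OF z1] \<beta> by (simp add: sum_distrib_left powr_divide)
        finally show "cmod (f z) powr p \<le> (\<Sum>i=1..J. (S1 powr p / (\<beta> ^ ndist i k) powr p) * F i z powr p)" .
      qed (rule r01(1))
      also have "\<dots> = (\<Sum>i=1..J. (S1 powr p / (\<beta> ^ ndist i k) powr p) * circle_mean (\<lambda>z. F i z powr p) r)"
        unfolding circle_mean_cmult[symmetric]
        by (rule circle_mean_sum) (intro continuous_on_mult_left Fc r01 finite_atLeastAtMost)+
      also have "\<dots> \<le> (\<Sum>i=1..J. g i k)"
      proof (rule sum_mono)
        fix i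
        note rb = radius_bounds[OF K, of i]
        define d where "d = 1 - radius K i * r"
        have d0: "0 < d" unfolding d_def using bump_bounds(1)[OF K, of 0 r i] r01 by simp
        have d1: "1 / real K ^ i \<le> d"
        proof -
          have "radius K i * r \<le> radius K i" using rb r01 by (intro mult_left_le) auto
          then show ?thesis by (simp add: d_def radius_def)
        qed
        have d2: "1 / real K ^ Suc k \<le> d"
        proof -
          have "radius K i * r \<le> 1 * r" using rb r01 by (intro mult_right_mono) auto
          then show ?thesis using r(2) by (simp add: d_def radius_def)
        qed
        have dh: "1 / real K ^ i / d \<le> h i k"
        proof (cases "Suc k \<le> i")
          case True
          then obtain e where e: "i = Suc k + e" using le_Suc_ex by blast
          have "1 / real K ^ i / d \<le> 1 / real K ^ i / (1 / real K ^ Suc k)"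
            using d2 d0 K by (intro divide_left_mono mult_pos_pos) auto
          also have "\<dots> = h i k" using K by (simp add: h_def e power_add power_one_over)
          finally show ?thesis .
        next
          case False
          then have "h i k = 1" by (simp add: h_def)
          then show ?thesis using divide_le_eq_1_pos[OF d0, of "1 / real K ^ i"] d1 by (simp only:)
        qed
        have "circle_mean (\<lambda>z. F i z powr p) r
            \<le> S0 powr p * (1 / real K ^ i) * (1 / real K ^ i / d) powr \<kappa> * (\<Sum>m<K ^ (i + 2). y i m powr p)"
          unfolding F_def S0_def d_def \<kappa>_def by (rule level_sum_mean_le[OF K r01 pos(1) M2 Mp y0])
        also have "\<dots> \<le> S0 powr p * (1 / real K ^ i) * h i k powr \<kappa> * (\<Sum>m<K ^ (i + 2). y i m powr p)"
          using dh \<kappa>1 d0 K by (intro mult_right_mono mult_left_mono powr_mono2 sum_nonneg) auto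
        also have "(\<Sum>m<K ^ (i + 2). y i m powr p) = real K ^ i * tail i powr (- (p / q)) * Y i"
        proof -
          have "y i m powr p = real K ^ i * tail i powr (- (p / q)) * x i m powr p" for m
            using pos K x by (simp add: y_def powr_mult powr_powr powr_realpow)
          then show ?thesis by (simp add: Y_def sum_distrib_left)
        qed
        also have "S0 powr p * (1 / real K ^ i) * h i k powr \<kappa> * (real K ^ i * tail i powr (- (p / q)) * Y i)
           = S0 powr p * h i k powr \<kappa> * (tail i powr (- (p / q)) * Y i)" using K by simp
        finally have "(S1 powr p / (\<beta> ^ ndist i k) powr p) * circle_mean (\<lambda>z. F i z powr p) r
           \<le> (S1 powr p / (\<beta> ^ ndist i k) powr p) * (S0 powr p * h i k powr \<kappa> * (tail i powr (- (p / q)) * Y i))"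
          by (intro mult_left_mono) auto
        also have "\<dots> = g i k" by (simp add: g_def A_def mult_ac)
        finally show "(S1 powr p / (\<beta> ^ ndist i k) powr p) * circle_mean (\<lambda>z. F i z powr p) r \<le> g i k" .
      qed
      finally show ?thesis .
    qed
    define c where "c k = S2 powr (q / p) * (\<Sum>i=1..J. (g i k / \<beta>' ^ ndist i k) powr (q / p))" for k
    have geq: "(g i k / \<beta>' ^ ndist i k) powr (q / p) = A powr (q / p) * Y i powr (q / p) * (sqrt C ^ ndist i k * h i k powr \<mu> / tail i)" for i k
    proof -
      define e where "e = ndist i k"
      have "\<beta>' ^ e = (\<beta> ^ e) powr p"
        using \<beta> by (simp add: \<beta>'_def powr_powr mult.commute flip: powr_realpow)
      then have "g i k / \<beta>' ^ e = A * Y i * tail i powr (- (p / q)) * h i k powr \<kappa> * ((\<beta> ^ e) powr (- p) * (\<beta> ^ e) powr (- p))"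
        by (simp add: g_def e_def powr_minus field_simps)
      also have "(\<beta> ^ e) powr (- p) * (\<beta> ^ e) powr (- p) = (\<beta> ^ e) powr (- 2 * p)" by (simp flip: powr_add)
      finally have "(g i k / \<beta>' ^ e) powr (q / p)
          = A powr (q / p) * Y i powr (q / p) * (tail i powr (- (p / q))) powr (q / p) * (h i k powr \<kappa>) powr (q / p)
            * ((\<beta> ^ e) powr (- 2 * p)) powr (q / p)"
        using S Y0 by (simp add: powr_mult)
      also have "(tail i powr (- (p / q))) powr (q / p) = 1 / tail i"
      proof -
        have "- (p / q) * (q / p) = - 1" using pos by simp
        then have "(tail i powr (- (p / q))) powr (q / p) = tail i powr (- 1)" unfolding powr_powr by (simp only:)
        then show ?thesis using tail_pos[of i] by (simp add: powr_minus_divide)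
      qed
      also have "(h i k powr \<kappa>) powr (q / p) = h i k powr \<mu>" by (simp add: powr_powr \<mu>_def)
      also have "((\<beta> ^ e) powr (- 2 * p)) powr (q / p) = sqrt C ^ e"
      proof -
        have "((\<beta> ^ e) powr (- 2 * p)) powr (q / p) = (\<beta> ^ e) powr (- 2 * q)" using pos by (simp add: powr_powr)
        also have "\<dots> = (\<beta> powr (- 2 * q)) ^ e"
          using \<beta> by (simp add: powr_powr mult.commute flip: powr_realpow)
        also have "\<beta> powr (- 2 * q) = C powr (1 / 2)" using pos by (simp add: \<beta>_def powr_powr)
        also have "\<dots> = sqrt C" using C by (simp add: powr_half_sqrt)
        finally show ?thesis .
      qed
      finally show ?thesis by (simp add: e_def)
    qed
    have "(\<integral>\<^sup>+r\<in>{0..<1}. ennreal (power_mean p f r powr (q / p) * w r) \<partial>lebesgue)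
        \<le> (\<Sum>k. ennreal (c k * tail k))"
    proof (rule weighted_integral_le)
      fix k r assume r: "radius K k \<le> r" "r < radius K (Suc k)"
      have "power_mean p f r powr (q / p) \<le> (\<Sum>i=1..J. g i k) powr (q / p)"
        using mean[OF r] pos by (intro powr_mono2 circle_mean_nonneg) auto
      also have "\<dots> \<le> c k"
        unfolding c_def S2_def using g0 \<beta>' pos by (intro powr_sum_le_sum_powr sum_power_ndist_le) auto
      finally show "power_mean p f r powr (q / p) \<le> c k" .
    qed (simp add: c_def sum_nonneg)
    also have "\<dots> \<le> ennreal E"
    proof (subst suminf_eq_SUP, rule SUP_least)
      fix m
      define Q where "Q = D * C * (2 / (1 - 1 / sqrt C))"
      have Q: "0 \<le> Q" unfolding Q_def using D C sC by (intro mult_nonneg_nonneg) auto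
      define X where "X i k = sqrt C ^ ndist i k * h i k powr \<mu> * (tail k / tail i)" for i k
      have XQ: "(\<Sum>k<m. X i k) \<le> Q" for i
      proof -
        have "(\<Sum>k<m. X i k) \<le> (\<Sum>k<m. D * C * (1 / sqrt C) ^ ndist i k)"
          unfolding X_def h_def by (intro sum_mono level_interaction_le \<mu>L)
        also have "\<dots> = D * C * (\<Sum>k<m. (1 / sqrt C) ^ ndist k i)" by (simp add: sum_distrib_left add.commute)
        also have "\<dots> \<le> Q"
          unfolding Q_def using DC sC by (intro mult_left_mono sum_power_ndist_le) auto
        finally show ?thesis .
      qed
      have cT: "c k * tail k = S2 powr (q / p) * A powr (q / p) * (\<Sum>i=1..J. Y i powr (q / p) * X i k)" for k
        unfolding c_def geq X_def by (simp add: sum_distrib_left sum_distrib_right mult_ac)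
      have "(\<Sum>k<m. \<Sum>i=1..J. Y i powr (q / p) * X i k) = (\<Sum>i=1..J. Y i powr (q / p) * (\<Sum>k<m. X i k))"
        unfolding sum_distrib_left by (rule sum.swap)
      also have "\<dots> \<le> (\<Sum>i=1..J. Y i powr (q / p) * Q)"
        by (intro sum_mono mult_left_mono XQ) auto
      also have "\<dots> = (\<Sum>i=1..J. Y i powr (q / p)) * Q" by (rule sum_distrib_right[symmetric])
      also have "\<dots> \<le> 1 * Q" using xs Q unfolding Y_def by (intro mult_right_mono) auto
      finally have XY: "(\<Sum>k<m. \<Sum>i=1..J. Y i powr (q / p) * X i k) \<le> Q" by simp
      have "(\<Sum>k<m. c k * tail k) = S2 powr (q / p) * A powr (q / p) * (\<Sum>k<m. \<Sum>i=1..J. Y i powr (q / p) * X i k)"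
        unfolding cT by (rule sum_distrib_left[symmetric])
      also have "\<dots> \<le> S2 powr (q / p) * A powr (q / p) * Q" by (intro mult_left_mono XY) auto
      finally have "(\<Sum>k<m. c k * tail k) \<le> E" by (simp add: E_def Q_def)
      then show "(\<Sum>k<m. ennreal (c k * tail k)) \<le> ennreal E"
        using tail_pos by (subst sum_ennreal) (auto simp: c_def less_imp_le sum_nonneg intro!: ennreal_leI)
    qed
    finally have "mixed_norm p q w f \<le> epowr (ennreal E) (1 / q)"
      unfolding mixed_norm_def integral_mean_powr using pos by (intro epowr_mono) auto
    then show ?thesis using E by (simp add: epowr_ennreal)
  qed
  show ?thesis
  proof (intro exI conjI allI impI)
    show "2 \<le> M" by (rule M2)
    show "0 < E powr (1 / q)" using E by simp
    fix f :: "complex \<Rightarrow> complex" and x :: "nat \<Rightarrow> nat \<Rightarrow> real" and J :: nat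
    assume a: "f holomorphic_on ball 0 1" "\<forall>i m. 0 \<le> x i m"
      "\<forall>z\<in>ball 0 1. cmod (f z) \<le> (\<Sum>i=1..J. \<Sum>m<K ^ (i + 2).
          real K powr (real i / p) * tail i powr (- (1 / q)) * x i m * bump K i m z ^ M)"
      "(\<Sum>i=1..J. (\<Sum>m<K ^ (i + 2). x i m powr p) powr (q / p)) \<le> 1"
    show "mixed_norm p q w f \<le> ennreal (E powr (1 / q))"
      by (rule bound[OF a(1) spec[OF spec[OF a(2)]] bspec[OF a(3)] a(4)])
  qed
qed

section \<open>Random signs, and the sequence condition from the embedding\<close>

text \<open>
  Powers of the kernel are stable under differentiation, so the test functions have explicit derivatives.
\<close>

lemma higher_deriv_kernel_sum:
  fixes b c :: "'i \<Rightarrow> complex"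
  assumes b: "\<And>i. i \<in> I \<Longrightarrow> cmod (b i) < 1" and z: "z \<in> ball 0 1"
  shows "(deriv ^^ n) (\<lambda>z. \<Sum>i\<in>I. c i * inverse (1 - b i * z) ^ M) z
    = (\<Sum>i\<in>I. c i * (pochhammer (of_nat M) n * b i ^ n * inverse (1 - b i * z) ^ (M + n)))"
  using z
proof (induction n arbitrary: z)
  case (Suc n)
  have ne: "1 - b i * w \<noteq> 0" if "i \<in> I" "w \<in> ball 0 1" for i w
  proof -
    have "cmod (b i * w) \<le> 1 * cmod w" unfolding norm_mult using b[OF that(1)] by (intro mult_right_mono) auto
    then have "cmod (b i * w) < 1" using that(2) by simp
    then show ?thesis by (rule one_minus_neq_0)
  qed
  let ?g = "\<lambda>w. \<Sum>i\<in>I. c i * (pochhammer (of_nat M) n * b i ^ n * inverse (1 - b i * w) ^ (M + n))"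
  have u: "((\<lambda>w. inverse (1 - b i * w)) has_field_derivative b i * inverse (1 - b i * z) ^ 2) (at z)" if "i \<in> I" for i
    using ne[OF that Suc.prems] by (auto intro!: derivative_eq_intros simp: power2_eq_square)
  have up: "((\<lambda>w. inverse (1 - b i * w) ^ k) has_field_derivative of_nat k * b i * inverse (1 - b i * z) ^ (Suc k)) (at z)"
    if "i \<in> I" for i k
  proof (cases k)
    case (Suc m)
    show ?thesis unfolding Suc
      by (rule DERIV_cong[OF DERIV_power[OF u[OF that]]]) (simp add: power2_eq_square)
  qed simp
  have "(?g has_field_derivative (\<Sum>i\<in>I. c i * (pochhammer (of_nat M) n * b i ^ n *
      (of_nat (M + n) * b i * inverse (1 - b i * z) ^ (Suc (M + n)))))) (at z)"
    by (intro DERIV_sum DERIV_cmult up)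
  then have "deriv ?g z = (\<Sum>i\<in>I. c i * (pochhammer (of_nat M) n * b i ^ n *
      (of_nat (M + n) * b i * inverse (1 - b i * z) ^ (Suc (M + n)))))"
    by (rule DERIV_imp_deriv)
  also have "\<dots> = (\<Sum>i\<in>I. c i * (pochhammer (of_nat M) (Suc n) * b i ^ Suc n * inverse (1 - b i * z) ^ (M + Suc n)))"
    by (intro sum.cong refl) (simp add: pochhammer_Suc mult_ac)
  finally have d: "deriv ?g z = \<dots>" .
  have "\<forall>\<^sub>F w in nhds z. (deriv ^^ n) (\<lambda>z. \<Sum>i\<in>I. c i * inverse (1 - b i * z) ^ M) w = ?g w"
    using eventually_nhds_in_open[OF open_ball Suc.prems] by (rule eventually_mono) (rule Suc.IH)
  then have "deriv ((deriv ^^ n) (\<lambda>z. \<Sum>i\<in>I. c i * inverse (1 - b i * z) ^ M)) z = deriv ?g z"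
    by (rule deriv_cong_ev) simp
  then show ?case by (simp only: funpow.simps o_apply d)
qed simp

text \<open>
  Signs are encoded by the set of indices that carry a plus, so that all choices of signs range over \<open>Pow I\<close>.
\<close>

definition sign_sum :: "'i set \<Rightarrow> ('i \<Rightarrow> complex) \<Rightarrow> 'i set \<Rightarrow> complex" where
  "sign_sum I v A = (\<Sum>i\<in>I. (if i \<in> A then 1 else - 1) * v i)"

text \<open>
  Flipping the sign of the summand \<open>v e\<close> pairs off the choices of signs. The two sums of a pair differ by \<open>2 * v e\<close>, so one
  of them has modulus at least \<open>c\<close>. Truncation at \<open>c\<close> provides the upper bound that \<open>sum_powr_ge_of_large_mean\<close>
  needs.
\<close>

lemma average_sign_sum_ge:
  assumes I: "finite I" and e: "e \<in> I" and c: "0 \<le> c" "c \<le> cmod (v e)" and s: "0 < s"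
  shows "real (card (Pow I)) / 2 * c powr s \<le> (\<Sum>A\<in>Pow I. min (cmod (sign_sum I v A)) c powr s)"
proof -
  define \<tau> where "\<tau> A = (if e \<in> A then A - {e} else insert e A)" for A
  define \<phi> where "\<phi> A = min (cmod (sign_sum I v A)) c powr s" for A
  have bij: "bij_betw \<tau> (Pow I) (Pow I)"
    by (rule bij_betw_byWitness[where f' = \<tau>]) (use e in \<open>auto simp: \<tau>_def\<close>)
  have pair: "c powr s \<le> \<phi> A + \<phi> (\<tau> A)" for A
  proof -
    have rest: "(\<Sum>i\<in>I - {e}. (if i \<in> \<tau> A then 1 else - 1) * v i) = (\<Sum>i\<in>I - {e}. (if i \<in> A then 1 else - 1) * v i)"
      by (intro sum.cong) (auto simp: \<tau>_def)
    have dec: "sign_sum I v B = (if e \<in> B then 1 else - 1) * v e + (\<Sum>i\<in>I - {e}. (if i \<in> B then 1 else - 1) * v i)" for B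
      unfolding sign_sum_def using I e by (simp add: sum.remove)
    have "sign_sum I v A - sign_sum I v (\<tau> A) = 2 * v e \<or> sign_sum I v A - sign_sum I v (\<tau> A) = - (2 * v e)"
      unfolding dec[of A] dec[of "\<tau> A"] rest by (auto simp: \<tau>_def)
    then have "2 * cmod (v e) = cmod (sign_sum I v A - sign_sum I v (\<tau> A))"
      by (metis norm_minus_cancel norm_mult norm_numeral)
    also have "\<dots> \<le> cmod (sign_sum I v A) + cmod (sign_sum I v (\<tau> A))" by (rule norm_triangle_ineq4)
    finally have "c \<le> cmod (sign_sum I v A) \<or> c \<le> cmod (sign_sum I v (\<tau> A))" using c by linarith
    then have "\<phi> A = c powr s \<or> \<phi> (\<tau> A) = c powr s" by (auto simp: \<phi>_def min_def)
    moreover have "0 \<le> \<phi> A" "0 \<le> \<phi> (\<tau> A)" by (simp_all add: \<phi>_def)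
    ultimately show ?thesis by auto
  qed
  have "real (card (Pow I)) * c powr s \<le> (\<Sum>A\<in>Pow I. \<phi> A + \<phi> (\<tau> A))"
    using sum_mono[of "Pow I" "\<lambda>_. c powr s" "\<lambda>A. \<phi> A + \<phi> (\<tau> A)"] pair by simp
  also have "\<dots> = (\<Sum>A\<in>Pow I. \<phi> A) + (\<Sum>A\<in>Pow I. \<phi> (\<tau> A))" by (rule sum.distrib)
  also have "(\<Sum>A\<in>Pow I. \<phi> (\<tau> A)) = (\<Sum>A\<in>Pow I. \<phi> A)" by (rule sum.reindex_bij_betw[OF bij])
  finally show ?thesis by (simp add: \<phi>_def)
qed

text \<open>
  A function bounded by \<open>W\<close> with mean at least \<open>W / 2\<close> is at least \<open>W / 4\<close> on a quarter of the space.
\<close>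

lemma sum_powr_ge_of_large_mean:
  fixes Y :: "'i \<Rightarrow> real"
  assumes \<Omega>: "finite \<Omega>" and Y: "\<And>A. A \<in> \<Omega> \<Longrightarrow> 0 \<le> Y A" "\<And>A. A \<in> \<Omega> \<Longrightarrow> Y A \<le> W"
    and mean: "real (card \<Omega>) / 2 * W \<le> (\<Sum>A\<in>\<Omega>. Y A)" and \<theta>: "0 < \<theta>" and W: "0 \<le> W"
  shows "real (card \<Omega>) / 4 * (W / 4) powr \<theta> \<le> (\<Sum>A\<in>\<Omega>. Y A powr \<theta>)"
proof (cases "W = 0")
  case True
  then show ?thesis using \<theta> by (simp add: sum_nonneg)
next
  case False
  then have W: "0 < W" using W by simp
  define S where "S = {A \<in> \<Omega>. W / 4 \<le> Y A}"
  have S: "finite S" "S \<subseteq> \<Omega>" using \<Omega> by (auto simp: S_def)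
  have "(\<Sum>A\<in>\<Omega>. Y A) = (\<Sum>A\<in>S. Y A) + (\<Sum>A\<in>\<Omega> - S. Y A)"
    using sum.subset_diff[OF S(2) \<Omega>, of Y] by simp
  also have "\<dots> \<le> (\<Sum>A\<in>S. W) + (\<Sum>A\<in>\<Omega> - S. W / 4)"
    by (intro add_mono sum_mono) (auto simp: S_def Y(2))
  also have "\<dots> \<le> real (card S) * W + real (card \<Omega>) * (W / 4)"
    using W \<Omega> card_mono[of \<Omega> "\<Omega> - S"] by (auto intro!: mult_right_mono)
  finally have "real (card \<Omega>) / 4 * W \<le> real (card S) * W" using mean by simp
  then have cS: "real (card \<Omega>) / 4 \<le> real (card S)" using W by simp
  have "real (card \<Omega>) / 4 * (W / 4) powr \<theta> \<le> (\<Sum>A\<in>S. (W / 4) powr \<theta>)"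
    using mult_right_mono[OF cS, of "(W / 4) powr \<theta>"] by simp
  also have "\<dots> \<le> (\<Sum>A\<in>S. Y A powr \<theta>)"
    using W \<theta> by (intro sum_mono powr_mono2) (auto simp: S_def)
  also have "\<dots> \<le> (\<Sum>A\<in>\<Omega>. Y A powr \<theta>)" using S \<Omega> by (intro sum_mono2) auto
  finally show ?thesis .
qed

text \<open>
  The kernel of a lattice point is of full size on its own arc: the arc lies on the circle one level further in, but still within a multiple of
  \<open>K\<^sup>-\<^sup>j\<close> of the lattice point.
\<close>

lemma kernel_on_arc_le:
  assumes K: "2 \<le> K" and j: "1 \<le> j" and \<theta>: "\<theta> \<in> arc (K ^ (j + 2)) l"
  shows "cmod (1 - cnj (lattice_point K j l) * (of_real (radius K (j - 1)) * cis \<theta>)) \<le> (real K + 3) / real K ^ j"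
proof -
  define \<rho> where "\<rho> = radius K (j - 1)"
  define R where "R = radius K j"
  define N where "N = K ^ (j + 2)"
  define \<alpha> where "\<alpha> = 2 * pi * real l / real N"
  obtain i where i: "j = Suc i" using j by (cases j) auto
  have N: "0 < N" using K by (simp add: N_def)
  have rb: "0 \<le> \<rho>" "\<rho> < 1" "0 \<le> R" "R < 1" using radius_bounds[OF K] by (auto simp: \<rho>_def R_def)
  have prod: "0 \<le> R * \<rho>" "R * \<rho> \<le> 1" using rb by (auto intro: mult_le_one)
  have eq: "cnj (lattice_point K j l) * (of_real \<rho> * cis \<theta>) = of_real (R * \<rho>) * cis (\<theta> - \<alpha>)"
    by (simp add: lattice_point_def R_def \<alpha>_def N_def cis_cnj cis_mult)
  have "1 - of_real (R * \<rho>) * cis (\<theta> - \<alpha>) = of_real (1 - R * \<rho>) - of_real (R * \<rho>) * (cis (\<theta> - \<alpha>) - cis 0)"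
    by (simp add: algebra_simps)
  then have "cmod (1 - of_real (R * \<rho>) * cis (\<theta> - \<alpha>))
      \<le> cmod (of_real (1 - R * \<rho>)) + cmod (of_real (R * \<rho>) * (cis (\<theta> - \<alpha>) - cis 0))"
    by (metis norm_triangle_ineq4)
  also have "cmod (of_real (1 - R * \<rho>)) = 1 - R * \<rho>" using prod by (metis abs_of_nonneg diff_ge_0_iff_ge norm_of_real)
  also have "cmod (of_real (R * \<rho>) * (cis (\<theta> - \<alpha>) - cis 0)) = R * \<rho> * cmod (cis (\<theta> - \<alpha>) - cis 0)"
    using rb by (simp add: norm_mult)
  also have "\<dots> \<le> 1 * \<bar>(\<theta> - \<alpha>) - 0\<bar>" using prod by (intro mult_mono norm_cis_diff_le) auto
  also have "\<bar>(\<theta> - \<alpha>) - 0\<bar> \<le> 2 * pi / real N"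
    using \<theta> unfolding arc_def N_def[symmetric] \<alpha>_def by (simp add: add_divide_distrib algebra_simps)
  also have "2 * pi / real N \<le> 2 / real K ^ j" unfolding N_def by (rule arc_length_le[OF K])
  also have "1 - R * \<rho> \<le> (real K + 1) / real K ^ j"
  proof -
    have "1 - R * \<rho> = (1 - R) + R * (1 - \<rho>)" by (simp add: algebra_simps)
    also have "\<dots> \<le> (1 - R) + 1 * (1 - \<rho>)" using rb by (intro add_mono mult_right_mono) auto
    also have "\<dots> = (real K + 1) / real K ^ j" using K by (simp add: R_def \<rho>_def radius_def i add_divide_distrib)
    finally show ?thesis .
  qed
  finally show ?thesis unfolding eq \<rho>_def[symmetric] by (simp add: add_divide_distrib)
qed

text \<open>
  With \<open>x\<close> extremal for \<open>\<beta>\<close>, the embedding inequality is summed over all signs \<open>A\<close> of the test functions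
  \<open>f A\<close>. On each arc only the kernel belonging to that arc is kept in the lower bound.
\<close>

lemma dual_norm2_of_embedding:
  assumes lwo: "lacunary_weight \<omega> K C\<omega> D\<omega>" and lwv: "lacunary_weight \<nu> K C\<nu> D\<nu>"
    and pos: "0 < p" "0 < q" "0 < s" "0 < t"
  shows "\<exists>c>0. \<forall>G B J. G holomorphic_on ball 0 1 \<longrightarrow> 0 < B \<longrightarrow> embedding_bound p q s t n \<omega> \<nu> G B \<longrightarrow> 1 \<le> J \<longrightarrow>
     dual_norm2 p q s t {1..J} (\<lambda>j. {..<K ^ (j + 2)})
        (\<lambda>j l. level_factor p q t n \<omega> \<nu> K j * arc_mean s G (radius K (j - 1)) (K ^ (j + 2)) l) \<le> c * B"
proof -
  interpret O: lacunary_weight \<omega> K C\<omega> D\<omega> by (rule lwo)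
  interpret V: lacunary_weight \<nu> K C\<nu> D\<nu> by (rule lwv)
  note K = O.K
  obtain M E where M: "2 \<le> M" and E: "0 < E" and
    norm: "\<And>f x J. f holomorphic_on ball 0 1 \<Longrightarrow> (\<And>i m. 0 \<le> x i m) \<Longrightarrow>
     (\<And>z. z\<in>ball 0 1 \<Longrightarrow> cmod (f z) \<le> (\<Sum>i=1..J. \<Sum>m<K ^ (i + 2).
          real K powr (real i / p) * O.tail i powr (- (1 / q)) * x i m * bump K i m z ^ M)) \<Longrightarrow>
     (\<Sum>i=1..J. (\<Sum>m<K ^ (i + 2). x i m powr p) powr (q / p)) \<le> 1 \<Longrightarrow> mixed_norm p q \<omega> f \<le> ennreal E"
    using O.test_function_norm_le[OF pos(1,2)] by blast
  define c0 where "c0 = (1 / 2) ^ n / (real K + 3) ^ (M + n)"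
  have c0: "0 < c0" by (simp add: c0_def)
  define k where "k = 1 - 1 / C\<nu>"
  have k: "0 < k" using V.C by (simp add: k_def)
  define c where "c = (4 * 4 powr (t / s) / (k * c0 powr t)) powr (1 / t) * E"
  have c: "0 < c" using c0 k E by (simp add: c_def)
  have "dual_norm2 p q s t {1..J} (\<lambda>j. {..<K ^ (j + 2)})
        (\<lambda>j l. level_factor p q t n \<omega> \<nu> K j * arc_mean s G (radius K (j - 1)) (K ^ (j + 2)) l) \<le> c * B"
    if G: "G holomorphic_on ball 0 1" and B: "0 < B" and emb: "embedding_bound p q s t n \<omega> \<nu> G B" and J: "1 \<le> J"
    for G B J
  proof -
    define b where "b j l = arc_mean s G (radius K (j - 1)) (K ^ (j + 2)) l" for j l
    have b0: "0 \<le> b j l" for j l by (simp add: b_def arc_mean_def)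
    define \<kappa> where "\<kappa> j = level_factor p q t n \<omega> \<nu> K j" for j
    have \<kappa>: "0 < \<kappa> j" for j using K O.tail_pos[of j] V.tail_pos[of j]
      by (simp add: \<kappa>_def level_factor_def O.tail_def V.tail_def)
    define DN where "DN = dual_norm2 p q s t {1..J} (\<lambda>j. {..<K ^ (j + 2)}) (\<lambda>j l. \<kappa> j * b j l)"
    have DN0: "0 \<le> DN"
      unfolding DN_def dual_norm2_def using J b0 \<kappa> K
      by (intro dual_norm_nonneg) (auto simp: less_imp_le lessThan_empty_iff)
    have "\<exists>x. (\<forall>j l. 0 \<le> x j l) \<and> (\<Sum>j=1..J. (\<Sum>l<K ^ (j + 2). x j l powr p) powr (q / p)) \<le> 1 \<and>
       DN powr t \<le> (\<Sum>j=1..J. (\<Sum>l<K ^ (j + 2). (x j l * (\<kappa> j * b j l)) powr s) powr (t / s))"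
      unfolding DN_def using J b0 \<kappa> K pos
      by (intro dual_norm2_attained) (auto simp: less_imp_le lessThan_empty_iff)
    then obtain x where x: "\<And>j l. 0 \<le> x j l" "(\<Sum>j=1..J. (\<Sum>l<K ^ (j + 2). x j l powr p) powr (q / p)) \<le> 1"
      "DN powr t \<le> (\<Sum>j=1..J. (\<Sum>l<K ^ (j + 2). (x j l * (\<kappa> j * b j l)) powr s) powr (t / s))" by blast
    \<comment> \<open>the coefficients of the test functions\<close>
    define y where "y j l = real K powr (real j / p) * O.tail j powr (- (1 / q)) * x j l" for j l
    have y0: "0 \<le> y j l" for j l using x by (simp add: y_def)
    define I where "I = Sigma {1..J} (\<lambda>j. {..<K ^ (j + 2)})"
    have I: "finite I" by (simp add: I_def)
    define a where "a i = cnj (lattice_point K (fst i) (snd i))" for i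
    have a1: "cmod (a i) < 1" for i using radius_bounds[OF K, of "fst i"] by (simp add: a_def norm_lattice_point[OF K])
    have ne: "1 - a i * z \<noteq> 0" if "z \<in> ball 0 1" for i z
    proof -
      have "cmod (a i * z) \<le> 1 * cmod z" unfolding norm_mult using a1[of i] by (intro mult_right_mono) auto
      then have "cmod (a i * z) < 1" using that by simp
      then show ?thesis by (rule one_minus_neq_0)
    qed
    define co :: "nat \<times> nat \<Rightarrow> complex" where "co i = of_real (y (fst i) (snd i) * (1 / real K ^ fst i) ^ M)" for i
    define sg :: "(nat \<times> nat) set \<Rightarrow> nat \<times> nat \<Rightarrow> complex" where "sg A i = (if i \<in> A then 1 else - 1)" for A i
    define f where "f A z = (\<Sum>i\<in>I. (sg A i * co i) * inverse (1 - a i * z) ^ M)" for A z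
    define v where "v z i = co i * (pochhammer (of_nat M) n * a i ^ n * inverse (1 - a i * z) ^ (M + n))" for z i
    have fh: "f A holomorphic_on ball 0 1" for A
      unfolding f_def by (intro holomorphic_intros) (use ne in auto)
    have fn: "mixed_norm p q \<omega> (f A) \<le> ennreal E" for A
    proof (rule norm[OF fh x(1) _ x(2)])
      fix z :: complex assume z: "z \<in> ball 0 1"
      have "cmod (f A z) \<le> (\<Sum>i\<in>I. cmod (sg A i * co i * inverse (1 - a i * z) ^ M))"
        unfolding f_def by (rule norm_sum)
      also have "\<dots> = (\<Sum>i\<in>I. y (fst i) (snd i) * bump K (fst i) (snd i) z ^ M)"
      proof (intro sum.cong refl)
        fix i
        have 1: "cmod (sg A i) = 1" by (simp add: sg_def)
        have 2: "cmod (co i) = y (fst i) (snd i) * (1 / real K ^ fst i) ^ M"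
          unfolding co_def norm_of_real using y0 by (intro abs_of_nonneg mult_nonneg_nonneg) auto
        have 3: "bump K (fst i) (snd i) z = (1 / real K ^ fst i) * inverse (cmod (1 - a i * z))"
          by (simp add: bump_def a_def divide_inverse)
        show "cmod (sg A i * co i * inverse (1 - a i * z) ^ M) = y (fst i) (snd i) * bump K (fst i) (snd i) z ^ M"
          unfolding norm_mult norm_power norm_inverse 1 2 3 power_mult_distrib by simp
      qed
      also have "\<dots> = (\<Sum>j=1..J. \<Sum>l<K ^ (j + 2). y j l * bump K j l z ^ M)"
        unfolding I_def by (subst sum.Sigma) (auto simp: case_prod_unfold)
      finally show "cmod (f A z) \<le> (\<Sum>i=1..J. \<Sum>m<K ^ (i + 2).
          real K powr (real i / p) * O.tail i powr (- (1 / q)) * x i m * bump K i m z ^ M)"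
        by (simp add: y_def)
    qed
    define F where "F A = (deriv ^^ n) (f A)" for A
    have Fh: "F A holomorphic_on ball 0 1" for A unfolding F_def by (intro holomorphic_higher_deriv fh) auto
    have FG: "(\<lambda>z. F A z * G z) holomorphic_on ball 0 1" for A by (intro holomorphic_intros Fh G)
    have Fv: "F A z = sign_sum I (v z) A" if "z \<in> ball 0 1" for A z
      unfolding F_def f_def using higher_deriv_kernel_sum[where I = I and b = a and c = "\<lambda>i. sg A i * co i" and M = M and n = n, OF a1 that]
      by (simp add: sign_sum_def v_def sg_def mult.assoc)
    define X where "X A j = circle_mean (\<lambda>z. cmod (F A z * G z) powr s) (radius K (j - 1))" for A j
    have X0: "0 \<le> X A j" for A j unfolding X_def by (intro circle_mean_nonneg) auto
    have upper: "k * (\<Sum>j=1..J. V.tail j * X A j powr (t / s)) \<le> (B * E) powr t" for A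
    proof -
      let ?Int = "\<integral>\<^sup>+r\<in>{0..<1}. ennreal (circle_mean (\<lambda>z. cmod (F A z * G z) powr s) r powr (t / s) * \<nu> r) \<partial>lebesgue"
      have "f A \<in> mixed_space p q \<omega>"
        using fh fn[of A] by (auto simp: mixed_space_def intro: le_less_trans)
      then have "epowr ?Int (1 / t) \<le> ennreal B * mixed_norm p q \<omega> (f A)"
        using emb unfolding embedding_bound_def product_mean[of "(deriv ^^ n) _" _ s G] F_def by blast
      also have "\<dots> \<le> ennreal B * ennreal E" by (intro mult_left_mono fn) simp
      also have "\<dots> = ennreal (B * E)" using B E by (simp add: ennreal_mult)
      finally have "epowr (epowr ?Int (1 / t)) (1 / (1 / t)) \<le> epowr (ennreal (B * E)) (1 / (1 / t))"
        using pos by (intro epowr_mono) auto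
      then have Int: "?Int \<le> ennreal ((B * E) powr t)"
        using pos B E by (subst (asm) epowr_epowr_inverse) (auto simp: epowr_ennreal)
      \<comment> \<open>the mean at \<open>r\<^sub>j\<^sub>-\<^sub>1\<close> bounds the one on the annulus \<open>j - 1\<close> from below, whose mass dominates the tail at \<open>r\<^sub>j\<close>\<close>
      have "(\<Sum>j=1..J. V.tail j * X A j powr (t / s)) \<le> (\<Sum>j=1..J. V.tail (j - 1) * X A j powr (t / s))"
      proof (intro sum_mono mult_right_mono)
        fix j assume "j \<in> {1..J}"
        then show "V.tail j \<le> V.tail (j - 1)" using V.tail_Suc_le[of "j - 1"] by simp
      qed auto
      also have "\<dots> = (\<Sum>i\<in>(\<lambda>j. j - 1) ` {1..J}. V.tail i * circle_mean (\<lambda>z. cmod (F A z * G z) powr s) (radius K i) powr (t / s))"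
        by (subst sum.reindex) (auto simp: inj_on_def X_def)
      finally have "k * (\<Sum>j=1..J. V.tail j * X A j powr (t / s))
         \<le> k * (\<Sum>i\<in>(\<lambda>j. j - 1) ` {1..J}. V.tail i * circle_mean (\<lambda>z. cmod (F A z * G z) powr s) (radius K i) powr (t / s))"
        using k by simp
      then have "ennreal (k * (\<Sum>j=1..J. V.tail j * X A j powr (t / s))) \<le> ?Int"
        using sum_levels_le_integral[OF lwv FG pos(3,4), of "(\<lambda>j. j - 1) ` {1..J}" A]
        unfolding k_def V.tail_def by (meson ennreal_leI finite_atLeastAtMost finite_imageI order_trans)
      then have "ennreal (k * (\<Sum>j=1..J. V.tail j * X A j powr (t / s))) \<le> ennreal ((B * E) powr t)"
        using Int by (rule order_trans)
      then show ?thesis by simp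
    qed
    \<comment> \<open>a lower bound for the derivative of the kernel \<open>(j, l)\<close> on the arc \<open>l\<close>\<close>
    define cc where "cc j l = c0 * real K ^ (j * n) * y j l" for j l
    have cc0: "0 \<le> cc j l" for j l using c0 y0 by (simp add: cc_def)
    define W where "W j = (\<Sum>l<K ^ (j + 2). (cc j l * b j l) powr s)" for j
    have W0: "0 \<le> W j" for j by (simp add: W_def sum_nonneg)
    have lower: "real (card (Pow I)) / 4 * (W j / 4) powr (t / s) \<le> (\<Sum>A\<in>Pow I. X A j powr (t / s))"
      if j: "j \<in> {1..J}" for j
    proof -
      define \<rho> where "\<rho> = radius K (j - 1)"
      define N where "N = K ^ (j + 2)"
      have \<rho>: "0 \<le> \<rho>" "\<rho> < 1" using radius_bounds[OF K] by (auto simp: \<rho>_def)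
      have N: "0 < N" using K by (simp add: N_def)
      have j1: "1 \<le> j" using j by simp
      have Gc: "continuous_on (ball 0 1) G" using G holomorphic_on_imp_continuous_on by blast
      define g where "g \<theta> = cmod (G (of_real \<rho> * cis \<theta>)) powr s / (2 * pi)" for \<theta>
      have g0: "0 \<le> g \<theta>" for \<theta> by (simp add: g_def)
      have gc: "continuous_on S g" for S
        unfolding g_def by (intro continuous_on_divide powr_norm_circle_continuous[OF G \<rho> pos(3)]) auto
      have bg: "b j l powr s = integral (arc N l) g" for l
        unfolding b_def g_def \<rho>_def[symmetric] N_def[symmetric] by (rule arc_mean_powr[OF pos(3) Gc \<rho>])
      define \<phi> where "\<phi> A l \<theta> = min (cmod (F A (of_real \<rho> * cis \<theta>))) (cc j l) powr s * g \<theta>" for A l \<theta>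
      have \<phi>c: "continuous_on S (\<phi> A l)" for S A l
      proof -
        have "continuous_on S (\<lambda>\<theta>. F A (of_real \<rho> * cis \<theta>))"
        proof (rule continuous_on_circle)
          have "F A holomorphic_on sphere 0 \<rho>" by (rule holomorphic_on_subset[OF Fh]) (use \<rho> in auto)
          then show "continuous_on (sphere 0 \<rho>) (F A)" by (rule holomorphic_on_imp_continuous_on)
        qed (rule \<rho>(1))
        then have "continuous_on S (\<lambda>\<theta>. min (cmod (F A (of_real \<rho> * cis \<theta>))) (cc j l))"
          by (intro continuous_intros)
        then show ?thesis unfolding \<phi>_def using pos cc0
          by (intro continuous_on_mult gc continuous_on_powr' continuous_on_const) auto
      qed
      have \<phi>i: "\<phi> A l integrable_on arc N l" for A l unfolding arc_def by (intro integrable_continuous_real \<phi>c)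
      have gi: "g integrable_on arc N l" for l unfolding arc_def by (intro integrable_continuous_real gc)
      define Y where "Y A = (\<Sum>l<N. integral (arc N l) (\<phi> A l))" for A
      have Y0: "0 \<le> Y A" for A unfolding Y_def
        by (intro sum_nonneg Henstock_Kurzweil_Integration.integral_nonneg \<phi>i) (simp add: \<phi>_def g0)
      have YX: "Y A \<le> X A j" for A
      proof -
        have "X A j = (\<Sum>l<N. integral (arc N l) (\<lambda>\<theta>. cmod (F A (of_real \<rho> * cis \<theta>) * G (of_real \<rho> * cis \<theta>)) powr s / (2 * pi)))"
          unfolding X_def \<rho>_def[symmetric] by (rule circle_mean_arcs[OF FG \<rho> pos(3) N])
        moreover have "integral (arc N l) (\<phi> A l) \<le> integral (arc N l) (\<lambda>\<theta>. cmod (F A (of_real \<rho> * cis \<theta>) * G (of_real \<rho> * cis \<theta>)) powr s / (2 * pi))" for l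
        proof (rule integral_le[OF \<phi>i])
          show "(\<lambda>\<theta>. cmod (F A (of_real \<rho> * cis \<theta>) * G (of_real \<rho> * cis \<theta>)) powr s / (2 * pi)) integrable_on arc N l"
            unfolding arc_def using powr_norm_circle_continuous[OF FG \<rho> pos(3)]
            by (intro integrable_continuous_real continuous_on_divide) auto
          fix \<theta>
          have "min (cmod (F A (of_real \<rho> * cis \<theta>))) (cc j l) powr s \<le> cmod (F A (of_real \<rho> * cis \<theta>)) powr s"
            using pos cc0 by (intro powr_mono2) auto
          from mult_right_mono[OF this g0[of \<theta>]]
          show "\<phi> A l \<theta> \<le> cmod (F A (of_real \<rho> * cis \<theta>) * G (of_real \<rho> * cis \<theta>)) powr s / (2 * pi)"
            by (simp add: \<phi>_def g_def norm_mult powr_mult)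
        qed
        ultimately show ?thesis unfolding Y_def by (simp add: sum_mono)
      qed
      have Wg: "W j = (\<Sum>l<N. integral (arc N l) (\<lambda>\<theta>. cc j l powr s * g \<theta>))"
        unfolding W_def N_def[symmetric] using cc0 b0 by (simp add: powr_mult bg)
      have YW: "Y A \<le> W j" for A
        unfolding Y_def Wg
      proof (intro sum_mono integral_le \<phi>i)
        fix l show "(\<lambda>\<theta>. cc j l powr s * g \<theta>) integrable_on arc N l"
          unfolding arc_def by (intro integrable_continuous_real continuous_on_mult_left gc)
        fix \<theta> show "\<phi> A l \<theta> \<le> cc j l powr s * g \<theta>"
          unfolding \<phi>_def using pos cc0 g0 by (intro mult_right_mono powr_mono2) auto
      qed
      have vge: "cc j l \<le> cmod (v (of_real \<rho> * cis \<theta>) (j, l))" if th: "\<theta> \<in> arc N l" for l \<theta>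
      proof -
        define z where "z = of_real \<rho> * cis \<theta>"
        define d where "d = cmod (1 - a (j, l) * z)"
        have zb: "z \<in> ball 0 1" using \<rho> by (simp add: z_def norm_mult)
        have d0: "0 < d" using ne[OF zb] by (simp add: d_def)
        have dle: "d \<le> (real K + 3) / real K ^ j"
          using kernel_on_arc_le[OF K j1, of \<theta> l] th by (simp add: d_def a_def z_def \<rho>_def N_def)
        have r2: "1 / 2 \<le> radius K j" by (rule radius_ge_half[OF K j1])
        have poch: "1 \<le> cmod (pochhammer (of_nat M) n :: complex)"
        proof -
          have "cmod (pochhammer (of_nat M) n :: complex) = real (pochhammer M n)"
            by (metis pochhammer_of_nat norm_of_nat)
          moreover have "1 \<le> pochhammer M n" using pochhammer_pos[of M n] M by simp
          ultimately show ?thesis by simp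
        qed
        have "cc j l = y j l * (1 / real K ^ j) ^ M * ((1 / 2) ^ n * inverse ((real K + 3) / real K ^ j) ^ (M + n))"
          using K by (simp add: cc_def c0_def power_add power_mult power_divide power_one_over field_simps)
        also have "\<dots> \<le> y j l * (1 / real K ^ j) ^ M * ((cmod (pochhammer (of_nat M) n :: complex) * radius K j ^ n) * inverse d ^ (M + n))"
        proof (intro mult_left_mono mult_mono power_mono)
          have "1 * (1 / 2) ^ n \<le> cmod (pochhammer (of_nat M) n :: complex) * radius K j ^ n"
            using poch r2 by (intro mult_mono power_mono) auto
          then show "(1 / 2) ^ n \<le> cmod (pochhammer (of_nat M) n :: complex) * radius K j ^ n" by simp
          show "inverse ((real K + 3) / real K ^ j) \<le> inverse d" using dle d0 by (rule le_imp_inverse_le)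
        qed (use y0 r2 K in auto)
        also have "\<dots> = cmod (v z (j, l))"
        proof -
          have 1: "cmod (co (j, l)) = y j l * (1 / real K ^ j) ^ M"
            unfolding co_def norm_of_real fst_conv snd_conv using y0 by (intro abs_of_nonneg mult_nonneg_nonneg) auto
          have 2: "cmod (a (j, l)) = radius K j" by (simp add: a_def norm_lattice_point[OF K])
          show ?thesis unfolding v_def norm_mult norm_power norm_inverse 1 2 d_def[symmetric] by simp
        qed
        finally show ?thesis by (simp add: z_def)
      qed
      have mean: "real (card (Pow I)) / 2 * W j \<le> (\<Sum>A\<in>Pow I. Y A)"
      proof -
        have "(\<Sum>A\<in>Pow I. Y A) = (\<Sum>l<N. \<Sum>A\<in>Pow I. integral (arc N l) (\<phi> A l))"
          unfolding Y_def by (rule sum.swap)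
        also have "\<dots> = (\<Sum>l<N. integral (arc N l) (\<lambda>\<theta>. \<Sum>A\<in>Pow I. \<phi> A l \<theta>))"
          using I \<phi>i by (intro sum.cong refl integral_sum[symmetric]) auto
        also have "\<dots> \<ge> (\<Sum>l<N. integral (arc N l) (\<lambda>\<theta>. real (card (Pow I)) / 2 * (cc j l powr s * g \<theta>)))"
        proof (intro sum_mono integral_le)
          fix l assume l: "l \<in> {..<N}"
          show "(\<lambda>\<theta>. real (card (Pow I)) / 2 * (cc j l powr s * g \<theta>)) integrable_on arc N l"
            unfolding arc_def by (intro integrable_continuous_real continuous_on_mult_left gc)
          show "(\<lambda>\<theta>. \<Sum>A\<in>Pow I. \<phi> A l \<theta>) integrable_on arc N l"
            unfolding arc_def by (intro integrable_continuous_real continuous_on_sum \<phi>c)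
          fix \<theta> assume th: "\<theta> \<in> arc N l"
          have zb: "of_real \<rho> * cis \<theta> \<in> ball 0 1" using \<rho> by (simp add: norm_mult)
          have "(j, l) \<in> I" using j l by (simp add: I_def N_def)
          from average_sign_sum_ge[where v = "v (of_real \<rho> * cis \<theta>)", OF I this cc0[of j l] vge[OF th] pos(3)]
          have "real (card (Pow I)) / 2 * cc j l powr s \<le> (\<Sum>A\<in>Pow I. min (cmod (F A (of_real \<rho> * cis \<theta>))) (cc j l) powr s)"
            by (simp add: Fv[OF zb])
          from mult_right_mono[OF this g0[of \<theta>]]
          show "real (card (Pow I)) / 2 * (cc j l powr s * g \<theta>) \<le> (\<Sum>A\<in>Pow I. \<phi> A l \<theta>)"
            by (simp add: \<phi>_def sum_distrib_right mult.assoc)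
        qed
        also have "(\<Sum>l<N. integral (arc N l) (\<lambda>\<theta>. real (card (Pow I)) / 2 * (cc j l powr s * g \<theta>))) = real (card (Pow I)) / 2 * W j"
          unfolding Wg sum_distrib_left by simp
        finally show ?thesis .
      qed
      have "real (card (Pow I)) / 4 * (W j / 4) powr (t / s) \<le> (\<Sum>A\<in>Pow I. Y A powr (t / s))"
        using I Y0 YW mean pos W0 by (intro sum_powr_ge_of_large_mean) auto
      also have "\<dots> \<le> (\<Sum>A\<in>Pow I. X A j powr (t / s))"
        using Y0 YX pos by (intro sum_mono powr_mono2) auto
      finally show ?thesis .
    qed
    have card0: "0 < real (card (Pow I))" using I by (simp add: card_Pow)
    have "real (card (Pow I)) * (k / 4 * (\<Sum>j=1..J. V.tail j * (W j / 4) powr (t / s)))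
        = k * (\<Sum>j=1..J. V.tail j * (real (card (Pow I)) / 4 * (W j / 4) powr (t / s)))"
      by (simp add: sum_distrib_left mult_ac)
    also have "\<dots> \<le> k * (\<Sum>j=1..J. V.tail j * (\<Sum>A\<in>Pow I. X A j powr (t / s)))"
      using k V.tail_pos by (intro mult_left_mono sum_mono lower) (auto simp: less_imp_le)
    also have "\<dots> = (\<Sum>A\<in>Pow I. k * (\<Sum>j=1..J. V.tail j * X A j powr (t / s)))"
      unfolding sum_distrib_left by (rule sum.swap)
    also have "\<dots> \<le> real (card (Pow I)) * (B * E) powr t"
      using sum_mono[of "Pow I" "\<lambda>A. k * (\<Sum>j=1..J. V.tail j * X A j powr (t / s))" "\<lambda>_. (B * E) powr t"] upper by simp
    finally have avg: "k / 4 * (\<Sum>j=1..J. V.tail j * (W j / 4) powr (t / s)) \<le> (B * E) powr t" using card0 by simp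
    have Weq: "V.tail j * (W j / 4) powr (t / s)
        = c0 powr t / 4 powr (t / s) * (\<Sum>l<K ^ (j + 2). (x j l * (\<kappa> j * b j l)) powr s) powr (t / s)" for j
    proof -
      define Z where "Z = (\<Sum>l<K ^ (j + 2). (x j l * (\<kappa> j * b j l)) powr s)"
      have Z0: "0 \<le> Z" by (simp add: Z_def sum_nonneg)
      have e: "V.tail j powr (1 / t) * (cc j l * b j l) = c0 * (x j l * (\<kappa> j * b j l))" for l
      proof -
        have "real K ^ (j * n) * real K powr (real j / p) = real K powr (real j * (real n + 1 / p))"
          using K by (simp add: powr_realpow[symmetric] powr_add[symmetric] algebra_simps)
        then have "\<kappa> j = real K ^ (j * n) * real K powr (real j / p) * V.tail j powr (1 / t) * O.tail j powr (- (1 / q))"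
          by (simp add: \<kappa>_def level_factor_def V.tail_def O.tail_def)
        then show ?thesis by (simp add: cc_def y_def)
      qed
      have "V.tail j powr (s / t) * W j = c0 powr s * Z"
        unfolding W_def Z_def sum_distrib_left
      proof (intro sum.cong refl)
        fix l
        have "V.tail j powr (s / t) * (cc j l * b j l) powr s = (V.tail j powr (1 / t) * (cc j l * b j l)) powr s"
          using V.tail_pos[of j] cc0 b0 by (simp add: powr_mult powr_powr)
        also have "\<dots> = c0 powr s * (x j l * (\<kappa> j * b j l)) powr s"
          unfolding e using c0 x b0 \<kappa>[of j] by (simp add: powr_mult less_imp_le)
        finally show "V.tail j powr (s / t) * (cc j l * b j l) powr s = c0 powr s * (x j l * (\<kappa> j * b j l)) powr s" .
      qed
      then have "(V.tail j powr (s / t) * W j / 4) powr (t / s) = (c0 powr s * Z / 4) powr (t / s)" by simp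
      then show ?thesis using V.tail_pos[of j] W0[of j] Z0 c0 pos
        by (simp add: powr_mult powr_divide powr_powr Z_def)
    qed
    have "k / 4 * (c0 powr t / 4 powr (t / s)) * DN powr t
       \<le> k / 4 * (c0 powr t / 4 powr (t / s)) * (\<Sum>j=1..J. (\<Sum>l<K ^ (j + 2). (x j l * (\<kappa> j * b j l)) powr s) powr (t / s))"
      using k by (intro mult_left_mono x(3)) auto
    also have "\<dots> = k / 4 * (\<Sum>j=1..J. V.tail j * (W j / 4) powr (t / s))"
      unfolding Weq by (simp add: sum_distrib_left mult_ac)
    finally have "k / 4 * (c0 powr t / 4 powr (t / s)) * DN powr t \<le> (B * E) powr t" using avg by linarith
    then have "DN powr t \<le> (4 * 4 powr (t / s) / (k * c0 powr t)) * (B * E) powr t"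
      using k c0 by (simp add: field_simps)
    also have "\<dots> = (c * B) powr t"
      using k c0 B E pos by (simp add: c_def powr_mult powr_powr mult_ac)
    finally have "(DN powr t) powr (1 / t) \<le> ((c * B) powr t) powr (1 / t)" using pos by (intro powr_mono2[of "1 / t"]) auto
    then have "DN \<le> c * B" using pos DN0 c B by (simp add: powr_powr)
    then show ?thesis by (simp add: DN_def \<kappa>_def b_def)
  qed
  then show ?thesis using c by (intro exI[of _ c]) blast
qed

theorem proposition3p3:
  fixes p q s t :: real and n :: nat
    and \<omega> \<nu> :: "real \<Rightarrow> real"
    and K\<omega> K\<nu> K :: nat and C\<omega> C\<nu> :: real
  assumes "0 < p" "0 < q" "0 < s" "0 < t"
    and "\<omega> \<in> D_class" "\<nu> \<in> D_class"
    and "K\<omega> \<ge> 2" "C\<omega> > 1"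
    and "\<And>r. 0 \<le> r \<Longrightarrow> r < 1 \<Longrightarrow>
           weight_tail \<omega> r \<ge> C\<omega> * weight_tail \<omega> (1 - (1 - r) / real K\<omega>)"
    and "K\<nu> \<ge> 2" "C\<nu> > 1"
    and "\<And>r. 0 \<le> r \<Longrightarrow> r < 1 \<Longrightarrow>
           weight_tail \<nu> r \<ge> C\<nu> * weight_tail \<nu> (1 - (1 - r) / real K\<nu>)"
    and "K = max K\<omega> K\<nu>"
  shows "(\<forall>G. G holomorphic_on ball 0 1 \<longrightarrow>
            ((\<exists>C>0. embedding_bound p q s t n \<omega> \<nu> G C) \<longleftrightarrow>
             weighted_arc_means p q s t n \<omega> \<nu> K G
               \<in> lpq_space (ennreal s * conj_exponent (p / s)) (ennreal t * conj_exponent (q / t))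
                   {1..} (\<lambda>j. {..<K ^ (j + 2)})))
       \<and> (\<exists>c>0. \<forall>G. G holomorphic_on ball 0 1 \<longrightarrow>
            (let N = lpq_norm (ennreal s * conj_exponent (p / s)) (ennreal t * conj_exponent (q / t))
                       {1..} (\<lambda>j. {..<K ^ (j + 2)})
                       (weighted_arc_means p q s t n \<omega> \<nu> K G);
                 B = Inf (ennreal ` {C. C > 0 \<and> embedding_bound p q s t n \<omega> \<nu> G C})
             in ennreal (1 / c) * N \<le> B \<and> B \<le> ennreal c * N))"
proof -
  have K: "2 \<le> K" "K\<omega> \<le> K" "K\<nu> \<le> K" using assms by auto
  obtain D\<omega> where lwo: "lacunary_weight \<omega> K C\<omega> D\<omega>"
    using lacunary_weight_D_class[OF assms(5) assms(7) K(2) assms(8) assms(9)] by blast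
  obtain D\<nu> where lwv: "lacunary_weight \<nu> K C\<nu> D\<nu>"
    using lacunary_weight_D_class[OF assms(6) assms(10) K(3) assms(11) assms(12)] by blast
  define L where "L = (\<lambda>j::nat. {..<K ^ (j + 2)})"
  define \<beta> where "\<beta> G j l = level_factor p q t n \<omega> \<nu> K j * arc_mean s G (radius K (j - 1)) (K ^ (j + 2)) l" for G j l
  define N where "N G = lpq_norm (ennreal s * conj_exponent (p / s)) (ennreal t * conj_exponent (q / t))
                       {1..} L (weighted_arc_means p q s t n \<omega> \<nu> K G)" for G
  let ?emb = "embedding_bound p q s t n \<omega> \<nu>"
  have wam: "weighted_arc_means p q s t n \<omega> \<nu> K G = (\<lambda>j l. of_real (\<beta> G j l))" for G
    by (simp add: weighted_arc_means_def \<beta>_def level_factor_def fun_eq_iff)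
  have \<beta>0: "0 \<le> \<beta> G j l" for G j l by (simp add: \<beta>_def level_factor_def arc_mean_def)
  have iff: "N G \<le> x \<longleftrightarrow> (\<forall>J\<ge>1. ennreal (dual_norm2 p q s t {1..J} L (\<beta> G)) \<le> x)" for G x
    unfolding N_def wam
    by (rule lpq_norm_le_iff_dual_norm2) (use K assms \<beta>0 in \<open>auto simp: L_def lessThan_empty_iff\<close>)
  obtain c1 where c1: "0 < c1" "\<And>G x B. G holomorphic_on ball 0 1 \<Longrightarrow> 0 \<le> x \<Longrightarrow> 0 < B \<Longrightarrow> c1 * x \<le> B \<Longrightarrow>
     (\<And>J. 1 \<le> J \<Longrightarrow> dual_norm2 p q s t {1..J} L (\<beta> G) \<le> x) \<Longrightarrow> ?emb G B"
    using embedding_of_dual_norm2[OF lwo lwv assms(1-4), of n] unfolding L_def \<beta>_def by blast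
  obtain c2 where c2: "0 < c2" "\<And>G B J. G holomorphic_on ball 0 1 \<Longrightarrow> 0 < B \<Longrightarrow> ?emb G B \<Longrightarrow> 1 \<le> J \<Longrightarrow>
     dual_norm2 p q s t {1..J} L (\<beta> G) \<le> c2 * B"
    using dual_norm2_of_embedding[OF lwo lwv assms(1-4), of n] unfolding L_def \<beta>_def by blast
  have suff: "?emb G B" if "G holomorphic_on ball 0 1" "N G \<le> ennreal x" "0 \<le> x" "0 < B" "c1 * x \<le> B" for G x B
    using that(2) iff[of G "ennreal x"] that(3) by (intro c1(2)[OF that(1,3-5)]) simp
  have nec: "N G \<le> ennreal (c2 * B)" if "G holomorphic_on ball 0 1" "0 < B" "?emb G B" for G B
    unfolding iff using c2(2)[OF that] by (auto intro: ennreal_leI)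
  define c where "c = max c1 c2"
  have c: "0 < c" "c1 \<le> c" "c2 \<le> c" using c1 by (auto simp: c_def)
  have equiv: "(\<exists>C>0. ?emb G C) \<longleftrightarrow> N G < top" if G: "G holomorphic_on ball 0 1" for G
  proof
    assume "\<exists>C>0. ?emb G C"
    then show "N G < top" using nec[OF G] by (meson ennreal_less_top le_less_trans)
  next
    assume "N G < top"
    then obtain x where x: "N G = ennreal x" "0 \<le> x" by (cases "N G") auto
    then show "\<exists>C>0. ?emb G C" using suff[OF G, of x "c1 * x + 1"] c1(1)
      by (intro exI[of _ "c1 * x + 1"]) (simp add: add_nonneg_pos)
  qed
  have compare: "ennreal (1 / c) * N G \<le> Inf (ennreal ` {C. C > 0 \<and> ?emb G C})"
       "Inf (ennreal ` {C. C > 0 \<and> ?emb G C}) \<le> ennreal c * N G"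
    if G: "G holomorphic_on ball 0 1" for G
  proof -
    show "ennreal (1 / c) * N G \<le> Inf (ennreal ` {C. C > 0 \<and> ?emb G C})"
    proof (rule Inf_greatest)
      fix y assume "y \<in> ennreal ` {C. C > 0 \<and> ?emb G C}"
      then obtain C where C: "y = ennreal C" "0 < C" "?emb G C" by auto
      have "N G \<le> ennreal (c2 * C)" by (rule nec[OF G C(2,3)])
      also have "\<dots> \<le> ennreal (c * C)" using c C by (intro ennreal_leI mult_right_mono) auto
      finally have "ennreal (1 / c) * N G \<le> ennreal (1 / c) * ennreal (c * C)" by (intro mult_left_mono) auto
      also have "\<dots> = y" using c C by (simp add: ennreal_mult'[symmetric])
      finally show "ennreal (1 / c) * N G \<le> y" .
    qed
    show "Inf (ennreal ` {C. C > 0 \<and> ?emb G C}) \<le> ennreal c * N G"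
    proof (cases "N G = top")
      case True
      then show ?thesis using c by (simp add: ennreal_mult_top)
    next
      case False
      then obtain x where x: "N G = ennreal x" "0 \<le> x" by (cases "N G") auto
      show ?thesis
      proof (rule ennreal_le_epsilon)
        fix e :: real assume e: "0 < e"
        have "c1 * x \<le> c * x" using c x by (intro mult_right_mono) auto
        moreover have "0 \<le> c * x" using c x by simp
        ultimately have "?emb G (c * x + e)" using x e by (intro suff[OF G, of x]) auto
        then have "Inf (ennreal ` {C. C > 0 \<and> ?emb G C}) \<le> ennreal (c * x + e)"
          using e \<open>0 \<le> c * x\<close> by (intro Inf_lower imageI) auto
        also have "\<dots> = ennreal c * N G + ennreal e" using c x e by (simp add: ennreal_mult)
        finally show "Inf (ennreal ` {C. C > 0 \<and> ?emb G C}) \<le> ennreal c * N G + ennreal e" .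
      qed
    qed
  qed
  show ?thesis
    unfolding lpq_space_def mem_Collect_eq Let_def L_def[symmetric] N_def[symmetric]
    using equiv compare c(1) by blast
qed

end
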